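(* Let $\alpha>0$, let $w\in A^{\mathrm{restricted}}_{\infty}$, and let $\varphi,\psi$ be entire functions on $\mathbb{C}$. For $r>0$ and $z\in\mathbb{C}$ put $$\Phi_r(z):=\frac{1}{w(D(z,r))}\int_{\varphi^{-1}(D(z,r))}|\psi(\xi)|^2e^{-\alpha(|\xi|^2-|\varphi(\xi)|^2)}w(\xi)\,dA(\xi).$$ Then there exists $\delta\in(0,1)$ such that (1) $W_{\varphi,\psi}$ is bounded on $F^2_{\alpha,w}$ if and only if for some (or any) $r\in(0,\delta)$, $\sup_{z\in\mathbb{C}}\Phi_r(z)<\infty$; (2) $W_{\varphi,\psi}$ is compact on $F^2_{\alpha,w}$ if and only if for some (or any) $r\in(0,\delta)$, $\lim_{|z|\to\infty}\Phi_r(z)=0$; (3) for $p\geq2$, $W_{\varphi,\psi}\in \mathcal{S}_p(F^2_{\alpha,w})$ if and only if for some (or any) $r\in(0,\delta)$, the function $z\mapsto\Phi_r(z)$ belongs to $L^{p/2}(\mathbb{C},dA)$.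
   Context: A weight is a non-negative locally integrable function $w$ on $\mathbb{C}$; $dA$ (and $A(\cdot)$) is Lebesgue measure on $\mathbb{C}$; $w(E):=\int_E w\,dA$; $D(z,r)$ is the disk with center $z$ and radius $r$. Squares $Q\subset\mathbb{C}$ have sides parallel to the axes, with side length $\ell(Q)$. For $1<q<\infty$ with $1/q+1/q'=1$, $w\in A_q^{\mathrm{restricted}}$ if for some (or any) fixed $r>0$, $\sup_{\ell(Q)=r}\big(\frac1{A(Q)}\int_Q w\,dA\big)\big(\frac1{A(Q)}\int_Q w^{-q'/q}dA\big)^{q/q'}<\infty$; $w\in A_1^{\mathrm{restricted}}$ if for some (or any) fixed $r>0$, $\sup_{\ell(Q)=r}\big(\frac1{A(Q)}\int_Q w\,dA\big)\|w^{-1}\|_{L^\infty(Q)}<\infty$. Set $A_\infty^{\mathrm{restricted}}:=\bigcup_{1\le q<\infty}A_q^{\mathrm{restricted}}$. $F^2_{\alpha,w}$ is the Hilbert space of entire functions $f$ with $\|f\|^2_{F^2_{\alpha,w}}=\int_{\mathbb{C}}|f(z)|^2e^{-\alpha|z|^2}w(z)\,dA(z)<\infty$. The weighted composition operator is $W_{\varphi,\psi}f:=\psi\cdot (f\circ\varphi)$. A compact operator $T$ on a separable Hilbert space $H$ with singular values $\{s_n(T)\}$ is in the Schatten class $\mathcal{S}_p(H)$ if $\sum_n s_n(T)^p<\infty$.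
   Formalization: In (2) the condition lim Φ_r(z)=0 is taken to include Φ_r(z)<∞ for every z; without this the claim fails, e.g. for φ constant and ψ not in F²_{α,w}, where Φ_r vanishes near infinity but W is unbounded. *)

theory Defs
  imports
    "HOL-Complex_Analysis.Complex_Analysis"
    "HOL-Probability.Essential_Supremum"
    "HOL-Library.Function_Algebras"
begin

section \<open>Weights and restricted Muckenhoupt classes\<close>

definition is_weight :: "(complex \<Rightarrow> real) \<Rightarrow> bool" where
  "is_weight w \<longleftrightarrow> (\<forall>z. 0 \<le> w z) \<and> (\<forall>K. compact K \<longrightarrow> set_integrable lebesgue K w)"

definition weight_measure :: "(complex \<Rightarrow> real) \<Rightarrow> complex set \<Rightarrow> ennreal" where
  "weight_measure w E = (\<integral>\<^sup>+z\<in>E. ennreal (w z) \<partial>lebesgue)"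

definition axis_square :: "complex \<Rightarrow> real \<Rightarrow> complex set" where
  "axis_square a l = cbox a (a + Complex l l)"

definition set_average :: "complex set \<Rightarrow> (complex \<Rightarrow> ennreal) \<Rightarrow> ennreal" where
  "set_average Q f = (\<integral>\<^sup>+z\<in>Q. f z \<partial>lebesgue) / emeasure lebesgue Q"

text \<open>Real powers on \<open>[0, \<infinity>]\<close>; only used for positive exponents.\<close>

definition ennreal_rpow :: "ennreal \<Rightarrow> real \<Rightarrow> ennreal" where
  "ennreal_rpow x s = (if x = \<infinity> then \<infinity> else ennreal (enn2real x powr s))"

definition conj_exponent :: "real \<Rightarrow> real" where
  "conj_exponent q = q / (q - 1)"

lemma conj_exponent_sum:
  assumes "1 < q"
  shows "1 / q + 1 / conj_exponent q = 1"
  using assms by (simp add: conj_exponent_def field_simps)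

definition muckenhoupt_sup :: "real \<Rightarrow> real \<Rightarrow> (complex \<Rightarrow> real) \<Rightarrow> ennreal" where
  "muckenhoupt_sup q r w = (SUP a. let Q = axis_square a r; q' = conj_exponent q in
     set_average Q (\<lambda>z. ennreal (w z)) *
     ennreal_rpow (set_average Q (\<lambda>z. ennreal (w z powr (- (q' / q))))) (q / q'))"

definition muckenhoupt1_sup :: "real \<Rightarrow> (complex \<Rightarrow> real) \<Rightarrow> ennreal" where
  "muckenhoupt1_sup r w = (SUP a. let Q = axis_square a r in
     set_average Q (\<lambda>z. ennreal (w z)) *
     esssup (restrict_space lebesgue Q) (\<lambda>z. ennreal (inverse (w z))))"

text \<open>
  The negative powers of \<open>w\<close> in the Muckenhoupt conditions are meaningful only if \<open>w > 0\<close> almost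
  everywhere. In HOL \<open>0 powr s = 0\<close> and \<open>inverse 0 = 0\<close>, so this has to be required explicitly;
  otherwise, for example, the zero function would satisfy the conditions.

  The conditions do not depend on the side length \<open>r\<close>; the weakest form, ``for some \<open>r\<close>'', is used.
\<close>

definition A_restricted :: "real \<Rightarrow> (complex \<Rightarrow> real) set" where
  "A_restricted q = {w. is_weight w \<and> (AE z in lebesgue. 0 < w z) \<and>
     (\<exists>r>0. (if q = 1 then muckenhoupt1_sup r w else muckenhoupt_sup q r w) < \<infinity>)}"

definition A_infinity_restricted :: "(complex \<Rightarrow> real) set" where
  "A_infinity_restricted = (\<Union>q\<in>{1..}. A_restricted q)"


section \<open>Operators on spaces of complex functions\<close>

text \<open>
  In this section \<open>H\<close> is a complex linear space of functions, with norm \<open>N\<close> induced by the inner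
  product \<open>ip\<close> (linear in the first argument). Only the values of an operator on \<open>H\<close> matter.
\<close>

definition operator_on ::
  "(complex \<Rightarrow> complex) set \<Rightarrow> ((complex \<Rightarrow> complex) \<Rightarrow> (complex \<Rightarrow> complex)) \<Rightarrow> bool" where
  "operator_on H T \<longleftrightarrow> T ` H \<subseteq> H \<and>
     (\<forall>f\<in>H. \<forall>g\<in>H. \<forall>a b. T (\<lambda>z. a * f z + b * g z) = (\<lambda>z. a * T f z + b * T g z))"

definition bounded_operator_on ::
  "(complex \<Rightarrow> complex) set \<Rightarrow> ((complex \<Rightarrow> complex) \<Rightarrow> real) \<Rightarrow>
   ((complex \<Rightarrow> complex) \<Rightarrow> (complex \<Rightarrow> complex)) \<Rightarrow> bool" where
  "bounded_operator_on H N T \<longleftrightarrow> operator_on H T \<and> (\<exists>C. \<forall>f\<in>H. N (T f) \<le> C * N f)"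

definition norm_topology ::
  "(complex \<Rightarrow> complex) set \<Rightarrow> ((complex \<Rightarrow> complex) \<Rightarrow> real) \<Rightarrow> (complex \<Rightarrow> complex) topology" where
  "norm_topology H N = Metric_space.mtopology H (\<lambda>f g. N (\<lambda>z. f z - g z))"

definition compact_operator_on ::
  "(complex \<Rightarrow> complex) set \<Rightarrow> ((complex \<Rightarrow> complex) \<Rightarrow> real) \<Rightarrow>
   ((complex \<Rightarrow> complex) \<Rightarrow> (complex \<Rightarrow> complex)) \<Rightarrow> bool" where
  "compact_operator_on H N T \<longleftrightarrow> operator_on H T \<and>
     compactin (norm_topology H N) (norm_topology H N closure_of (T ` {f \<in> H. N f \<le> 1}))"

definition is_adjoint_on ::
  "(complex \<Rightarrow> complex) set \<Rightarrow> ((complex \<Rightarrow> complex) \<Rightarrow> (complex \<Rightarrow> complex) \<Rightarrow> complex) \<Rightarrow>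
   ((complex \<Rightarrow> complex) \<Rightarrow> (complex \<Rightarrow> complex)) \<Rightarrow>
   ((complex \<Rightarrow> complex) \<Rightarrow> (complex \<Rightarrow> complex)) \<Rightarrow> bool" where
  "is_adjoint_on H ip T S \<longleftrightarrow> operator_on H S \<and> (\<forall>f\<in>H. \<forall>g\<in>H. ip (T f) g = ip f (S g))"

definition fun_scale :: "complex \<Rightarrow> (complex \<Rightarrow> complex) \<Rightarrow> (complex \<Rightarrow> complex)" where
  "fun_scale c f = (\<lambda>z. c * f z)"

lemma vector_space_fun_scale: "vector_space fun_scale"
  by unfold_locales (auto simp: fun_scale_def fun_eq_iff algebra_simps)

text \<open>
  The singular values of a compact operator \<open>T\<close> are the square roots of the eigenvalues of \<open>T\<^sup>* T\<close>,
  listed in decreasing order: each \<open>t > 0\<close> occurs as often as the (finite) dimension of the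
  eigenspace of \<open>T\<^sup>* T\<close> for \<open>t\<^sup>2\<close>, and a finite list is padded with zeros. For compact \<open>T\<close> this
  determines \<open>s\<close> uniquely.
\<close>

definition singular_values_on ::
  "(complex \<Rightarrow> complex) set \<Rightarrow> ((complex \<Rightarrow> complex) \<Rightarrow> (complex \<Rightarrow> complex) \<Rightarrow> complex) \<Rightarrow>
   ((complex \<Rightarrow> complex) \<Rightarrow> (complex \<Rightarrow> complex)) \<Rightarrow> (nat \<Rightarrow> real) \<Rightarrow> bool" where
  "singular_values_on H ip T s \<longleftrightarrow> decseq s \<and> (\<forall>n. 0 \<le> s n) \<and>
     (\<exists>S. is_adjoint_on H ip T S \<and>
       (\<forall>t>0. finite {n. s n = t} \<and>
         card {n. s n = t} =
           vector_space.dim fun_scale {f \<in> H. S (T f) = fun_scale (complex_of_real (t\<^sup>2)) f}))"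

definition schatten_class_on ::
  "(complex \<Rightarrow> complex) set \<Rightarrow> ((complex \<Rightarrow> complex) \<Rightarrow> real) \<Rightarrow>
   ((complex \<Rightarrow> complex) \<Rightarrow> (complex \<Rightarrow> complex) \<Rightarrow> complex) \<Rightarrow> real \<Rightarrow>
   ((complex \<Rightarrow> complex) \<Rightarrow> (complex \<Rightarrow> complex)) \<Rightarrow> bool" where
  "schatten_class_on H N ip p T \<longleftrightarrow> compact_operator_on H N T \<and>
     (\<exists>s. singular_values_on H ip T s \<and> summable (\<lambda>n. s n powr p))"


section \<open>Weighted Fock spaces and weighted composition operators\<close>

definition fock_space :: "real \<Rightarrow> (complex \<Rightarrow> real) \<Rightarrow> (complex \<Rightarrow> complex) set" where
  "fock_space \<alpha> w = {f. f holomorphic_on UNIV \<and>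
     (\<integral>\<^sup>+z. ennreal ((cmod (f z))\<^sup>2 * exp (- \<alpha> * (cmod z)\<^sup>2) * w z) \<partial>lebesgue) < \<infinity>}"

definition fock_norm :: "real \<Rightarrow> (complex \<Rightarrow> real) \<Rightarrow> (complex \<Rightarrow> complex) \<Rightarrow> real" where
  "fock_norm \<alpha> w f =
     sqrt (LINT z|lebesgue. (cmod (f z))\<^sup>2 * exp (- \<alpha> * (cmod z)\<^sup>2) * w z)"

definition fock_inner ::
  "real \<Rightarrow> (complex \<Rightarrow> real) \<Rightarrow> (complex \<Rightarrow> complex) \<Rightarrow> (complex \<Rightarrow> complex) \<Rightarrow> complex" where
  "fock_inner \<alpha> w f g =
     (LINT z|lebesgue. f z * cnj (g z) * complex_of_real (exp (- \<alpha> * (cmod z)\<^sup>2) * w z))"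

lemma fock_inner_self:
  assumes "is_weight w"
  shows "fock_inner \<alpha> w f f = complex_of_real ((fock_norm \<alpha> w f)\<^sup>2)"
proof -
  have "0 \<le> (LINT z|lebesgue. (cmod (f z))\<^sup>2 * exp (- \<alpha> * (cmod z)\<^sup>2) * w z)"
    using assms by (intro Bochner_Integration.integral_nonneg) (auto simp: is_weight_def)
  then show ?thesis
    unfolding fock_inner_def fock_norm_def
    by (simp add: complex_norm_square[symmetric] mult.assoc
        flip: integral_complex_of_real of_real_mult of_real_power)
qed

definition weighted_comp ::
  "(complex \<Rightarrow> complex) \<Rightarrow> (complex \<Rightarrow> complex) \<Rightarrow> (complex \<Rightarrow> complex) \<Rightarrow> (complex \<Rightarrow> complex)" where
  "weighted_comp \<phi> \<psi> f = (\<lambda>z. \<psi> z * (f \<circ> \<phi>) z)"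

definition averaging_fun ::
  "real \<Rightarrow> (complex \<Rightarrow> real) \<Rightarrow> (complex \<Rightarrow> complex) \<Rightarrow> (complex \<Rightarrow> complex) \<Rightarrow>
   real \<Rightarrow> complex \<Rightarrow> ennreal" where
  "averaging_fun \<alpha> w \<phi> \<psi> r z =
     (\<integral>\<^sup>+\<xi>\<in>\<phi> -` ball z r.
        ennreal ((cmod (\<psi> \<xi>))\<^sup>2 * exp (- \<alpha> * ((cmod \<xi>)\<^sup>2 - (cmod (\<phi> \<xi>))\<^sup>2)) * w \<xi>) \<partial>lebesgue)
     / weight_measure w (ball z r)"

definition vanishes_at_infinity :: "(complex \<Rightarrow> ennreal) \<Rightarrow> bool" where
  "vanishes_at_infinity F \<longleftrightarrow> (\<forall>z. F z < \<infinity>) \<and> (F \<longlongrightarrow> 0) at_infinity"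

text \<open>
  Finiteness in the previous definition is not automatic for \<open>averaging_fun\<close>: if \<open>\<phi>\<close> is constant,
  then \<open>averaging_fun\<close> vanishes far away from that constant, but is infinite near it whenever
  \<open>\<psi>\<close> is not in the Fock space. A limit of a real-valued function is meant.
\<close>

definition in_Lp :: "real \<Rightarrow> (complex \<Rightarrow> ennreal) \<Rightarrow> bool" where
  "in_Lp s F \<longleftrightarrow> F \<in> borel_measurable lebesgue \<and> (\<integral>\<^sup>+z. ennreal_rpow (F z) s \<partial>lebesgue) < \<infinity>"

end

theory Submission
  imports Defs "HOL-Probability.Probability" "HOL-Real_Asymp.Real_Asymp"
begin

text \<open>
  Substituting \<open>\<phi>\<close> turns the norm of \<open>W f\<close> into the integral of \<open>|f|\<^sup>2 e\<^bsup>-\<alpha>|z|\<^sup>2\<^esup>\<close> against the pull-back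
  measure whose mean over \<open>D(z, r)\<close> is \<open>\<Phi>\<^sub>r(z)\<close>, so all three parts are statements about a Carleson
  embedding. The only property of the weight that matters is that, inside a square \<open>Q\<close> of fixed side,
  the mass of a disk is at least a fixed power of its radius times the mass of \<open>Q\<close>. It implies the
  pointwise estimate \<open>|f(z)|\<^sup>2 e\<^bsup>-\<alpha>|z|\<^sup>2\<^esup> w(D(z, r)) \<lesssim> \<integral>\<^bsub>D(z, r)\<^esub> |f|\<^sup>2 e\<^bsup>-\<alpha>|\<xi>|\<^sup>2\<^esup> w\<close> and, since weights of squares grow at
  most exponentially with the distance, the integrability of Gaussians. The first gives
  \<open>\<parallel>W f\<parallel>\<^sup>2 \<lesssim> \<integral> |f|\<^sup>2 e\<^bsup>-\<alpha>|z|\<^sup>2\<^esup> \<Phi>\<^sub>r w\<close>; the second makes the functions \<open>e\<^bsup>\<alpha> z\<^sup>* \<xi> - \<alpha>|z|\<^sup>2/2\<^esup> / V(z)\<^bsup>1/2\<^esup>\<close>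
  (\<open>z\<^sup>*\<close> is the conjugate of \<open>z\<close> and \<open>V(z)\<close> the mass of the square centred at \<open>z\<close>) bounded in the Fock space, and \<open>\<Phi>\<^sub>r(z)\<close> is at most a constant
  times the squared norm of their images. Boundedness and compactness follow. For the Schatten classes
  one expands \<open>\<parallel>W f\<parallel>\<^sup>2 = \<Sum>\<^sub>n s\<^sub>n\<^sup>2 |\<langle>f, e\<^sub>n\<rangle>|\<^sup>2\<close> and uses Jensen's inequality with exponent \<open>p/2 \<ge> 1\<close>
  in both directions.
\<close>

section \<open>Doubling measures on the plane\<close>

text \<open>The conditions for different radii are never compared with each other: for each
  \<open>r\<close> at most \<open>h\<close> both implications between the operator property and the
  condition at \<open>r\<close> are proved, so "some" and "any" coincide. The bound \<open>h\<close>
  is half the side of the squares in the Muckenhoupt condition, because masses are compared directly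
  only inside such squares. The two uses of Jensen's inequality refer to different measures. For the
  singular vectors e_n, one uses the weights |<t_z, e_n>|^2 on the indices, where t_z is the test
  function at z; these have bounded sum by Bessel and bounded integral over z for each n. The other
  uses the probability measure with density |e_n|^2 e^{-\<alpha>|z|^2} with respect to the weighted
  area; there the sum over n is bounded by the reproducing kernel, and passing to half the radius
  turns weighted area divided by V into plain area. Singular values are specified by dimensions of
  eigenspaces, so the expansion has to be carried as far as those dimensions. The adjoint comes from
  Riesz representation, whose completeness premise is supplied by Montel and Fatou.\<close>

locale doubling_measure =
  fixes M :: "complex measure" and h q c :: real
  assumes sets_M [measurable_cong]: "sets M = sets borel"
    and h_pos: "0 < h" and q_pos: "0 < q" and c_pos: "0 < c"
    and emeasure_square_finite: "emeasure M (cbox (z - Complex h h) (z + Complex h h)) < \<infinity>"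
    and emeasure_square_pos: "0 < emeasure M (cbox (z - Complex h h) (z + Complex h h))"
    and doubling: "0 < \<rho> \<Longrightarrow> ball \<zeta> \<rho> \<subseteq> cbox (z - Complex h h) (z + Complex h h) \<Longrightarrow>
      c * \<rho> powr (2 * q) * measure M (cbox (z - Complex h h) (z + Complex h h)) \<le> measure M (ball \<zeta> \<rho>)"
begin

text \<open>\<open>V z\<close> stands in for the masses of all disks of radius at most
  \<open>h\<close> around \<open>z\<close>: they agree with it up to a factor depending only on the
  radius, so later estimates need not carry the radius inside the weight.\<close>

definition V :: "complex \<Rightarrow> real" where
  "V z = measure M (cbox (z - Complex h h) (z + Complex h h))"

lemma space_M [simp]: "space M = UNIV"
  using sets_eq_imp_space_eq[OF sets_M] by simp

lemma V_pos: "0 < V z"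
  using emeasure_square_finite[of z] emeasure_square_pos[of z]
  by (auto simp: V_def measure_def enn2real_positive_iff)

lemma emeasure_square: "emeasure M (cbox (z - Complex h h) (z + Complex h h)) = ennreal (V z)"
  using emeasure_square_finite[of z] by (simp add: V_def emeasure_eq_ennreal_measure)

lemma ball_subset_square:
  assumes "r + dist \<zeta> z \<le> h"
  shows "ball \<zeta> r \<subseteq> cbox (z - Complex h h) (z + Complex h h)"
proof
  fix x assume "x \<in> ball \<zeta> r"
  then have "dist x z \<le> h"
    using assms dist_triangle[of x z \<zeta>] by (auto simp: dist_commute)
  then have "\<bar>Re (x - z)\<bar> \<le> h" "\<bar>Im (x - z)\<bar> \<le> h"
    using abs_Re_le_cmod[of "x - z"] abs_Im_le_cmod[of "x - z"] by (auto simp: dist_norm)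
  then show "x \<in> cbox (z - Complex h h) (z + Complex h h)"
    by (auto simp: in_cbox_complex_iff)
qed

lemma emeasure_ball_le: "r \<le> h \<Longrightarrow> emeasure M (ball z r) \<le> ennreal (V z)"
  unfolding emeasure_square[symmetric]
  by (intro emeasure_mono ball_subset_square) auto

lemma emeasure_ball_ge:
  assumes "0 < r" "r + dist \<zeta> z \<le> h"
  shows "ennreal (c * r powr (2 * q) * V z) \<le> emeasure M (ball \<zeta> r)"
proof -
  have "emeasure M (ball \<zeta> r) \<le> emeasure M (cbox (z - Complex h h) (z + Complex h h))"
    using assms by (intro emeasure_mono ball_subset_square) auto
  then have "emeasure M (ball \<zeta> r) = ennreal (measure M (ball \<zeta> r))"
    using emeasure_square_finite[of z] by (intro emeasure_eq_ennreal_measure) (auto simp: top_unique)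
  then show ?thesis
    using doubling[of r \<zeta> z] assms ball_subset_square[of r \<zeta> z]
    by (auto simp: V_def intro!: ennreal_leI)
qed

definition K :: real where "K = 1 / (c * (h / 2) powr (2 * q))"

lemma K_pos: "0 < K"
  using c_pos h_pos by (auto simp: K_def)

text \<open>The disk of radius \<open>h / 2\<close> around the midpoint lies in both squares.
  Doubling in the square at \<open>z'\<close> bounds its mass below, inclusion in the square at
  \<open>z\<close> bounds it above; \<open>K\<close> is the reciprocal of the doubling factor at
  this radius.\<close>

lemma V_le_near:
  assumes "dist z z' \<le> h"
  shows "V z' \<le> K * V z"
proof -
  let ?m = "(z + z') / 2"
  have d: "dist ?m z = dist z z' / 2" "dist ?m z' = dist z z' / 2"
    by (simp_all add: dist_norm norm_minus_commute field_simps flip: norm_divide_numeral)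
       (simp_all add: norm_divide[symmetric] field_simps norm_minus_commute)
  have "ennreal (c * (h / 2) powr (2 * q) * V z') \<le> emeasure M (ball ?m (h/2))"
    using h_pos assms d by (intro emeasure_ball_ge) auto
  also have "\<dots> \<le> ennreal (V z)"
    unfolding emeasure_square[symmetric] using h_pos assms d
    by (intro emeasure_mono ball_subset_square) auto
  finally have "c * (h / 2) powr (2 * q) * V z' \<le> V z"
    using V_pos[of z] by (simp add: ennreal_le_iff)
  then show ?thesis using c_pos h_pos by (simp add: K_def field_simps)
qed

lemma K_ge_1: "1 \<le> K"
  using V_le_near[of 0 0] h_pos V_pos[of 0] by simp

text \<open>Walk along the segment in steps of length at most \<open>h\<close>. In the induction
  \<open>y\<close> divides it in the ratio n : 1, so the hypothesis covers the way from
  \<open>z\<close> to \<open>y\<close> and one application of \<open>V_le_near\<close> the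
  rest.\<close>

lemma V_le_power: "dist z z' \<le> real n * h \<Longrightarrow> V z' \<le> K ^ n * V z"
proof (induction n arbitrary: z')
  case 0
  then show ?case by simp
next
  case (Suc n)
  define t where "t = real n / real (Suc n)"
  define y where "y = z + of_real t * (z' - z)"
  have "dist z y = t * dist z z'"
    by (simp add: y_def dist_norm norm_mult norm_minus_commute) (simp add: t_def)
  also have "\<dots> \<le> t * (real (Suc n) * h)"
    using Suc.prems by (intro mult_left_mono) (auto simp: t_def)
  also have "\<dots> = real n * h" by (simp add: t_def)
  finally have 1: "dist z y \<le> real n * h" .
  have t: "1 - t = 1 / real (Suc n)" by (simp add: t_def field_simps)
  have "y - z' = of_real (1 - t) * (z - z')"
    by (simp add: y_def algebra_simps)
  then have "dist y z' = dist z z' / real (Suc n)"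
    unfolding dist_norm t by (simp only: norm_mult norm_of_real) simp
  also have "\<dots> \<le> h" using Suc.prems by (simp add: field_simps)
  finally have "V z' \<le> K * V y" by (rule V_le_near)
  also have "\<dots> \<le> K * (K ^ n * V z)"
    using Suc.IH[OF 1] K_pos by simp
  finally show ?case by (simp add: ac_simps)
qed

definition k :: real where "k = ln K / h"

text \<open>Rounding the number of steps dist/h up to an integer costs the leading factor
  \<open>K\<close>; the rate \<open>k\<close> is chosen so that K^(d/h) = exp(k d).\<close>

lemma V_growth: "V z' \<le> K * exp (k * dist z z') * V z"
proof -
  define n where "n = nat \<lceil>dist z z' / h\<rceil>"
  have n: "dist z z' / h \<le> real n" "real n \<le> dist z z' / h + 1"
    using h_pos by (auto simp: n_def)
  have "V z' \<le> K ^ n * V z"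
    using n h_pos by (intro V_le_power) (simp add: field_simps)
  also have "K ^ n = K powr real n" using K_pos by (simp add: powr_realpow)
  also have "\<dots> \<le> K powr (dist z z' / h + 1)" using n K_ge_1 by (intro powr_mono) auto
  also have "\<dots> = K * exp (k * dist z z')"
    using K_pos by (simp add: powr_add k_def powr_def[of K "dist z z' / h"] mult.commute)
  finally show ?thesis using V_pos[of z] by (simp add: mult_right_mono)
qed

lemma k_nonneg: "0 \<le> k"
  using K_ge_1 h_pos by (simp add: k_def)

end

section \<open>Integrability of Gaussians\<close>

lemma nn_integral_gaussian_finite:
  assumes "0 < (\<gamma>::real)"
  shows "(\<integral>\<^sup>+(z::complex). ennreal (exp (- \<gamma> * (cmod z)\<^sup>2)) \<partial>lborel) < \<infinity>"
proof -
  have one: "(\<integral>\<^sup>+x. ennreal (exp (- \<gamma> * x\<^sup>2)) \<partial>lborel) < \<infinity>"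
  proof -
    have s: "sqrt \<gamma> > 0" using assms by simp
    have "(\<integral>\<^sup>+x. ennreal (exp (- x\<^sup>2)) \<partial>lborel) < \<infinity>"
      using has_bochner_integral_even_function[OF gaussian_moment_0]
      by (auto simp: has_bochner_integral_iff integrable_iff_bounded)
    moreover have "(\<integral>\<^sup>+x. ennreal (exp (- x\<^sup>2)) \<partial>lborel)
       = ennreal (sqrt \<gamma>) * (\<integral>\<^sup>+x. ennreal (exp (- \<gamma> * x\<^sup>2)) \<partial>lborel)"
      using nn_integral_real_affine[of "\<lambda>x. ennreal (exp (- x\<^sup>2))" "sqrt \<gamma>" 0] assms
      by (simp add: power_mult_distrib)
    ultimately show ?thesis
      using s by (auto simp: ennreal_mult_less_top top_unique less_top)
  qed
  have "(\<integral>\<^sup>+(z::complex). ennreal (exp (- \<gamma> * (cmod z)\<^sup>2)) \<partial>lborel)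
    = (\<integral>\<^sup>+(z::complex). (\<Prod>b\<in>Basis. ennreal (exp (- \<gamma> * (z \<bullet> b)\<^sup>2))) \<partial>lborel)"
    by (simp add: Basis_complex_def cmod_power2 ring_distribs exp_add ennreal_mult' mult_exp_exp
        flip: exp_add ennreal_mult')
  also have "\<dots> = (\<Prod>b\<in>(Basis::complex set). (\<integral>\<^sup>+x. ennreal (exp (- \<gamma> * x\<^sup>2)) \<partial>lborel))"
    by (rule nn_integral_lborel_prod) auto
  also have "\<dots> < \<infinity>"
    using one by (simp add: power_less_top_ennreal)
  finally show ?thesis .
qed

context doubling_measure
begin

lemma emeasure_compact_finite:
  assumes "compact S"
  shows "emeasure M S < \<infinity>"
proof -
  obtain D where D: "finite D" "S \<subseteq> (\<Union>z\<in>D. ball z h)"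
    using compactE_image[OF assms, of UNIV "\<lambda>z. ball z h"] h_pos
    by (metis UNIV_I UN_I centre_in_ball open_ball subsetI)
  have "emeasure M S \<le> emeasure M (\<Union>z\<in>D. ball z h)"
    using D by (intro emeasure_mono) auto
  also have "\<dots> \<le> (\<Sum>z\<in>D. emeasure M (ball z h))"
    using D by (intro emeasure_subadditive_finite) auto
  also have "\<dots> \<le> (\<Sum>z\<in>D. ennreal (V z))"
    by (intro sum_mono emeasure_ball_le) auto
  also have "\<dots> < \<infinity>" using D by simp
  finally show ?thesis .
qed

sublocale sigma_finite_measure M
proof
  show "\<exists>A. countable A \<and> A \<subseteq> sets M \<and> \<Union> A = space M \<and> (\<forall>a\<in>A. emeasure M a \<noteq> \<infinity>)"
  proof (intro exI conjI ballI)
    show "countable (range (\<lambda>n::nat. cball (0::complex) (real n)))" by auto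
    show "\<Union> (range (\<lambda>n::nat. cball (0::complex) (real n))) = space M"
      using real_arch_simple by (fastforce simp: dist_norm)
    fix a assume "a \<in> range (\<lambda>n::nat. cball (0::complex) (real n))"
    then show "emeasure M a \<noteq> \<infinity>" using emeasure_compact_finite[of a] by auto
  qed auto
qed

text \<open>The squares are sections of one measurable subset of the product space, so
  sigma-finiteness of \<open>M\<close> makes their masses measurable in the centre. Fubini's theorem
  later meets \<open>V\<close> inside integrands.\<close>

lemma V_measurable [measurable]: "V \<in> borel_measurable borel"
proof -
  have "{x \<in> space (borel \<Otimes>\<^sub>M M). snd x \<in> cbox (fst x - Complex h h) (fst x + Complex h h)}
      \<in> sets (borel \<Otimes>\<^sub>M M)"
    unfolding in_cbox_complex_iff atLeastAtMost_iff by measurable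
  from measurable_emeasure_Pair[OF this]
  have "(\<lambda>z. emeasure M (cbox (z - Complex h h) (z + Complex h h))) \<in> borel_measurable borel"
    by (simp add: vimage_def space_pair_measure)
  then show ?thesis
    unfolding V_def measure_def by measurable
qed

text \<open>Masses grow at most exponentially with the distance, and a Gaussian absorbs any
  exponential. The factor \<open>V z\<close> on the right is what the normalisation of the test
  functions will cancel.\<close>

lemma gaussian_integral_le:
  assumes "0 < \<beta>"
  shows "\<exists>C>0. \<forall>z. (\<integral>\<^sup>+\<xi>. ennreal (exp (- \<beta> * (dist \<xi> z)\<^sup>2)) \<partial>M) \<le> ennreal (C * V z)"
proof -
  define B where "B = measure lborel (ball (0::complex) h)"
  have B: "emeasure lborel (ball \<xi> h) = ennreal B" for \<xi> :: complex
    by (simp add: B_def emeasure_ball content_ball h_pos less_imp_le)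
  have B_pos: "B > 0" unfolding B_def using h_pos by (simp add: content_ball_pos)
  define J where "J = enn2real (\<integral>\<^sup>+(z::complex). ennreal (exp (- (\<beta> / 4) * (cmod z)\<^sup>2)) \<partial>lborel)"
  have J: "(\<integral>\<^sup>+(z::complex). ennreal (exp (- (\<beta> / 4) * (cmod z)\<^sup>2)) \<partial>lborel) = ennreal J"
    using nn_integral_gaussian_finite[of "\<beta>/4"] assms by (simp add: J_def)
  \<comment> \<open>Both exponentials pay for passing from a = |\<xi> - z| to t = |\<zeta> - z|: t^2
    \<le> 2 a^2 + 2 h^2 gives -\<beta> a^2 \<le> -\<beta> t^2 / 2 + \<beta> h^2, and k t \<le>
    \<beta> t^2 / 4 + k^2 / \<beta> uses up half of the remaining decay.\<close>
  define A where "A = exp (\<beta> * h\<^sup>2) * K * exp (k\<^sup>2 / \<beta>)"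
  have A_pos: "A > 0" using K_pos by (simp add: A_def)
  have main: "ennreal B * (\<integral>\<^sup>+\<xi>. ennreal (exp (- \<beta> * (dist \<xi> z)\<^sup>2)) \<partial>M) \<le> ennreal (A * V z * J)" for z
  proof -
    have *: "exp (- \<beta> * (dist \<xi> z)\<^sup>2) * (K * exp (k * dist \<zeta> z)) \<le> A * exp (- (\<beta> / 4) * (cmod (\<zeta> - z))\<^sup>2)"
      if "dist \<xi> \<zeta> < h" for \<xi> \<zeta>
    proof -
      define a b t where "a = dist \<xi> z" and "b = dist \<xi> \<zeta>" and "t = dist \<zeta> z"
      have abt: "0 \<le> a" "0 \<le> b" "0 \<le> t" "t \<le> a + b" "b < h"
        using dist_triangle[of \<zeta> z \<xi>] that by (auto simp: a_def b_def t_def dist_commute)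
      have "t\<^sup>2 \<le> (a + b)\<^sup>2" using abt by (intro power_mono) auto
      also have "\<dots> \<le> 2 * a\<^sup>2 + 2 * b\<^sup>2"
        using sum_squares_bound[of a b] by (simp add: power2_sum)
      also have "\<dots> \<le> 2 * a\<^sup>2 + 2 * h\<^sup>2" using abt by (simp add: power_mono)
      finally have 1: "\<beta> * t\<^sup>2 \<le> \<beta> * (2 * a\<^sup>2 + 2 * h\<^sup>2)" using assms by (intro mult_left_mono) auto
      have 2: "k * t \<le> \<beta> / 4 * t\<^sup>2 + k\<^sup>2 / \<beta>"
      proof -
        have "0 \<le> (\<beta> * t / 2 - k)\<^sup>2 / \<beta>" using assms by simp
        also have "\<dots> = \<beta> / 4 * t\<^sup>2 + k\<^sup>2 / \<beta> - k * t"
          using assms by (simp add: power2_eq_square field_simps)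
        finally show ?thesis by simp
      qed
      have "- \<beta> * a\<^sup>2 + k * t \<le> \<beta> * h\<^sup>2 + k\<^sup>2 / \<beta> + - (\<beta> / 4) * t\<^sup>2"
        using 1 2 by (simp add: algebra_simps)
      then have "exp (- \<beta> * a\<^sup>2 + k * t) \<le> exp (\<beta> * h\<^sup>2 + k\<^sup>2 / \<beta> + - (\<beta> / 4) * t\<^sup>2)" by simp
      then show ?thesis
        using K_pos unfolding a_def[symmetric] t_def[symmetric] A_def dist_norm[symmetric] exp_add
        by (simp add: mult_ac)
    qed
    \<comment> \<open>Averaging over the disks of radius \<open>h\<close> that contain \<open>\<xi>\<close> replaces \<open>M\<close> by \<open>V\<close> and Lebesgue measure.\<close>
    have "ennreal B * (\<integral>\<^sup>+\<xi>. ennreal (exp (- \<beta> * (dist \<xi> z)\<^sup>2)) \<partial>M)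
      = (\<integral>\<^sup>+\<xi>. (\<integral>\<^sup>+\<zeta>. ennreal (exp (- \<beta> * (dist \<xi> z)\<^sup>2)) * indicator {p. dist (fst p) (snd p) < h} (\<xi>, \<zeta>) \<partial>lborel) \<partial>M)"
    proof -
      have "(\<integral>\<^sup>+\<zeta>. ennreal (exp (- \<beta> * (dist \<xi> z)\<^sup>2)) * indicator {p. dist (fst p) (snd p) < h} (\<xi>, \<zeta>) \<partial>lborel)
        = ennreal B * ennreal (exp (- \<beta> * (dist \<xi> z)\<^sup>2))" for \<xi>
      proof -
        have "indicator {p. dist (fst p) (snd p) < h} (\<xi>, \<zeta>) = (indicator (ball \<xi> h) \<zeta> :: ennreal)" for \<zeta>
          by (auto simp: indicator_def)
        then show ?thesis using B[of \<xi>]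
          by (simp add: nn_integral_cmult_indicator) (simp add: mult.commute)
      qed
      then show ?thesis by (simp add: nn_integral_cmult)
    qed
    also have "\<dots> = (\<integral>\<^sup>+\<zeta>. (\<integral>\<^sup>+\<xi>. ennreal (exp (- \<beta> * (dist \<xi> z)\<^sup>2)) * indicator {p. dist (fst p) (snd p) < h} (\<xi>, \<zeta>) \<partial>M) \<partial>lborel)"
    proof -
      interpret pair_sigma_finite M lborel ..
      show ?thesis
        by (rule Fubini'[symmetric]) measurable
    qed
    also have "\<dots> \<le> (\<integral>\<^sup>+\<zeta>. ennreal (A * V z * exp (- (\<beta> / 4) * (cmod (\<zeta> - z))\<^sup>2)) \<partial>lborel)"
    proof (rule nn_integral_mono)
      fix \<zeta> :: complex
      \<comment> \<open>The bound \<open>*\<close> solved for the Gaussian at \<xi>: it no longer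
        depends on \<xi> in the disk around \<zeta>, and its denominator is the growth factor that
        \<open>V_growth\<close> produces for \<open>V \<zeta>\<close>.\<close>
      define e where "e = A * exp (- (\<beta> / 4) * (cmod (\<zeta> - z))\<^sup>2) / (K * exp (k * dist \<zeta> z))"
      have "(\<integral>\<^sup>+\<xi>. ennreal (exp (- \<beta> * (dist \<xi> z)\<^sup>2)) * indicator {p. dist (fst p) (snd p) < h} (\<xi>, \<zeta>) \<partial>M)
        \<le> (\<integral>\<^sup>+\<xi>. ennreal e * indicator (ball \<zeta> h) \<xi> \<partial>M)"
        using *[of _ \<zeta>] K_pos
        by (intro nn_integral_mono) (auto simp: indicator_def e_def dist_commute field_simps intro!: ennreal_leI)
      also have "\<dots> = ennreal e * emeasure M (ball \<zeta> h)" by (simp add: nn_integral_cmult_indicator)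
      also have "\<dots> \<le> ennreal e * ennreal (V \<zeta>)" by (intro mult_left_mono emeasure_ball_le) auto
      also have "\<dots> \<le> ennreal e * ennreal (K * exp (k * dist \<zeta> z) * V z)"
        using V_growth[of \<zeta> z] by (intro mult_left_mono ennreal_leI) (auto simp: dist_commute)
      also have "\<dots> = ennreal (A * V z * exp (- (\<beta> / 4) * (cmod (\<zeta> - z))\<^sup>2))"
        using K_pos A_pos V_pos[of z] by (simp add: e_def flip: ennreal_mult)
      finally show "(\<integral>\<^sup>+\<xi>. ennreal (exp (- \<beta> * (dist \<xi> z)\<^sup>2)) * indicator {p. dist (fst p) (snd p) < h} (\<xi>, \<zeta>) \<partial>M)
        \<le> ennreal (A * V z * exp (- (\<beta> / 4) * (cmod (\<zeta> - z))\<^sup>2))" .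
    qed
    also have "\<dots> = ennreal (A * V z) * (\<integral>\<^sup>+\<zeta>. ennreal (exp (- (\<beta> / 4) * (cmod (\<zeta> - z))\<^sup>2)) \<partial>lborel)"
      using A_pos V_pos[of z] by (simp add: ennreal_mult nn_integral_cmult)
    also have "(\<integral>\<^sup>+\<zeta>. ennreal (exp (- (\<beta> / 4) * (cmod (\<zeta> - z))\<^sup>2)) \<partial>lborel) = ennreal J"
      by (subst J[symmetric], subst (2) lborel_distr_plus[of "-z", symmetric])
         (simp add: nn_integral_distr)
    also have "ennreal (A * V z) * ennreal J = ennreal (A * V z * J)"
      using A_pos V_pos[of z] by (simp add: J_def ennreal_mult)
    finally show ?thesis .
  qed
  have J_nonneg: "J \<ge> 0" by (simp add: J_def)
  \<comment> \<open>The summand 1 keeps the constant positive, since \<open>J\<close> is only known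
    to be nonnegative.\<close>
  show ?thesis
  proof (intro exI[of _ "A * J / B + 1"] conjI allI)
    show "0 < A * J / B + 1" using A_pos B_pos J_nonneg by (simp add: add_nonneg_pos)
    fix z
    have "ennreal (1/B) * (ennreal B * (\<integral>\<^sup>+\<xi>. ennreal (exp (- \<beta> * (dist \<xi> z)\<^sup>2)) \<partial>M))
       \<le> ennreal (1/B) * ennreal (A * V z * J)"
      by (intro mult_left_mono main) auto
    then have "(\<integral>\<^sup>+\<xi>. ennreal (exp (- \<beta> * (dist \<xi> z)\<^sup>2)) \<partial>M) \<le> ennreal (A * V z * J / B)"
      using B_pos A_pos V_pos[of z] J_nonneg by (simp add: mult.assoc[symmetric] flip: ennreal_mult)
    also have "\<dots> \<le> ennreal ((A * J / B + 1) * V z)"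
      using V_pos[of z] by (intro ennreal_leI) (simp add: algebra_simps)
    finally show "(\<integral>\<^sup>+\<xi>. ennreal (exp (- \<beta> * (dist \<xi> z)\<^sup>2)) \<partial>M) \<le> ennreal ((A * J / B + 1) * V z)" .
  qed
qed

text \<open>
  Let \<open>z1\<close> maximise \<open>|f(\<xi>)| (r - |\<xi> - z|)\<^sup>q\<close>. By Cauchy's estimate for the derivative, \<open>|f|\<close> is at least
  \<open>|f(z1)| / 2\<close> on a disk around \<open>z1\<close> whose radius is a fixed multiple of \<open>r - |z1 - z|\<close>; the power \<open>q\<close>
  matches the doubling exponent. No subharmonicity of fractional powers of \<open>|f|\<close> is needed.
\<close>

lemma pointwise_le_untwisted:
  assumes f: "f holomorphic_on UNIV" and r: "0 < r" "r \<le> h"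
  shows "ennreal ((cmod (f z))\<^sup>2 * V z) \<le> ennreal (4 / (c * (2 powr (- (q + 3)) * r) powr (2 * q))) *
    (\<integral>\<^sup>+\<xi>\<in>ball z r. ennreal ((cmod (f \<xi>))\<^sup>2) \<partial>M)"
proof (cases "f z = 0")
  case False
  have contf: "continuous_on S f" for S
    using f holomorphic_on_imp_continuous_on holomorphic_on_subset by blast
  define G where "G \<xi> = cmod (f \<xi>) * (r - dist \<xi> z) powr q" for \<xi>
  have "continuous_on (cball z r) G"
    unfolding G_def using q_pos contf
    by (intro continuous_intros continuous_on_powr') (auto simp: dist_commute)
  then obtain z1 where z1: "z1 \<in> cball z r" "\<And>\<xi>. \<xi> \<in> cball z r \<Longrightarrow> G \<xi> \<le> G z1"
    using continuous_attains_sup[of "cball z r" G] r by fastforce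
  define d where "d = r - dist z1 z"
  have Gz: "cmod (f z) * r powr q \<le> cmod (f z1) * d powr q"
    using z1(2)[of z] r by (simp add: G_def d_def)
  \<comment> \<open>On the boundary circle \<open>G\<close> is 0, whereas its value at
    \<open>z\<close> is positive; the same comparison shows that \<open>f\<close> does not vanish at
    \<open>z1\<close>.\<close>
  have d_pos: "d > 0"
  proof -
    have "0 < cmod (f z) * r powr q" using False r by simp
    then have "d \<noteq> 0" using Gz by auto
    moreover have "d \<ge> 0" using z1(1) by (simp add: d_def dist_commute)
    ultimately show ?thesis by simp
  qed
  define m where "m = cmod (f z1)"
  have m_pos: "m > 0"
  proof -
    have "0 < cmod (f z) * r powr q" using False r by simp
    then have "m \<noteq> 0" using Gz by (auto simp: m_def)
    then show ?thesis by (simp add: m_def)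
  qed
  have near: "cmod (f \<xi>) \<le> 2 powr q * m" if "dist \<xi> z1 \<le> d / 2" for \<xi>
  proof -
    have 1: "d / 2 \<le> r - dist \<xi> z"
      using that dist_triangle[of \<xi> z z1] by (simp add: d_def)
    then have "\<xi> \<in> cball z r" using d_pos by (simp add: dist_commute)
    then have "cmod (f \<xi>) * (r - dist \<xi> z) powr q \<le> m * d powr q"
      using z1(2) by (simp add: G_def m_def d_def)
    moreover have "(d / 2) powr q \<le> (r - dist \<xi> z) powr q"
      using 1 d_pos q_pos by (intro powr_mono2) auto
    ultimately have "cmod (f \<xi>) * (d / 2) powr q \<le> m * d powr q"
      by (meson mult_left_mono norm_ge_zero order_trans)
    then show ?thesis using d_pos by (simp add: powr_divide field_simps)
  qed
  \<comment> \<open>Chosen so that 2^q \<rho> = d / 8: on the disk of radius d/4 around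
    \<open>z1\<close> the derivative is at most 4 * 2^q m / d, hence \<open>f\<close> changes by at
    most m / 2 over the distance \<rho>.\<close>
  define \<rho> where "\<rho> = 2 powr (- (q + 3)) * d"
  have \<rho>_eq: "2 powr q * \<rho> = d / 8"
    by (simp add: \<rho>_def powr_diff powr_minus powr_add field_simps)
  have \<rho>: "0 < \<rho>" "\<rho> \<le> d / 4"
  proof -
    show "0 < \<rho>" using d_pos by (simp add: \<rho>_def)
    have "1 * \<rho> \<le> 2 powr q * \<rho>"
      using \<open>0 < \<rho>\<close> q_pos by (intro mult_right_mono) (auto simp: ge_one_powr_ge_zero)
    then show "\<rho> \<le> d / 4" using \<rho>_eq d_pos by simp
  qed
  have deriv_bd: "cmod (deriv f \<xi>) \<le> 2 powr q * m / (d / 4)" if "dist \<xi> z1 \<le> d / 4" for \<xi>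
  proof -
    have "cmod ((deriv ^^ 1) f \<xi>) \<le> fact 1 * (2 powr q * m) / (d / 4) ^ 1"
    proof (rule Cauchy_inequality)
      show "f holomorphic_on ball \<xi> (d / 4)" using f by (rule holomorphic_on_subset) auto
      show "continuous_on (cball \<xi> (d / 4)) f" by (rule contf)
      show "0 < d / 4" using d_pos by simp
      fix x assume "cmod (\<xi> - x) = d / 4"
      then show "cmod (f x) \<le> 2 powr q * m"
        using that dist_triangle[of x z1 \<xi>] by (intro near) (auto simp: dist_norm norm_minus_commute)
    qed
    then show ?thesis by simp
  qed
  have lower: "m / 2 \<le> cmod (f \<xi>)" if "dist \<xi> z1 \<le> \<rho>" for \<xi>
  proof -
    have "cmod (f \<xi> - f z1) \<le> 2 powr q * m / (d / 4) * cmod (\<xi> - z1)"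
    proof (rule field_differentiable_bound)
      show "convex (cball z1 (d/4))" by simp
      show "(f has_field_derivative deriv f x) (at x within cball z1 (d/4))" for x
        using f by (simp add: holomorphic_derivI)
      show "cmod (deriv f x) \<le> 2 powr q * m / (d / 4)" if "x \<in> cball z1 (d/4)" for x
        using that by (intro deriv_bd) (simp add: dist_commute)
    qed (use that \<rho> d_pos in \<open>auto simp: dist_commute\<close>)
    also have "\<dots> \<le> 2 powr q * m / (d / 4) * \<rho>"
      using that m_pos d_pos by (intro mult_left_mono) (auto simp: dist_norm)
    also have "\<dots> = m / 2" using \<rho>_eq d_pos by (simp add: field_simps)
    finally have "cmod (f \<xi> - f z1) \<le> m / 2" .
    then show ?thesis using norm_triangle_ineq2[of "f z1" "f \<xi>"]
      by (simp add: m_def norm_minus_commute)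
  qed
  have sub: "ball z1 \<rho> \<subseteq> ball z r"
  proof
    fix x assume "x \<in> ball z1 \<rho>"
    then show "x \<in> ball z r"
      using \<rho> d_pos dist_triangle[of x z z1] by (simp add: d_def dist_commute)
  qed
  then have sub': "dist x z < r" if "dist x z1 < \<rho>" for x
    using subsetD[OF sub, of x] that by (simp add: dist_commute)
  have "ennreal ((m / 2)\<^sup>2 * (c * \<rho> powr (2 * q) * V z)) \<le> ennreal ((m/2)\<^sup>2) * emeasure M (ball z1 \<rho>)"
  proof -
    have "\<rho> + dist z1 z \<le> h" using \<rho> d_pos r by (simp add: d_def)
    then have "ennreal (c * \<rho> powr (2 * q) * V z) \<le> emeasure M (ball z1 \<rho>)"
      using \<rho> by (intro emeasure_ball_ge) auto
    then show ?thesis using c_pos V_pos[of z] by (simp add: ennreal_mult mult_left_mono)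
  qed
  also have "\<dots> = (\<integral>\<^sup>+\<xi>. ennreal ((m/2)\<^sup>2) * indicator (ball z1 \<rho>) \<xi> \<partial>M)"
    by (simp add: nn_integral_cmult_indicator)
  also have "\<dots> \<le> (\<integral>\<^sup>+\<xi>\<in>ball z r. ennreal ((cmod (f \<xi>))\<^sup>2) \<partial>M)"
    using lower sub' m_pos
    by (intro nn_integral_mono) (auto simp: indicator_def dist_commute intro!: ennreal_leI power_mono)
  finally have 1: "ennreal ((m / 2)\<^sup>2 * (c * \<rho> powr (2 * q) * V z))
    \<le> (\<integral>\<^sup>+\<xi>\<in>ball z r. ennreal ((cmod (f \<xi>))\<^sup>2) \<partial>M)" .
  define D where "D = c * (2 powr (- (q + 3)) * r) powr (2 * q)"
  have D_pos: "D > 0" using c_pos r by (simp add: D_def)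
  have sq: "x powr (2 * q) = (x powr q)\<^sup>2" for x
    by (simp add: powr_add[symmetric] power2_eq_square)
  \<comment> \<open>The doubling factor at \<rho> is of order d^(2q), which may be far smaller than
    r^(2q). Squaring \<open>Gz\<close> moves exactly this power from \<open>z1\<close> to
    \<open>z\<close>, so the final constant depends on \<open>r\<close> alone.\<close>
  have "(cmod (f z))\<^sup>2 * V z = 4 / D * (D / 4 * (cmod (f z))\<^sup>2 * V z)" using D_pos by simp
  also have "D / 4 * (cmod (f z))\<^sup>2 = c * (2 powr (- (q + 3))) powr (2*q) / 4 * (cmod (f z) * r powr q)\<^sup>2"
    unfolding D_def using r by (simp add: powr_mult sq power_mult_distrib)
  also have "\<dots> \<le> c * (2 powr (- (q + 3))) powr (2*q) / 4 * (m * d powr q)\<^sup>2"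
    using Gz c_pos by (intro mult_left_mono power_mono) (auto simp: m_def)
  also have "\<dots> = (m / 2)\<^sup>2 * (c * \<rho> powr (2 * q))"
    unfolding \<rho>_def using d_pos by (simp add: powr_mult sq power_mult_distrib power_divide)
  finally have 2: "(cmod (f z))\<^sup>2 * V z \<le> 4 / D * ((m / 2)\<^sup>2 * (c * \<rho> powr (2 * q) * V z))"
    using D_pos V_pos[of z] by (simp add: mult_left_mono mult_right_mono mult.assoc divide_right_mono)
  have "ennreal ((cmod (f z))\<^sup>2 * V z) \<le> ennreal (4 / D) * ennreal ((m / 2)\<^sup>2 * (c * \<rho> powr (2 * q) * V z))"
    using 2 D_pos by (simp add: ennreal_leI flip: ennreal_mult')
  also have "\<dots> \<le> ennreal (4 / D) * (\<integral>\<^sup>+\<xi>\<in>ball z r. ennreal ((cmod (f \<xi>))\<^sup>2) \<partial>M)"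
    by (intro mult_left_mono 1) auto
  finally show ?thesis by (simp add: D_def)
qed simp

end

section \<open>The pointwise estimate with the Gaussian weight\<close>

locale fock_measure = doubling_measure +
  fixes \<alpha> :: real
  assumes \<alpha>_pos: "0 < \<alpha>"
begin

definition P :: "real \<Rightarrow> real" where
  "P r = 4 / (c * (2 powr (- (q + 3)) * r) powr (2 * q)) * exp (\<alpha> * r\<^sup>2)"

lemma P_pos: "0 < r \<Longrightarrow> 0 < P r"
  using c_pos by (simp add: P_def)

text \<open>Multiplying \<open>f\<close> by the exponential of an affine function of \<xi> gives an
  entire \<open>g\<close> with |g(\<xi>)|^2 = |f(\<xi>)|^2 e^{-\<alpha>|\<xi>|^2} e^{\<alpha>|\<xi>
  - z|^2}. The last factor is 1 at \<open>z\<close> and at most e^{\<alpha> r^2} on the disk, so the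
  estimate without the Gaussian applies to \<open>g\<close>.\<close>

lemma pointwise_le:
  assumes f: "f holomorphic_on UNIV" and r: "0 < r" "r \<le> h"
  shows "ennreal ((cmod (f z))\<^sup>2 * exp (- \<alpha> * (cmod z)\<^sup>2) * V z) \<le> ennreal (P r) *
    (\<integral>\<^sup>+\<xi>\<in>ball z r. ennreal ((cmod (f \<xi>))\<^sup>2 * exp (- \<alpha> * (cmod \<xi>)\<^sup>2)) \<partial>M)"
proof -
  define g where "g \<xi> = f \<xi> * exp (- \<alpha> * cnj z * \<xi> + \<alpha> * (cmod z)\<^sup>2 / 2)" for \<xi>
  have g: "g holomorphic_on UNIV"
    unfolding g_def using f by (auto intro!: holomorphic_intros)
  have tw: "(cmod (g \<xi>))\<^sup>2 = (cmod (f \<xi>))\<^sup>2 * exp (- \<alpha> * (cmod \<xi>)\<^sup>2) * exp (\<alpha> * (dist \<xi> z)\<^sup>2)" for \<xi>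
  proof -
    have "(dist \<xi> z)\<^sup>2 = (cmod \<xi>)\<^sup>2 - 2 * Re (cnj z * \<xi>) + (cmod z)\<^sup>2"
      by (simp add: dist_norm cmod_power2 power2_diff algebra_simps)
    then have "- \<alpha> * (cmod \<xi>)\<^sup>2 + \<alpha> * (dist \<xi> z)\<^sup>2 = 2 * Re (- \<alpha> * cnj z * \<xi> + \<alpha> * (cmod z)\<^sup>2 / 2)"
      unfolding \<open>(dist \<xi> z)\<^sup>2 = _\<close> by (simp add: algebra_simps)
    then have "exp (- \<alpha> * (cmod \<xi>)\<^sup>2) * exp (\<alpha> * (dist \<xi> z)\<^sup>2)
      = (exp (Re (- \<alpha> * cnj z * \<xi> + \<alpha> * (cmod z)\<^sup>2 / 2)))\<^sup>2"
      by (simp only: exp_add[symmetric] exp_double[symmetric])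
    then show ?thesis by (simp add: g_def norm_mult power_mult_distrib mult.assoc)
  qed
  have "ennreal ((cmod (f z))\<^sup>2 * exp (- \<alpha> * (cmod z)\<^sup>2) * V z) = ennreal ((cmod (g z))\<^sup>2 * V z)"
    using tw[of z] by simp
  also have "\<dots> \<le> ennreal (4 / (c * (2 powr (- (q + 3)) * r) powr (2 * q))) *
    (\<integral>\<^sup>+\<xi>\<in>ball z r. ennreal ((cmod (g \<xi>))\<^sup>2) \<partial>M)"
    using g r by (rule pointwise_le_untwisted)
  also have "(\<integral>\<^sup>+\<xi>\<in>ball z r. ennreal ((cmod (g \<xi>))\<^sup>2) \<partial>M) \<le>
    (\<integral>\<^sup>+\<xi>. ennreal (exp (\<alpha> * r\<^sup>2)) * (ennreal ((cmod (f \<xi>))\<^sup>2 * exp (- \<alpha> * (cmod \<xi>)\<^sup>2)) * indicator (ball z r) \<xi>) \<partial>M)"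
  proof (rule nn_integral_mono)
    fix \<xi>
    show "ennreal ((cmod (g \<xi>))\<^sup>2) * indicator (ball z r) \<xi> \<le>
      ennreal (exp (\<alpha> * r\<^sup>2)) * (ennreal ((cmod (f \<xi>))\<^sup>2 * exp (- \<alpha> * (cmod \<xi>)\<^sup>2)) * indicator (ball z r) \<xi>)"
    proof (cases "\<xi> \<in> ball z r")
      case True
      then have "exp (\<alpha> * (dist \<xi> z)\<^sup>2) \<le> exp (\<alpha> * r\<^sup>2)"
        using \<alpha>_pos by (auto intro!: power_mono simp: dist_commute)
      then have "(cmod (g \<xi>))\<^sup>2 \<le> exp (\<alpha> * r\<^sup>2) * ((cmod (f \<xi>))\<^sup>2 * exp (- \<alpha> * (cmod \<xi>)\<^sup>2))"
        unfolding tw by (subst mult.commute) (intro mult_right_mono; simp)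
      then show ?thesis using True by (simp add: ennreal_leI flip: ennreal_mult')
    qed simp
  qed
  also have "\<dots> = ennreal (exp (\<alpha> * r\<^sup>2)) *
      (\<integral>\<^sup>+\<xi>\<in>ball z r. ennreal ((cmod (f \<xi>))\<^sup>2 * exp (- \<alpha> * (cmod \<xi>)\<^sup>2)) \<partial>M)"
  proof -
    have [measurable]: "f \<in> borel_measurable borel"
      using f by (intro borel_measurable_continuous_onI holomorphic_on_imp_continuous_on)
    have [measurable]: "ball z r \<in> sets borel" by simp
    show ?thesis by (rule nn_integral_cmult) measurable
  qed
  finally have main: "ennreal ((cmod (f z))\<^sup>2 * exp (- \<alpha> * (cmod z)\<^sup>2) * V z)
    \<le> ennreal (4 / (c * (2 powr (- (q + 3)) * r) powr (2 * q))) * (ennreal (exp (\<alpha> * r\<^sup>2)) *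
      (\<integral>\<^sup>+\<xi>\<in>ball z r. ennreal ((cmod (f \<xi>))\<^sup>2 * exp (- \<alpha> * (cmod \<xi>)\<^sup>2)) \<partial>M))"
    by (simp add: mult_left_mono)
  have "ennreal (P r) = ennreal (4 / (c * (2 powr (- (q + 3)) * r) powr (2 * q))) * ennreal (exp (\<alpha> * r\<^sup>2))"
    unfolding P_def using c_pos by (intro ennreal_mult) auto
  with main show ?thesis by (simp only: mult.assoc)
qed

end

section \<open>Restricted Muckenhoupt weights\<close>

text \<open>Local integrability makes the truncations to disks measurable, and \<open>w\<close> is
  their pointwise limit.\<close>

lemma weight_measurable:
  assumes "is_weight w"
  shows "w \<in> borel_measurable lebesgue"
proof (rule borel_measurable_LIMSEQ_real)
  show "(\<lambda>n. indicat_real (cball 0 (real n)) x *\<^sub>R w x) \<longlonglongrightarrow> w x" for x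
  proof (rule tendsto_eventually)
    show "\<forall>\<^sub>F n in sequentially. indicat_real (cball 0 (real n)) x *\<^sub>R w x = w x"
      using eventually_ge_at_top[of "nat \<lceil>cmod x\<rceil>"]
      by eventually_elim (auto simp: indicator_def nat_le_iff ceiling_le_iff)
  qed
  show "(\<lambda>x. indicat_real (cball 0 (real n)) x *\<^sub>R w x) \<in> borel_measurable lebesgue" for n
    using assms unfolding is_weight_def set_integrable_def by (auto intro: borel_measurable_integrable)
qed

lemma emeasure_lebesgue_axis_square:
  assumes "0 < l"
  shows "emeasure lebesgue (axis_square a l) = ennreal (l\<^sup>2)"
  using assms unfolding axis_square_def
  by (subst emeasure_completion)
     (auto simp: emeasure_lborel_cbox_eq Basis_complex_def power2_eq_square inner_complex_def ennreal_mult'[symmetric])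

section \<open>Weights satisfying a Muckenhoupt condition at one side length\<close>

context
  fixes w :: "complex \<Rightarrow> real" and r\<^sub>0 :: real
  assumes weight: "is_weight w" and pos: "AE z in lebesgue. 0 < w z" and r0: "0 < r\<^sub>0"
begin

lemmas w_meas [measurable] = weight_measurable[OF weight]

lemma w_nonneg: "0 \<le> w z"
  using weight by (simp add: is_weight_def)

lemma square_sets [measurable]: "axis_square a r\<^sub>0 \<in> sets lebesgue"
  by (simp add: axis_square_def)

lemma weight_square_finite: "weight_measure w (axis_square a r\<^sub>0) < \<infinity>"
proof -
  have "set_integrable lebesgue (axis_square a r\<^sub>0) w"
    using weight by (simp add: is_weight_def axis_square_def)
  then have "(\<integral>\<^sup>+z. ennreal (norm (indicat_real (axis_square a r\<^sub>0) z *\<^sub>R w z)) \<partial>lebesgue) < \<infinity>"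
    unfolding set_integrable_def by (simp add: integrable_iff_bounded)
  also have "(\<integral>\<^sup>+z. ennreal (norm (indicat_real (axis_square a r\<^sub>0) z *\<^sub>R w z)) \<partial>lebesgue)
     = weight_measure w (axis_square a r\<^sub>0)"
    unfolding weight_measure_def
    by (intro nn_integral_cong) (auto simp: indicator_def w_nonneg)
  finally show ?thesis .
qed

lemma weight_measure_pos:
  assumes "E \<in> sets lebesgue" "0 < emeasure lebesgue E"
  shows "0 < weight_measure w E"
proof -
  have "weight_measure w E \<noteq> 0"
  proof
    assume "weight_measure w E = 0"
    then have "AE z in lebesgue. ennreal (w z) * indicator E z = 0"
      using assms by (subst (asm) weight_measure_def, subst (asm) nn_integral_0_iff_AE) auto
    with pos have "AE z in lebesgue. z \<notin> E"
      by eventually_elim (auto simp: indicator_def split: if_splits)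
    then show False using assms by (simp add: AE_iff_measurable[OF assms(1)])
  qed
  then show ?thesis by (simp add: zero_less_iff_neq_zero)
qed

text \<open>In place of Hoelder's inequality, the elementary 1 \<le> t + t^{-s} with t = \<mu> w is
  integrated over \<open>E\<close> and \<mu> is chosen afterwards. Giving each term half of |E|
  produces the division by 2 in the statement. The exponent s = 1/(q - 1) equals q'/q, the power of
  1/w in the condition.\<close>

lemma muckenhoupt_doubling:
  assumes q: "1 < q" and fin: "muckenhoupt_sup q r\<^sub>0 w < \<infinity>"
  shows "\<exists>c>0. \<forall>a E. E \<in> sets lebesgue \<longrightarrow> E \<subseteq> axis_square a r\<^sub>0 \<longrightarrow>
    ennreal (c * (measure lebesgue E / 2) powr q) * weight_measure w (axis_square a r\<^sub>0) \<le> weight_measure w E"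
proof -
  \<comment> \<open>A real upper bound for the supremum; adding 1 makes it positive, so that it can
    be divided by.\<close>
  define \<sigma> where "\<sigma> = enn2real (muckenhoupt_sup q r\<^sub>0 w) + 1"
  have \<sigma>: "muckenhoupt_sup q r\<^sub>0 w \<le> ennreal \<sigma>" "0 < \<sigma>"
    using fin by (auto simp: \<sigma>_def add_nonneg_pos less_top[symmetric] intro!: order_trans[OF _ ennreal_leI[of "enn2real _" ]] )
  define s where "s = 1 / (q - 1)"
  have s: "s > 0" using q by (simp add: s_def)
  have ce: "conj_exponent q / q = s" "q / conj_exponent q = q - 1"
    using q by (simp_all add: conj_exponent_def s_def field_simps)
  define A where "A = r\<^sub>0\<^sup>2"
  have A: "A > 0" "emeasure lebesgue (axis_square a r\<^sub>0) = ennreal A" for a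
    using r0 emeasure_lebesgue_axis_square[of r\<^sub>0 a] by (simp_all add: A_def)
  define c where "c = 1 / (\<sigma> * A powr q)"
  have "c > 0" using \<sigma> A by (simp add: c_def)
  moreover have "ennreal (c * (measure lebesgue E / 2) powr q) * weight_measure w (axis_square a r\<^sub>0) \<le> weight_measure w E"
    if E [measurable]: "E \<in> sets lebesgue" and sub: "E \<subseteq> axis_square a r\<^sub>0" for a E
  proof (cases "measure lebesgue E = 0")
    case False
    let ?Q = "axis_square a r\<^sub>0"
    define J where "J = (\<integral>\<^sup>+z\<in>?Q. ennreal (w z powr - s) \<partial>lebesgue)"
    obtain i where i: "weight_measure w ?Q = ennreal i" "i > 0"
    proof -
      have "weight_measure w ?Q = ennreal (enn2real (weight_measure w ?Q))"
        using weight_square_finite[of a] by simp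
      moreover have "0 < weight_measure w ?Q"
        using A by (intro weight_measure_pos) auto
      ultimately show ?thesis using that by (metis ennreal_less_zero_iff)
    qed
    have "set_average ?Q (\<lambda>z. ennreal (w z)) * ennreal_rpow (set_average ?Q (\<lambda>z. ennreal (w z powr - s))) (q - 1)
       \<le> muckenhoupt_sup q r\<^sub>0 w"
      unfolding muckenhoupt_sup_def by (rule SUP_upper2[of a]) (simp_all add: Let_def ce)
    also note \<sigma>(1)
    finally have le: "ennreal i / ennreal A * ennreal_rpow (J / ennreal A) (q - 1) \<le> ennreal \<sigma>"
      using A(2)[of a] i(1) by (simp add: set_average_def J_def weight_measure_def)
    \<comment> \<open>The average of \<open>w\<close> over the square is positive, so an infinite
      \<open>J\<close> would make the Muckenhoupt product infinite.\<close>
    have Jfin: "J < \<infinity>"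
    proof (rule ccontr)
      assume "\<not> J < \<infinity>"
      then have "J / ennreal A = \<infinity>" by (simp add: ennreal_top_divide not_less top_unique)
      then show False using le i A by (simp add: ennreal_rpow_def divide_ennreal ennreal_mult_top top_unique)
    qed
    define j where "j = enn2real J"
    have J: "J = ennreal j" "j \<ge> 0" using Jfin by (simp_all add: j_def)
    have le: "i / A * (j / A) powr (q - 1) \<le> \<sigma>"
    proof -
      have "ennreal (i / A * (j / A) powr (q - 1)) \<le> ennreal \<sigma>"
        using le A i J by (subst ennreal_mult) (auto simp: ennreal_rpow_def divide_ennreal)
      then show ?thesis using \<sigma> by simp
    qed
    have Efin: "emeasure lebesgue E \<le> ennreal A"
      using emeasure_mono[OF sub, of lebesgue] A by simp
    define e where "e = measure lebesgue E"
    have e: "emeasure lebesgue E = ennreal e" "e > 0"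
      using Efin False neq_top_trans[OF _ Efin] by (simp_all add: e_def emeasure_eq_ennreal_measure less_le del: emeasure_completion)
    have wE: "weight_measure w E \<le> ennreal i"
      unfolding i(1)[symmetric] weight_measure_def using sub
      by (intro nn_integral_mono) (auto simp: indicator_def)
    define m where "m = enn2real (weight_measure w E)"
    have m: "weight_measure w E = ennreal m" "m \<ge> 0"
      using neq_top_trans[OF _ wE] by (simp_all add: m_def less_top)
    have young: "e \<le> \<mu> * m + \<mu> powr - s * j" if \<mu>: "\<mu> > 0" for \<mu>
    proof -
      have "ennreal e = (\<integral>\<^sup>+z. indicator E z \<partial>lebesgue)" using e by simp
      also have "\<dots> \<le> (\<integral>\<^sup>+z. ennreal \<mu> * (ennreal (w z) * indicator E z) + ennreal (\<mu> powr - s) * (ennreal (w z powr - s) * indicator ?Q z) \<partial>lebesgue)"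
      proof (rule nn_integral_mono_AE)
        show "AE z in lebesgue. indicator E z \<le> ennreal \<mu> * (ennreal (w z) * indicator E z) + ennreal (\<mu> powr - s) * (ennreal (w z powr - s) * indicator ?Q z)"
          using pos
        proof eventually_elim
          fix z assume wz: "0 < w z"
          \<comment> \<open>Either \<mu> w(z) is at least 1, or it is below 1 and its negative power
            is at least 1.\<close>
          have "1 \<le> \<mu> * w z + \<mu> powr - s * w z powr - s"
          proof (cases "\<mu> * w z \<ge> 1")
            case False
            then have "(\<mu> * w z) powr 0 \<le> (\<mu> * w z) powr - s"
              using s wz \<mu> by (intro powr_mono') auto
            then have "1 \<le> \<mu> powr - s * w z powr - s" using wz \<mu> by (simp add: powr_mult)
            then show ?thesis using wz \<mu> by (simp add: add_nonneg_nonneg add_increasing)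
          qed (simp add: add_increasing2)
          then have "1 \<le> ennreal \<mu> * ennreal (w z) + ennreal (\<mu> powr - s) * ennreal (w z powr - s)"
            using wz \<mu> by (simp flip: ennreal_mult ennreal_plus)
          then show "indicator E z \<le> ennreal \<mu> * (ennreal (w z) * indicator E z) + ennreal (\<mu> powr - s) * (ennreal (w z powr - s) * indicator ?Q z)"
            using sub by (auto simp: indicator_def)
        qed
      qed
      also have "\<dots> = ennreal \<mu> * weight_measure w E + ennreal (\<mu> powr - s) * J"
        unfolding weight_measure_def J_def by (subst nn_integral_add) (auto simp: nn_integral_cmult)
      also have "\<dots> = ennreal (\<mu> * m + \<mu> powr - s * j)"
        unfolding m(1) J(1) using m(2) J(2) \<mu> by (simp add: ennreal_mult)
      finally show ?thesis using m J \<mu> by (subst (asm) ennreal_le_iff) auto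
    qed
    \<comment> \<open>For \<open>j\<close> = 0 the second term of \<open>young\<close> vanishes for
      every \<mu>, and a small \<mu> makes the first term less than \<open>e\<close>.\<close>
    have j_pos: "j > 0"
    proof (rule ccontr)
      assume "\<not> j > 0"
      then have "j = 0" using J by simp
      then have "e \<le> e / (2 * (m + 1)) * m" using young[of "e / (2 * (m + 1))"] e m by simp
      also have "\<dots> < e" using e m by (simp add: field_simps add_nonneg_pos)
      finally show False by simp
    qed
    \<comment> \<open>This \<open>\<mu>\<close> makes the second term in \<open>young\<close> equal to half of the left-hand side.\<close>
    define \<mu> where "\<mu> = (2 * j / e) powr (q - 1)"
    have \<mu>_pos: "\<mu> > 0" using j_pos e by (simp add: \<mu>_def)
    have "\<mu> powr - s * j = e / 2"
      using q j_pos e by (simp add: \<mu>_def s_def powr_powr powr_minus_divide)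
    then have "e / 2 \<le> \<mu> * m" using young[OF \<mu>_pos] by simp
    then have m_ge: "e / 2 / \<mu> \<le> m" using \<mu>_pos by (simp add: field_simps)
    \<comment> \<open>Once \<mu> is inserted, this is \<open>le\<close>, the Muckenhoupt product at
      this square; \<open>c\<close> collects \<sigma> and the power of the area.\<close>
    have "c * (e / 2) powr q * i \<le> e / 2 / \<mu>"
    proof -
      have "\<mu> = (j / A) powr (q - 1) * A powr (q - 1) / (e / 2) powr (q - 1)"
        using j_pos e A by (simp add: \<mu>_def powr_mult powr_divide)
      moreover have "(e / 2) powr q = (e / 2) * (e / 2) powr (q - 1)" "A powr q = A * A powr (q - 1)"
        using e A powr_mult_base[of "e / 2" "q - 1"] powr_mult_base[of A "q - 1"] by simp_all
      ultimately have "c * (e / 2) powr q * i * \<mu> = (i / A * (j / A) powr (q - 1)) / \<sigma> * (e / 2)"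
        using e A \<sigma> by (simp add: c_def field_simps)
      also have "\<dots> \<le> 1 * (e / 2)"
      proof (rule mult_right_mono)
        show "i / A * (j / A) powr (q - 1) / \<sigma> \<le> 1" using le \<sigma>(2) by (subst pos_divide_le_eq) auto
      qed (use e in simp)
      finally show ?thesis using \<mu>_pos by (simp add: field_simps)
    qed
    with m_ge have "c * (e / 2) powr q * i \<le> m" by simp
    then have "ennreal (c * (e / 2) powr q * i) \<le> ennreal m" by (rule ennreal_leI)
    then show ?thesis using m i \<open>c > 0\<close> by (simp add: ennreal_mult e_def)
  qed (use q in simp)
  ultimately show ?thesis by blast
qed

text \<open>Here 1/w is essentially bounded on the square, so |E| is at most that bound times w(E),
  without any optimisation. The form with half the measure and exponent 1 only matches the case q >
  1; the 2 in \<open>c\<close> cancels the half.\<close>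

lemma muckenhoupt1_doubling:
  assumes fin: "muckenhoupt1_sup r\<^sub>0 w < \<infinity>"
  shows "\<exists>c>0. \<forall>a E. E \<in> sets lebesgue \<longrightarrow> E \<subseteq> axis_square a r\<^sub>0 \<longrightarrow>
    ennreal (c * (measure lebesgue E / 2) powr 1) * weight_measure w (axis_square a r\<^sub>0) \<le> weight_measure w E"
proof -
  define \<sigma> where "\<sigma> = enn2real (muckenhoupt1_sup r\<^sub>0 w) + 1"
  have \<sigma>: "muckenhoupt1_sup r\<^sub>0 w \<le> ennreal \<sigma>" "0 < \<sigma>"
    using fin by (auto simp: \<sigma>_def add_nonneg_pos less_top[symmetric] intro!: order_trans[OF _ ennreal_leI[of "enn2real _" ]] )
  define A where "A = r\<^sub>0\<^sup>2"
  have A: "A > 0" "emeasure lebesgue (axis_square a r\<^sub>0) = ennreal A" for a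
    using r0 emeasure_lebesgue_axis_square[of r\<^sub>0 a] by (simp_all add: A_def)
  define c where "c = 2 / (\<sigma> * A)"
  have "c > 0" using \<sigma> A by (simp add: c_def)
  moreover have "ennreal (c * (measure lebesgue E / 2) powr 1) * weight_measure w (axis_square a r\<^sub>0) \<le> weight_measure w E"
    if E [measurable]: "E \<in> sets lebesgue" and sub: "E \<subseteq> axis_square a r\<^sub>0" for a E
  proof -
    let ?Q = "axis_square a r\<^sub>0"
    define L where "L = esssup (restrict_space lebesgue ?Q) (\<lambda>z. ennreal (inverse (w z)))"
    obtain i where i: "weight_measure w ?Q = ennreal i" "i > 0"
    proof -
      have "weight_measure w ?Q = ennreal (enn2real (weight_measure w ?Q))"
        using weight_square_finite[of a] by simp
      moreover have "0 < weight_measure w ?Q"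
        using A by (intro weight_measure_pos) auto
      ultimately show ?thesis using that by (metis ennreal_less_zero_iff)
    qed
    have "set_average ?Q (\<lambda>z. ennreal (w z)) * L \<le> muckenhoupt1_sup r\<^sub>0 w"
      unfolding muckenhoupt1_sup_def L_def by (rule SUP_upper2[of a]) (simp_all add: Let_def)
    also note \<sigma>(1)
    finally have le: "ennreal i / ennreal A * L \<le> ennreal \<sigma>"
      using A(2)[of a] i(1) by (simp add: set_average_def weight_measure_def)
    have Lfin: "L < \<infinity>"
    proof (rule ccontr)
      assume "\<not> L < \<infinity>"
      then show False using le i A by (simp add: divide_ennreal ennreal_mult_top top_unique not_less)
    qed
    define l where "l = enn2real L"
    have L: "L = ennreal l" "l \<ge> 0" using Lfin by (simp_all add: l_def)
    have le: "i / A * l \<le> \<sigma>"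
    proof -
      have "ennreal (i / A * l) \<le> ennreal \<sigma>"
        using le A i L by (subst ennreal_mult) (auto simp: divide_ennreal)
      then show ?thesis using \<sigma> by simp
    qed
    have "AE z in restrict_space lebesgue ?Q. ennreal (inverse (w z)) \<le> ennreal l"
      unfolding L(1)[symmetric] L_def by (rule esssup_AE)
    then have ae: "AE z in lebesgue. z \<in> ?Q \<longrightarrow> ennreal (inverse (w z)) \<le> ennreal l"
      by (subst (asm) AE_restrict_space_iff) auto
    have Efin: "emeasure lebesgue E \<le> ennreal A"
      using emeasure_mono[OF sub, of lebesgue] A by simp
    define e where "e = measure lebesgue E"
    have e: "emeasure lebesgue E = ennreal e" "e \<ge> 0"
      using neq_top_trans[OF _ Efin] by (simp_all add: e_def emeasure_eq_ennreal_measure del: emeasure_completion)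
    have "ennreal e = (\<integral>\<^sup>+z. indicator E z \<partial>lebesgue)" using e by simp
    also have "\<dots> \<le> (\<integral>\<^sup>+z. ennreal l * (ennreal (w z) * indicator E z) \<partial>lebesgue)"
    proof (rule nn_integral_mono_AE)
      show "AE z in lebesgue. indicator E z \<le> ennreal l * (ennreal (w z) * indicator E z)"
        using pos ae
      proof eventually_elim
        fix z assume wz: "0 < w z" and "z \<in> ?Q \<longrightarrow> ennreal (inverse (w z)) \<le> ennreal l"
        then have "inverse (w z) \<le> l" if "z \<in> E" using that sub L by auto
        then have "1 \<le> l * w z" if "z \<in> E" using that wz by (simp add: field_simps)
        then show "indicator E z \<le> ennreal l * (ennreal (w z) * indicator E z)"
          using L wz by (auto simp: indicator_def simp flip: ennreal_mult)
      qed
    qed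
    also have "\<dots> = ennreal l * weight_measure w E"
      unfolding weight_measure_def by (simp add: nn_integral_cmult)
    finally have e_le: "ennreal e \<le> ennreal l * weight_measure w E" .
    have "ennreal (c * (e / 2) * i) = ennreal (i / (\<sigma> * A)) * ennreal e"
      using i \<sigma> A e by (simp add: c_def flip: ennreal_mult)
    also have "\<dots> \<le> ennreal (i / (\<sigma> * A)) * (ennreal l * weight_measure w E)"
      by (intro mult_left_mono e_le) auto
    also have "\<dots> = ennreal (i / A * l / \<sigma>) * weight_measure w E"
      using i \<sigma> A L by (simp add: mult.assoc[symmetric] ac_simps flip: ennreal_mult)
    also have "\<dots> \<le> 1 * weight_measure w E"
    proof (rule mult_right_mono)
      have "i / A * l / \<sigma> \<le> 1" using le \<sigma>(2) by (subst pos_divide_le_eq) auto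
      then show "ennreal (i / A * l / \<sigma>) \<le> 1" by (subst ennreal_1[symmetric]) (rule ennreal_leI)
    qed simp
    finally have "ennreal (c * (e / 2) * i) \<le> weight_measure w E" by simp
    moreover have "ennreal (c * (measure lebesgue E / 2) powr 1) * weight_measure w ?Q = ennreal (c * (e / 2) * i)"
      unfolding i(1) e_def[symmetric] using i e \<open>c > 0\<close> by (simp flip: ennreal_mult)
    ultimately show ?thesis by simp
  qed
  ultimately show ?thesis by blast
qed

end

text \<open>Squares of side \<open>r\<close> become squares of half-side h = r/2, and measurable
  subsets are specialised to disks. Since area is quadratic in the radius, the power q of the area
  becomes the exponent 2q. The measure is built from a Borel version of \<open>w\<close>, equal to
  it almost everywhere.\<close>

lemma A_infinity_doubling:
  assumes w: "w \<in> A_infinity_restricted"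
    and w0 [measurable]: "w\<^sub>0 \<in> borel_measurable borel"
    and eq: "AE z in lborel. w z = w\<^sub>0 z"
  shows "\<exists>h q c. doubling_measure (density lborel (\<lambda>z. ennreal (w\<^sub>0 z))) h q c"
proof -
  obtain q' r where q': "1 \<le> q'" and weight: "is_weight w" and pos: "AE z in lebesgue. 0 < w z"
    and r: "0 < r" and fin: "(if q' = 1 then muckenhoupt1_sup r w else muckenhoupt_sup q' r w) < \<infinity>"
    using w by (auto simp: A_infinity_restricted_def A_restricted_def)
  have "\<exists>c>0. \<forall>a E. E \<in> sets lebesgue \<longrightarrow> E \<subseteq> axis_square a r \<longrightarrow>
    ennreal (c * (measure lebesgue E / 2) powr q') * weight_measure w (axis_square a r) \<le> weight_measure w E"
    using fin q' muckenhoupt1_doubling[OF weight pos r] muckenhoupt_doubling[OF weight pos r, of q']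
    by (cases "q' = 1") auto
  then obtain c where c: "c > 0"
    and dbl: "\<And>a E. E \<in> sets lebesgue \<Longrightarrow> E \<subseteq> axis_square a r \<Longrightarrow>
    ennreal (c * (measure lebesgue E / 2) powr q') * weight_measure w (axis_square a r) \<le> weight_measure w E"
    by blast
  let ?M = "density lborel (\<lambda>z. ennreal (w\<^sub>0 z))"
  let ?Q = "\<lambda>z. cbox (z - Complex (r/2) (r/2)) (z + Complex (r/2) (r/2))"
  have em: "emeasure ?M E = weight_measure w E" if "E \<in> sets borel" for E
    using that eq unfolding weight_measure_def
    by (auto simp: emeasure_density nn_integral_completion intro!: nn_integral_cong_AE)
  have Q: "?Q z = axis_square (z - Complex (r/2) (r/2)) r" for z
    unfolding axis_square_def by (rule arg_cong2[of _ _ _ _ cbox]) (simp_all add: complex_eq_iff)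
  have "doubling_measure ?M (r/2) q' c"
  proof
    fix z
    show fin: "emeasure ?M (?Q z) < \<infinity>"
      using weight_square_finite[OF weight pos r] by (subst em) (auto simp: Q axis_square_def)
    show "0 < emeasure ?M (?Q z)"
    proof (subst em)
      have "0 < emeasure lebesgue (?Q z)"
        unfolding Q emeasure_lebesgue_axis_square[OF r] using r by simp
      then show "0 < weight_measure w (?Q z)"
        by (intro weight_measure_pos[OF weight pos r]) auto
    qed auto
    fix \<zeta> \<rho> assume \<rho>: "(0::real) < \<rho>" "ball \<zeta> \<rho> \<subseteq> ?Q z"
    have bfin: "emeasure ?M (ball \<zeta> \<rho>) < \<infinity>"
      using emeasure_mono[OF \<rho>(2), of ?M] fin by (auto simp: less_top[symmetric] top_unique)
    \<comment> \<open>Half the area of the disk is \<pi> \<rho>^2 / 2, which is at least \<rho>^2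
      because \<pi> \<ge> 2.\<close>
    have le: "\<rho> powr (2 * q') \<le> (measure lebesgue (ball \<zeta> \<rho>) / 2) powr q'"
    proof -
      have "\<rho> powr (2 * q') = (\<rho>\<^sup>2) powr q'" using \<rho> by (simp add: powr_powr[symmetric])
      also have "\<dots> \<le> (measure lebesgue (ball \<zeta> \<rho>) / 2) powr q'"
        using \<rho> q' pi_ge_two by (intro powr_mono2) (auto simp: content_ball unit_ball_vol_2)
      finally show ?thesis .
    qed
    have "ennreal (c * \<rho> powr (2 * q') * measure ?M (?Q z)) = ennreal (c * \<rho> powr (2 * q')) * weight_measure w (?Q z)"
      using c fin by (subst em[symmetric]) (auto simp: ennreal_mult emeasure_eq_ennreal_measure)
    also have "\<dots> \<le> ennreal (c * (measure lebesgue (ball \<zeta> \<rho>) / 2) powr q') * weight_measure w (?Q z)"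
      using c le by (intro mult_right_mono ennreal_leI mult_left_mono) auto
    also have "\<dots> \<le> weight_measure w (ball \<zeta> \<rho>)"
      unfolding Q using \<rho> by (intro dbl) (auto simp: Q)
    also have "\<dots> = ennreal (measure ?M (ball \<zeta> \<rho>))"
      using bfin by (subst em[symmetric]) (auto simp: emeasure_eq_ennreal_measure)
    finally show "c * \<rho> powr (2 * q') * measure ?M (?Q z) \<le> measure ?M (ball \<zeta> \<rho>)" by simp
  qed (use r q' c in auto)
  then show ?thesis by blast
qed

section \<open>Compact operators on complex inner product spaces\<close>

text \<open>The space of interest is a subspace of a function type, so everything is developed
  relative to a carrier \<open>H\<close>. Completeness is a premise of the Riesz representation
  alone; the limits of the spectral part are supplied by the compactness of the operator.\<close>

locale complex_inner_on = vector_space scale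
  for scale :: "complex \<Rightarrow> 'a::ab_group_add \<Rightarrow> 'a" (infixr "*s" 75) +
  fixes H :: "'a set" and ip :: "'a \<Rightarrow> 'a \<Rightarrow> complex"
  assumes subspace_H: "subspace H"
    and ip_add: "f \<in> H \<Longrightarrow> g \<in> H \<Longrightarrow> h \<in> H \<Longrightarrow> ip (f + g) h = ip f h + ip g h"
    and ip_scale: "f \<in> H \<Longrightarrow> h \<in> H \<Longrightarrow> ip (a *s f) h = a * ip f h"
    and ip_cnj: "f \<in> H \<Longrightarrow> h \<in> H \<Longrightarrow> cnj (ip f h) = ip h f"
    and ip_nonneg: "f \<in> H \<Longrightarrow> 0 \<le> Re (ip f f)"
    and ip_eq_0: "f \<in> H \<Longrightarrow> ip f f = 0 \<Longrightarrow> f = 0"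
begin

section \<open>Norm, Cauchy-Schwarz inequality and Riesz representation\<close>

definition nrm :: "'a \<Rightarrow> real" where "nrm f = sqrt (Re (ip f f))"

lemma H_closed [simp]:
  "0 \<in> H" "f \<in> H \<Longrightarrow> g \<in> H \<Longrightarrow> f + g \<in> H" "f \<in> H \<Longrightarrow> a *s f \<in> H"
  "f \<in> H \<Longrightarrow> g \<in> H \<Longrightarrow> f - g \<in> H" "(\<And>i. i \<in> I \<Longrightarrow> F i \<in> H) \<Longrightarrow> sum F I \<in> H"
  using subspace_H by (auto intro: subspace_0 subspace_add subspace_scale subspace_diff subspace_sum)

lemma ip_zero [simp]: "h \<in> H \<Longrightarrow> ip 0 h = 0" "h \<in> H \<Longrightarrow> ip h 0 = 0"
proof -
  show 1: "ip 0 h = 0" if "h \<in> H" for h using ip_scale[of 0 h 0] that by simp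
  show "ip h 0 = 0" if "h \<in> H" using ip_cnj[of 0 h] 1[OF that] that by simp
qed

lemma ip_add_right: "f \<in> H \<Longrightarrow> g \<in> H \<Longrightarrow> h \<in> H \<Longrightarrow> ip h (f + g) = ip h f + ip h g"
  using ip_cnj[of "f + g" h] ip_add[of f g h] ip_cnj[of f h] ip_cnj[of g h] by auto

lemma ip_scale_right: "f \<in> H \<Longrightarrow> h \<in> H \<Longrightarrow> ip h (a *s f) = cnj a * ip h f"
  using ip_cnj[of "a *s f" h] ip_scale[of f h a] ip_cnj[of f h] by auto

lemma ip_diff: "f \<in> H \<Longrightarrow> g \<in> H \<Longrightarrow> h \<in> H \<Longrightarrow> ip (f - g) h = ip f h - ip g h"
  using ip_add[of "f - g" g h] by auto

lemma ip_diff_right: "f \<in> H \<Longrightarrow> g \<in> H \<Longrightarrow> h \<in> H \<Longrightarrow> ip h (f - g) = ip h f - ip h g"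
  using ip_add_right[of "f - g" g h] by auto

lemma ip_sum: "(\<And>i. i \<in> I \<Longrightarrow> F i \<in> H) \<Longrightarrow> h \<in> H \<Longrightarrow> ip (sum F I) h = (\<Sum>i\<in>I. ip (F i) h)"
  by (induction I rule: infinite_finite_induct) (auto simp: ip_add)

lemma ip_sum_right: "(\<And>i. i \<in> I \<Longrightarrow> F i \<in> H) \<Longrightarrow> h \<in> H \<Longrightarrow> ip h (sum F I) = (\<Sum>i\<in>I. ip h (F i))"
  by (induction I rule: infinite_finite_induct) (auto simp: ip_add_right)

lemma nrm_nonneg: "f \<in> H \<Longrightarrow> 0 \<le> nrm f"
  by (simp add: nrm_def ip_nonneg)

lemma nrm_zero [simp]: "nrm 0 = 0" by (simp add: nrm_def)

lemma ip_self: "f \<in> H \<Longrightarrow> ip f f = of_real ((nrm f)\<^sup>2)"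
  using ip_cnj[of f f] ip_nonneg[of f] by (auto simp: nrm_def complex_eq_iff)

lemma nrm_eq_0: "f \<in> H \<Longrightarrow> nrm f = 0 \<longleftrightarrow> f = 0"
  using ip_self[of f] ip_eq_0[of f] by auto

lemma nrm_scale:
  assumes "f \<in> H"
  shows "nrm (a *s f) = cmod a * nrm f"
proof -
  have "ip (a *s f) (a *s f) = (a * cnj a) * ip f f"
    using assms by (simp add: ip_scale ip_scale_right)
  also have "\<dots> = of_real ((cmod a * nrm f)\<^sup>2)"
    by (simp only: complex_norm_square[symmetric] ip_self[OF assms] of_real_mult[symmetric] power_mult_distrib)
  finally show ?thesis using nrm_nonneg[OF assms] by (simp add: nrm_def[of "a *s f"])
qed

lemma nrm_sq: "f \<in> H \<Longrightarrow> (nrm f)\<^sup>2 = Re (ip f f)"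
  by (simp add: nrm_def ip_nonneg)

lemma nrm_add_sq: "f \<in> H \<Longrightarrow> g \<in> H \<Longrightarrow> (nrm (f + g))\<^sup>2 = (nrm f)\<^sup>2 + (nrm g)\<^sup>2 + 2 * Re (ip f g)"
  using ip_cnj[of f g, symmetric] by (simp add: nrm_sq ip_add ip_add_right)

lemma nrm_diff_sq: "f \<in> H \<Longrightarrow> g \<in> H \<Longrightarrow> (nrm (f - g))\<^sup>2 = (nrm f)\<^sup>2 + (nrm g)\<^sup>2 - 2 * Re (ip f g)"
  using ip_cnj[of f g, symmetric] by (simp add: nrm_sq ip_diff ip_diff_right)

lemma Cauchy_Schwarz: 
  assumes "f \<in> H" "g \<in> H"
  shows "cmod (ip f g) \<le> nrm f * nrm g"
proof (cases "g = 0")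
  case False
  define n where "n = (nrm g)\<^sup>2"
  have n: "n > 0" using False assms nrm_eq_0[of g] by (simp add: n_def)
  \<comment> \<open>\<open>a *s g\<close> is the orthogonal projection of \<open>f\<close> to the
    line through \<open>g\<close>; the inequality is the nonnegativity of the squared distance from
    \<open>f\<close> to it.\<close>
  define a where "a = ip f g / of_real n"
  have "ip f (a *s g) = cnj a * ip f g" using assms by (simp add: ip_scale_right)
  also have "\<dots> = ip f g * cnj (ip f g) / of_real n" by (simp add: a_def)
  also have "\<dots> = of_real ((cmod (ip f g))\<^sup>2 / n)"
    by (simp only: complex_norm_square[symmetric] of_real_divide)
  finally have "ip f (a *s g) = of_real ((cmod (ip f g))\<^sup>2 / n)" .
  then have "Re (ip f (a *s g)) = (cmod (ip f g))\<^sup>2 / n" by simp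
  moreover have "(nrm (a *s g))\<^sup>2 = (cmod (ip f g))\<^sup>2 / n"
  proof -
    have "nrm (a *s g) = cmod (ip f g) / n * nrm g"
      using n by (simp add: nrm_scale[OF assms(2)] a_def norm_divide)
    then have "(nrm (a *s g))\<^sup>2 = (cmod (ip f g) / n)\<^sup>2 * n"
      by (simp only: power_mult_distrib n_def)
    also have "\<dots> = (cmod (ip f g))\<^sup>2 / n"
      using n by (simp only: power_divide power2_eq_square[of n]) simp
    finally show ?thesis .
  qed
  moreover have "(nrm (f - a *s g))\<^sup>2 = (nrm f)\<^sup>2 + (nrm (a *s g))\<^sup>2 - 2 * Re (ip f (a *s g))"
    by (rule nrm_diff_sq) (use assms in auto)
  ultimately have "(cmod (ip f g))\<^sup>2 / n \<le> (nrm f)\<^sup>2"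
    using zero_le_power2[of "nrm (f - a *s g)"] by linarith
  then have "(cmod (ip f g))\<^sup>2 \<le> (nrm f * nrm g)\<^sup>2"
    using n by (simp only: pos_divide_le_eq power_mult_distrib n_def)
  then show ?thesis by (rule power2_le_imp_le) (simp_all add: nrm_nonneg assms)
qed (use assms in simp)

lemma nrm_triangle: 
  assumes "f \<in> H" "g \<in> H"
  shows "nrm (f + g) \<le> nrm f + nrm g"
proof -
  have "Re (ip f g) \<le> nrm f * nrm g"
    using Cauchy_Schwarz[OF assms] complex_Re_le_cmod[of "ip f g"] by linarith
  then have "(nrm (f + g))\<^sup>2 \<le> (nrm f + nrm g)\<^sup>2"
    unfolding nrm_add_sq[OF assms] power2_sum by linarith
  then show ?thesis by (rule power2_le_imp_le) (simp_all add: nrm_nonneg assms)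
qed

lemma nrm_minus_commute:
  assumes "f \<in> H" "g \<in> H"
  shows "nrm (f - g) = nrm (g - f)"
proof -
  have "f - g = (-1) *s (g - f)" by (simp add: scale_minus_left)
  then show ?thesis using nrm_scale[of "g - f" "-1"] assms by simp
qed

lemma nrm_triangle_diff: 
  assumes "f \<in> H" "g \<in> H" "h \<in> H"
  shows "nrm (f - h) \<le> nrm (f - g) + nrm (g - h)"
  using nrm_triangle[of "f - g" "g - h"] assms by simp

lemma nrm_reverse_triangle:
  assumes "f \<in> H" "g \<in> H"
  shows "\<bar>nrm f - nrm g\<bar> \<le> nrm (f - g)"
proof -
  have "nrm f \<le> nrm (f - g) + nrm g" "nrm g \<le> nrm (g - f) + nrm f"
    using nrm_triangle[of "f - g" g] nrm_triangle[of "g - f" f] assms by simp_all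
  then show ?thesis by (simp add: nrm_minus_commute[OF assms])
qed

text \<open>Variational proof: the representing vector is the minimiser of \<open>J\<close>. The
  parallelogram law makes minimising sequences Cauchy; vanishing of the first variation at the
  minimiser gives the real parts, and applying that to \<open>\<i> *s f\<close> gives the imaginary
  parts.\<close>

lemma riesz_representation:
  assumes complete: "\<And>\<sigma>. (\<And>n. \<sigma> n \<in> H) \<Longrightarrow>
      (\<And>\<epsilon>. 0 < \<epsilon> \<Longrightarrow> \<exists>N. \<forall>m\<ge>N. \<forall>n\<ge>N. nrm (\<sigma> m - \<sigma> n) < \<epsilon>) \<Longrightarrow> \<exists>g\<in>H. (\<lambda>n::nat. nrm (\<sigma> n - g)) \<longlonglongrightarrow> 0"
    and L: "\<And>f g. f \<in> H \<Longrightarrow> g \<in> H \<Longrightarrow> L (f + g) = L f + L g" "\<And>a f. f \<in> H \<Longrightarrow> L (a *s f) = a * L f"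
    and bdd: "\<And>f. f \<in> H \<Longrightarrow> cmod (L f) \<le> C * nrm f"
  shows "\<exists>h\<in>H. \<forall>f\<in>H. L f = ip f h"
proof -
  have Ldiff: "L (f - g) = L f - L g" if "f \<in> H" "g \<in> H" for f g
    using L(1)[of "f - g" g] that by auto
  \<comment> \<open>If \<open>h\<close> represents \<open>L\<close>, then J f = |f - h|^2 - |h|^2,
    so \<open>h\<close> is the only possible minimiser.\<close>
  define J where "J f = (nrm f)\<^sup>2 - 2 * Re (L f)" for f
  have lb: "- (C\<^sup>2) \<le> J f" if "f \<in> H" for f
  proof -
    have "Re (L f) \<le> C * nrm f" using bdd[OF that] complex_Re_le_cmod[of "L f"] by simp
    moreover have "0 \<le> (nrm f - C)\<^sup>2" by simp
    ultimately show ?thesis by (simp add: J_def power2_diff mult.commute)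
  qed
  define \<mu> where "\<mu> = Inf (J ` H)"
  have \<mu>: "\<mu> \<le> J f" if "f \<in> H" for f
    unfolding \<mu>_def using that lb by (intro cInf_lower bdd_belowI2[where m="- (C\<^sup>2)"]) auto
  have "\<exists>f\<in>H. J f < \<mu> + inverse (real (Suc n))" for n
  proof -
    have "Inf (J ` H) < \<mu> + inverse (real (Suc n))" by (simp add: \<mu>_def)
    moreover have "J ` H \<noteq> {}" using H_closed(1) by blast
    moreover have "bdd_below (J ` H)" by (rule bdd_belowI2[OF lb])
    ultimately show ?thesis by (subst (asm) cInf_less_iff) auto
  qed
  then obtain \<sigma> where \<sigma>: "\<And>n. \<sigma> n \<in> H" "\<And>n. J (\<sigma> n) < \<mu> + inverse (real (Suc n))" by metis
  \<comment> \<open>The midpoint of \<open>f\<close> and \<open>g\<close> cannot go below \<mu>;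
    with the parallelogram law this forces two near-minimisers to be close to each other.\<close>
  have par: "(nrm (f - g))\<^sup>2 \<le> 2 * (J f - \<mu>) + 2 * (J g - \<mu>)" if fg: "f \<in> H" "g \<in> H" for f g
  proof -
    let ?m = "(1/2) *s (f + g)"
    have "J ?m = (nrm (f + g))\<^sup>2 / 4 - Re (L f) - Re (L g)"
      using fg by (simp add: J_def nrm_scale power_divide power_mult_distrib L norm_divide add_divide_distrib)
    moreover have "(nrm (f + g))\<^sup>2 + (nrm (f - g))\<^sup>2 = 2 * (nrm f)\<^sup>2 + 2 * (nrm g)\<^sup>2"
      using nrm_add_sq[OF fg] nrm_diff_sq[OF fg] by simp
    moreover have "\<mu> \<le> J ?m" using fg by (intro \<mu>) auto
    ultimately show ?thesis by (simp add: J_def algebra_simps)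
  qed
  have "\<exists>h\<in>H. (\<lambda>n. nrm (\<sigma> n - h)) \<longlonglongrightarrow> 0"
  proof (rule complete)
    fix \<epsilon> :: real assume \<epsilon>: "0 < \<epsilon>"
    obtain N where N: "inverse (real (Suc N)) < \<epsilon>\<^sup>2 / 4" using reals_Archimedean[of "\<epsilon>\<^sup>2/4"] \<epsilon> by auto
    have "nrm (\<sigma> m - \<sigma> n) < \<epsilon>" if "m \<ge> N" "n \<ge> N" for m n
    proof -
      have "inverse (real (Suc m)) \<le> inverse (real (Suc N))" "inverse (real (Suc n)) \<le> inverse (real (Suc N))"
        using that by (auto intro!: le_imp_inverse_le)
      then have "(nrm (\<sigma> m - \<sigma> n))\<^sup>2 < \<epsilon>\<^sup>2"
        using par[OF \<sigma>(1) \<sigma>(1), of m n] \<sigma>(2)[of m] \<sigma>(2)[of n] N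
        unfolding right_diff_distrib by linarith
      then show ?thesis using \<epsilon> by (auto intro: power2_less_imp_less)
    qed
    then show "\<exists>N. \<forall>m\<ge>N. \<forall>n\<ge>N. nrm (\<sigma> m - \<sigma> n) < \<epsilon>" by blast
  qed (use \<sigma> in auto)
  then obtain h where h: "h \<in> H" "(\<lambda>n. nrm (\<sigma> n - h)) \<longlonglongrightarrow> 0" by blast
  \<comment> \<open>The sequence used for the comparison exceeds \<open>J h\<close> because
    \<open>J (\<sigma> n)\<close> is within 1/(n+1) of \<mu>, and it tends to \<mu> because
    \<open>J\<close> is continuous along \<sigma>.\<close>
  have "J h \<le> \<mu>"
  proof (rule LIMSEQ_le_const)
    have "(\<lambda>n. nrm (\<sigma> n)) \<longlonglongrightarrow> nrm h"
    proof (rule LIM_zero_cancel, rule Lim_null_comparison[OF _ h(2)])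
      show "\<forall>\<^sub>F n in sequentially. norm (nrm (\<sigma> n) - nrm h) \<le> nrm (\<sigma> n - h)"
        using nrm_reverse_triangle[OF \<sigma>(1) h(1)] by simp
    qed
    moreover have "(\<lambda>n. L (\<sigma> n) - L h) \<longlonglongrightarrow> 0"
    proof (rule Lim_null_comparison)
      show "(\<lambda>n. C * nrm (\<sigma> n - h)) \<longlonglongrightarrow> 0" using tendsto_mult_right_zero[OF h(2)] by simp
      show "\<forall>\<^sub>F n in sequentially. cmod (L (\<sigma> n) - L h) \<le> C * nrm (\<sigma> n - h)"
        using bdd h \<sigma> by (auto simp flip: Ldiff)
    qed
    ultimately have "(\<lambda>n. (nrm (\<sigma> n))\<^sup>2 - 2 * Re (L (\<sigma> n))) \<longlonglongrightarrow> J h"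
      unfolding J_def by (intro tendsto_intros) (auto dest: LIM_zero_cancel)
    then have "(\<lambda>n. J h - (J (\<sigma> n) - inverse (real (Suc n)))) \<longlonglongrightarrow> J h - (J h - 0)"
      unfolding J_def[of "\<sigma> _"] by (intro tendsto_diff tendsto_const LIMSEQ_inverse_real_of_nat)
    then show "(\<lambda>n. \<mu> + (J h - (J (\<sigma> n) - inverse (real (Suc n))))) \<longlonglongrightarrow> \<mu>"
      using tendsto_add[OF tendsto_const[of \<mu>]] by fastforce
    show "\<exists>N. \<forall>n\<ge>N. J h \<le> \<mu> + (J h - (J (\<sigma> n) - inverse (real (Suc n))))"
      using \<sigma>(2) by (auto simp: less_imp_le algebra_simps)
  qed
  have Re_eq: "Re (L f) = Re (ip f h)" if f: "f \<in> H" for f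
  proof -
    define b where "b = Re (ip h f) - Re (L f)"
    have quad: "0 \<le> 2 * t * b + t\<^sup>2 * (nrm f)\<^sup>2" for t :: real
    proof -
      have "J h \<le> J (h + of_real t *s f)" using \<open>J h \<le> \<mu>\<close> \<mu>[of "h + of_real t *s f"] f h by simp
      also have "\<dots> = J h + 2 * t * b + t\<^sup>2 * (nrm f)\<^sup>2"
        using f h by (simp add: J_def nrm_add_sq L nrm_scale ip_scale_right b_def power_mult_distrib algebra_simps)
      finally show ?thesis by simp
    qed
    have "b = 0"
    proof (rule ccontr)
      assume b: "b \<noteq> 0"
      \<comment> \<open>With t = -b/n the linear term of \<open>quad\<close> dominates the quadratic
        one, since |f|^2 / n < 1; the added 1 also covers f = 0.\<close>
      define n where "n = (nrm f)\<^sup>2 + 1"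
      have n: "n > 0" by (simp add: n_def add_nonneg_pos)
      have "0 \<le> 2 * (- b / n) * b + (- b / n)\<^sup>2 * (nrm f)\<^sup>2" by (rule quad)
      also have "\<dots> = - (b\<^sup>2) / n * (2 - (nrm f)\<^sup>2 / n)" using n by (simp add: power2_eq_square field_simps)
      also have "\<dots> < 0"
      proof -
        have "(nrm f)\<^sup>2 / n < 2" using n by (simp add: n_def pos_divide_less_eq add_nonneg_pos)
        then show ?thesis using b n by (intro mult_neg_pos) (auto simp: divide_neg_pos)
      qed
      finally show False by simp
    qed
    moreover have "Re (ip h f) = Re (ip f h)" using ip_cnj[OF f h(1), symmetric] by simp
    ultimately show ?thesis by (simp add: b_def)
  qed
  have "L f = ip f h" if f: "f \<in> H" for f
  proof (rule complex_eqI)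
    show "Re (L f) = Re (ip f h)" by (rule Re_eq[OF f])
    have "Re (L (\<i> *s f)) = Re (ip (\<i> *s f) h)" using f by (intro Re_eq) auto
    then show "Im (L f) = Im (ip f h)" using f h by (simp add: L ip_scale)
  qed
  then show ?thesis using h by blast
qed

end

text \<open>Compactness is given in sequential form, as the arguments use it. The adjoint
  \<open>S\<close> is a parameter, since its existence is a matter of completeness.\<close>

locale compact_operator = complex_inner_on +
  fixes T S :: "'a \<Rightarrow> 'a"
  assumes T_H [simp]: "f \<in> H \<Longrightarrow> T f \<in> H" and S_H [simp]: "f \<in> H \<Longrightarrow> S f \<in> H"
    and T_add: "f \<in> H \<Longrightarrow> g \<in> H \<Longrightarrow> T (f + g) = T f + T g"
    and T_scale: "f \<in> H \<Longrightarrow> T (a *s f) = a *s T f"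
    and S_add: "f \<in> H \<Longrightarrow> g \<in> H \<Longrightarrow> S (f + g) = S f + S g"
    and S_scale: "f \<in> H \<Longrightarrow> S (a *s f) = a *s S f"
    and adj: "f \<in> H \<Longrightarrow> g \<in> H \<Longrightarrow> ip (T f) g = ip f (S g)"
    and compact: "(\<And>n. \<sigma> n \<in> H) \<Longrightarrow> (\<And>n. nrm (\<sigma> n) \<le> 1) \<Longrightarrow>
      \<exists>r g. strict_mono (r :: nat \<Rightarrow> nat) \<and> g \<in> H \<and> (\<lambda>n. nrm (T (\<sigma> (r n)) - g)) \<longlonglongrightarrow> 0"
begin

section \<open>Boundedness of the operator and of its adjoint\<close>

lemma T_diff: "f \<in> H \<Longrightarrow> g \<in> H \<Longrightarrow> T (f - g) = T f - T g"
  using T_add[of "f - g" g] by (auto simp: eq_diff_eq)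

lemma S_diff: "f \<in> H \<Longrightarrow> g \<in> H \<Longrightarrow> S (f - g) = S f - S g"
  using S_add[of "f - g" g] by (auto simp: eq_diff_eq)

lemma T_zero [simp]: "T 0 = 0" using T_scale[of 0 0] by simp
lemma S_zero [simp]: "S 0 = 0" using S_scale[of 0 0] by simp

lemma ST_sum: "(\<And>i. i \<in> I \<Longrightarrow> F i \<in> H) \<Longrightarrow> S (T (sum F I)) = (\<Sum>i\<in>I. S (T (F i)))"
  by (induction I rule: infinite_finite_induct) (auto simp: T_add S_add)

lemma adj': "f \<in> H \<Longrightarrow> g \<in> H \<Longrightarrow> ip (S f) g = ip f (T g)"
  using adj[of g f] ip_cnj[of "T g" f] ip_cnj[of g "S f"] by simp

lemma ST_self: "f \<in> H \<Longrightarrow> g \<in> H \<Longrightarrow> ip (S (T f)) g = ip f (S (T g))"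
  by (simp add: adj adj')

lemma bounded_unit: "\<exists>C>0. \<forall>f\<in>H. nrm f \<le> 1 \<longrightarrow> nrm (T f) \<le> C"
proof (rule ccontr)
  assume "\<not> ?thesis"
  then have no: "\<not> (0 < C \<and> (\<forall>f\<in>H. nrm f \<le> 1 \<longrightarrow> nrm (T f) \<le> C))" for C by blast
  have "\<forall>n. \<exists>f. f \<in> H \<and> nrm f \<le> 1 \<and> nrm (T f) > real (Suc n)"
  proof
    fix n show "\<exists>f. f \<in> H \<and> nrm f \<le> 1 \<and> nrm (T f) > real (Suc n)"
      using no[of "real (Suc n)"] by (auto simp: not_le)
  qed
  from choice[OF this] obtain \<sigma> where \<sigma>: "\<And>n. \<sigma> n \<in> H" "\<And>n. nrm (\<sigma> n) \<le> 1"
    "\<And>n. nrm (T (\<sigma> n)) > real (Suc n)" by auto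
  obtain r g where r: "strict_mono r" "g \<in> H" "(\<lambda>n. nrm (T (\<sigma> (r n)) - g)) \<longlonglongrightarrow> 0"
    using compact[of \<sigma>, OF \<sigma>(1,2)] by (elim exE conjE) (rule that)
  have "\<forall>\<^sub>F n in sequentially. nrm (T (\<sigma> (r n)) - g) < 1"
    using order_tendstoD(2)[OF r(3), of 1] by simp
  moreover have "\<forall>\<^sub>F n in sequentially. real n > 1 + nrm g"
    using filterlim_real_sequentially by (simp add: filterlim_at_top_dense)
  ultimately have "\<forall>\<^sub>F n in sequentially. False"
  proof eventually_elim
    case (elim n)
    have "real n \<le> real (r n)" using seq_suble[OF r(1), of n] by simp
    also have "\<dots> < nrm (T (\<sigma> (r n)))" using \<sigma>(3)[of "r n"] by simp
    also have "\<dots> \<le> nrm (T (\<sigma> (r n)) - g) + nrm g"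
      using nrm_triangle[of "T (\<sigma> (r n)) - g" g] \<sigma>(1) r(2) by simp
    finally show ?case using elim by simp
  qed
  then show False by simp
qed

text \<open>Some bound on the unit ball, not the least one. It serves for continuity and for bounded
  suprema; exact norms enter through \<open>opn_on\<close>.\<close>

definition opn :: real where "opn = (SOME C. C > 0 \<and> (\<forall>f\<in>H. nrm f \<le> 1 \<longrightarrow> nrm (T f) \<le> C))"

lemma opn: "opn > 0" "f \<in> H \<Longrightarrow> nrm f \<le> 1 \<Longrightarrow> nrm (T f) \<le> opn"
  using someI_ex[of "\<lambda>C. C > 0 \<and> (\<forall>f\<in>H. nrm f \<le> 1 \<longrightarrow> nrm (T f) \<le> C)"] bounded_unit
  unfolding opn_def by blast+

lemma le_by_unit:
  assumes "f \<in> H" "\<And>a. nrm (a *s f) \<le> 1 \<Longrightarrow> nrm (T (a *s f)) \<le> C"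
  shows "nrm (T f) \<le> C * nrm f"
proof (cases "f = 0")
  case False
  then have n: "nrm f > 0" using nrm_eq_0[OF assms(1)] nrm_nonneg[OF assms(1)] by simp
  have "nrm (T (of_real (1 / nrm f) *s f)) \<le> C"
    using n assms(1) by (intro assms(2)) (simp add: nrm_scale del: of_real_divide)
  then show ?thesis
    using n assms(1) by (simp add: T_scale nrm_scale field_simps del: of_real_divide)
qed simp

lemma T_bounded: "f \<in> H \<Longrightarrow> nrm (T f) \<le> opn * nrm f"
  by (rule le_by_unit) (auto intro: opn)

lemma S_bounded:
  assumes f: "f \<in> H"
  shows "nrm (S f) \<le> opn * nrm f"
proof (cases "nrm (S f) = 0")
  case False
  then have n: "nrm (S f) > 0" using nrm_nonneg[of "S f"] f by simp
  have "(nrm (S f))\<^sup>2 = cmod (ip (S f) (S f))" using f by (simp add: ip_self norm_power)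
  also have "\<dots> = cmod (ip (T (S f)) f)" using f by (simp add: adj)
  also have "\<dots> \<le> nrm (T (S f)) * nrm f" using f by (intro Cauchy_Schwarz) auto
  also have "\<dots> \<le> opn * nrm (S f) * nrm f"
    using f by (intro mult_right_mono T_bounded nrm_nonneg) auto
  finally show ?thesis using n by (simp add: power2_eq_square)
qed (use opn(1) f nrm_nonneg in simp)

section \<open>Maximisers on orthogonal complements\<close>

definition orth :: "'a set \<Rightarrow> 'a set" where "orth E = {f \<in> H. \<forall>x\<in>E. ip f x = 0}"

text \<open>The norm of \<open>T\<close> restricted to the orthogonal complement of
  \<open>E\<close>. With \<open>E\<close> the first n singular vectors it is the singular value of
  index n, counted from 0.\<close>

definition opn_on :: "'a set \<Rightarrow> real" where "opn_on E = (SUP f\<in>{f \<in> orth E. nrm f \<le> 1}. nrm (T f))"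

lemma orth_H: "f \<in> orth E \<Longrightarrow> f \<in> H" by (simp add: orth_def)

lemma opn_on_upper: "f \<in> orth E \<Longrightarrow> nrm f \<le> 1 \<Longrightarrow> nrm (T f) \<le> opn_on E"
  unfolding opn_on_def using opn by (intro cSUP_upper bdd_aboveI2[where M=opn]) (auto simp: orth_def)

lemma zero_orth: "E \<subseteq> H \<Longrightarrow> 0 \<in> orth E"
  by (auto simp: orth_def)

lemma opn_on_nonneg: "E \<subseteq> H \<Longrightarrow> 0 \<le> opn_on E"
  using opn_on_upper[OF zero_orth, of E] by simp

lemma opn_on_bound:
  assumes "E \<subseteq> H" "f \<in> orth E"
  shows "nrm (T f) \<le> opn_on E * nrm f"
proof (rule le_by_unit)
  show "f \<in> H" using assms(2) by (rule orth_H)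
  fix a assume "nrm (a *s f) \<le> 1"
  moreover have "a *s f \<in> orth E" using assms by (auto simp: orth_def ip_scale subset_iff)
  ultimately show "nrm (T (a *s f)) \<le> opn_on E" by (intro opn_on_upper)
qed

lemma opn_on_antimono:
  assumes "E \<subseteq> H" "F \<subseteq> E"
  shows "opn_on E \<le> opn_on F"
  unfolding opn_on_def[of E]
proof (rule cSUP_least)
  show "{f \<in> orth E. nrm f \<le> 1} \<noteq> {}" 
  proof -
    have "0 \<in> {f \<in> orth E. nrm f \<le> 1}" using zero_orth[OF assms(1)] by simp
    then show ?thesis by blast
  qed
  fix f assume "f \<in> {f \<in> orth E. nrm f \<le> 1}"
  then show "nrm (T f) \<le> opn_on F"
    using assms(2) by (intro opn_on_upper) (auto simp: orth_def)
qed

text \<open>Near-maximisers are approximate eigenvectors of \<open>S T\<close>, and this is what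
  converts convergence of their images, given by compactness, into convergence of the vectors
  themselves. Orthogonality to \<open>E\<close> is preserved by \<open>S T\<close> because
  \<open>E\<close> consists of its eigenvectors.\<close>

lemma maximizer_exists:
  assumes E: "E \<subseteq> H" "\<And>x. x \<in> E \<Longrightarrow> \<exists>t. S (T x) = of_real t *s x" and pos: "opn_on E > 0"
  shows "\<exists>e\<in>orth E. nrm e = 1 \<and> S (T e) = of_real ((opn_on E)\<^sup>2) *s e"
proof -
  define s where "s = opn_on E"
  have s: "s > 0" using pos by (simp add: s_def)
  have le: "nrm (T f) \<le> s * nrm f" if "f \<in> orth E" for f
    using opn_on_bound[OF E(1) that] by (simp add: s_def)
  \<comment> \<open>Invariance under \<open>S T\<close> allows the norm \<open>s\<close> of the
    restriction to be used twice in \<open>le2\<close>; the bound \<open>opn\<close> in place of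
    \<open>s\<close> would be too weak for \<open>defect\<close>.\<close>
  have inv: "S (T f) \<in> orth E" if "f \<in> orth E" for f
    unfolding orth_def
  proof (intro CollectI conjI ballI)
    fix x assume x: "x \<in> E"
    then obtain t where "S (T x) = of_real t *s x" using E(2) by blast
    then show "ip (S (T f)) x = 0"
      using that E(1) x by (simp add: orth_def ST_self ip_scale_right subset_iff)
  qed (use that in \<open>simp add: orth_def\<close>)
  have le2: "nrm (S (T f)) \<le> s\<^sup>2 * nrm f" if f: "f \<in> orth E" for f
  proof (cases "nrm (S (T f)) = 0")
    case True
    then show ?thesis using nrm_nonneg[OF orth_H[OF f]] by simp
  next
    case False
    then have n: "nrm (S (T f)) > 0" using nrm_nonneg[of "S (T f)"] orth_H[OF f] by simp
    have "(nrm (S (T f)))\<^sup>2 = cmod (ip (S (T f)) (S (T f)))" using orth_H[OF f] by (simp add: ip_self norm_power)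
    also have "\<dots> = cmod (ip (T f) (T (S (T f))))" using orth_H[OF f] by (simp add: adj')
    also have "\<dots> \<le> nrm (T f) * nrm (T (S (T f)))" using orth_H[OF f] by (intro Cauchy_Schwarz) auto
    also have "\<dots> \<le> (s * nrm f) * (s * nrm (S (T f)))"
      using f inv[OF f] s orth_H[OF f] by (intro mult_mono le nrm_nonneg mult_nonneg_nonneg) auto
    finally show ?thesis using n by (simp add: power2_eq_square mult_ac)
  qed
  \<comment> \<open>Expand the square and insert <S T f, f> = |T f|^2 and |S T f| \<le> s^2 |f|. The
    right-hand side tends to 0 as |T f| approaches its supremum \<open>s\<close>.\<close>
  have defect: "(nrm (S (T f) - of_real (s\<^sup>2) *s f))\<^sup>2 \<le> 2 * s\<^sup>2 * (s\<^sup>2 - (nrm (T f))\<^sup>2)"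
    if f: "f \<in> orth E" "nrm f \<le> 1" for f
  proof -
    have fH: "f \<in> H" using f orth_H by blast
    have "ip (S (T f)) f = of_real ((nrm (T f))\<^sup>2)" using fH by (simp add: adj' ip_self)
    then have "(nrm (S (T f) - of_real (s\<^sup>2) *s f))\<^sup>2
       = (nrm (S (T f)))\<^sup>2 + (s\<^sup>2 * nrm f)\<^sup>2 - 2 * s\<^sup>2 * (nrm (T f))\<^sup>2"
      using fH by (simp add: nrm_diff_sq nrm_scale ip_scale_right norm_power)
    also have "\<dots> \<le> (s\<^sup>2 * nrm f)\<^sup>2 + (s\<^sup>2 * nrm f)\<^sup>2 - 2 * s\<^sup>2 * (nrm (T f))\<^sup>2"
      using le2[OF f(1)] fH by (intro diff_mono add_mono power_mono) (auto simp: nrm_nonneg)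
    also have "\<dots> \<le> (s\<^sup>2)\<^sup>2 + (s\<^sup>2)\<^sup>2 - 2 * s\<^sup>2 * (nrm (T f))\<^sup>2"
      using f(2) nrm_nonneg[OF fH] by (intro diff_mono add_mono power_mono) (auto intro: mult_left_le)
    finally show ?thesis by (simp add: algebra_simps power2_eq_square)
  qed
  have "\<forall>n. \<exists>f. f \<in> orth E \<and> nrm f \<le> 1 \<and> s - inverse (real (Suc n)) < nrm (T f)"
  proof
    fix n
    have "s - inverse (real (Suc n)) < opn_on E" by (simp add: s_def)
    moreover have "0 \<in> {f \<in> orth E. nrm f \<le> 1}" using zero_orth[OF E(1)] by simp
    then have "{f \<in> orth E. nrm f \<le> 1} \<noteq> {}" by blast
    ultimately show "\<exists>f. f \<in> orth E \<and> nrm f \<le> 1 \<and> s - inverse (real (Suc n)) < nrm (T f)"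
      unfolding opn_on_def using opn
      by (subst (asm) less_cSUP_iff) (auto intro!: bdd_aboveI2[where M=opn] simp: orth_def)
  qed
  from choice[OF this] obtain \<sigma> where \<sigma>: "\<And>n. \<sigma> n \<in> orth E" "\<And>n. nrm (\<sigma> n) \<le> 1"
    "\<And>n. s - inverse (real (Suc n)) < nrm (T (\<sigma> n))" by auto
  have \<sigma>H [simp]: "\<sigma> n \<in> H" for n using \<sigma>(1) orth_H by blast
  obtain r g where r: "strict_mono r" and g: "g \<in> H" and lim: "(\<lambda>n. nrm (T (\<sigma> (r n)) - g)) \<longlonglongrightarrow> 0"
    using compact[of \<sigma>, OF \<sigma>H \<sigma>(2)] by (elim exE conjE) (rule that)
  have "(\<lambda>n. nrm (T (\<sigma> n))) \<longlonglongrightarrow> s"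
  proof (rule tendsto_sandwich)
    show "(\<lambda>n. s - inverse (real (Suc n))) \<longlonglongrightarrow> s"
      using tendsto_diff[OF tendsto_const LIMSEQ_inverse_real_of_nat] by simp
    show "(\<lambda>n. s) \<longlonglongrightarrow> s" by simp
    show "\<forall>\<^sub>F n in sequentially. nrm (T (\<sigma> n)) \<le> s"
      using opn_on_upper \<sigma> by (auto simp: s_def)
  qed (use \<sigma>(3) in \<open>auto intro!: always_eventually less_imp_le\<close>)
  then have Tlim: "(\<lambda>n. nrm (T (\<sigma> (r n)))) \<longlonglongrightarrow> s"
    using LIMSEQ_subseq_LIMSEQ[OF _ r] by (auto simp: o_def)
  \<comment> \<open>The only candidate for the limit: the images under \<open>S T\<close> tend to
    \<open>S g\<close>, and they differ from \<open>s\<close>^2 times the vectors by a null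
    sequence.\<close>
  define e where "e = of_real (1 / s\<^sup>2) *s S g"
  have eH [simp]: "e \<in> H" using g by (simp add: e_def)
  have "(\<lambda>n. nrm (S (T (\<sigma> (r n))) - of_real (s\<^sup>2) *s \<sigma> (r n))) \<longlonglongrightarrow> 0"
  proof (rule Lim_null_comparison)
    show "\<forall>\<^sub>F n in sequentially. norm (nrm (S (T (\<sigma> (r n))) - of_real (s\<^sup>2) *s \<sigma> (r n)))
      \<le> sqrt (2 * s\<^sup>2 * (s\<^sup>2 - (nrm (T (\<sigma> (r n))))\<^sup>2))"
      using defect[OF \<sigma>(1,2)] by (auto intro!: always_eventually real_le_rsqrt simp: nrm_nonneg)
    have "(\<lambda>n. sqrt (2 * s\<^sup>2 * (s\<^sup>2 - (nrm (T (\<sigma> (r n))))\<^sup>2))) \<longlonglongrightarrow> sqrt (2 * s\<^sup>2 * (s\<^sup>2 - s\<^sup>2))"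
      by (intro tendsto_intros Tlim)
    then show "(\<lambda>n. sqrt (2 * s\<^sup>2 * (s\<^sup>2 - (nrm (T (\<sigma> (r n))))\<^sup>2))) \<longlonglongrightarrow> 0" by simp
  qed
  then have lim2: "(\<lambda>n. (opn * nrm (T (\<sigma> (r n)) - g) + nrm (S (T (\<sigma> (r n))) - of_real (s\<^sup>2) *s \<sigma> (r n))) / s\<^sup>2) \<longlonglongrightarrow> 0"
    using tendsto_divide[OF tendsto_add[OF tendsto_mult_right_zero[OF lim, of opn]] tendsto_const, of _ 0 "s\<^sup>2"] s
    by simp
  have elim: "(\<lambda>n. nrm (\<sigma> (r n) - e)) \<longlonglongrightarrow> 0"
  proof (rule Lim_null_comparison[OF _ lim2], rule always_eventually, rule allI)
    fix n
    let ?f = "\<sigma> (r n)"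
    have "s\<^sup>2 * nrm (?f - e) = nrm (of_real (s\<^sup>2) *s (?f - e))"
      by (subst nrm_scale) (auto simp: norm_power)
    also have "of_real (s\<^sup>2) *s (?f - e) = of_real (s\<^sup>2) *s ?f - S g"
      using s by (simp add: e_def scale_right_diff_distrib flip: of_real_mult)
    also have "nrm \<dots> \<le> nrm (of_real (s\<^sup>2) *s ?f - S (T ?f)) + nrm (S (T ?f) - S g)"
      using g by (intro nrm_triangle_diff) auto
    also have "nrm (of_real (s\<^sup>2) *s ?f - S (T ?f)) = nrm (S (T ?f) - of_real (s\<^sup>2) *s ?f)"
      by (intro nrm_minus_commute) auto
    also have "nrm (S (T ?f) - S g) \<le> opn * nrm (T ?f - g)"
      using S_bounded[of "T ?f - g"] g by (simp add: S_diff)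
    finally show "norm (nrm (?f - e)) \<le> (opn * nrm (T ?f - g) + nrm (S (T ?f) - of_real (s\<^sup>2) *s ?f)) / s\<^sup>2"
      using s by (simp add: nrm_nonneg field_simps)
  qed
  have "ip e x = 0" if x: "x \<in> E" for x
  proof -
    have xH: "x \<in> H" using x E by auto
    have "(\<lambda>n. ip e x) \<longlonglongrightarrow> 0"
    proof (rule Lim_null_comparison)
      show "(\<lambda>n. nrm (\<sigma> (r n) - e) * nrm x) \<longlonglongrightarrow> 0" using tendsto_mult_left_zero[OF elim] by simp
      have "cmod (ip e x) \<le> nrm (\<sigma> (r n) - e) * nrm x" for n
      proof -
        have "ip e x = - ip (\<sigma> (r n) - e) x"
          using \<sigma>(1)[of "r n"] x xH by (simp add: orth_def ip_diff)
        then show ?thesis using Cauchy_Schwarz[of "\<sigma> (r n) - e" x] xH by simp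
      qed
      then show "\<forall>\<^sub>F n in sequentially. cmod (ip e x) \<le> nrm (\<sigma> (r n) - e) * nrm x" by simp
    qed
    then show ?thesis by (simp add: LIMSEQ_const_iff)
  qed
  then have eE: "e \<in> orth E" by (simp add: orth_def)
  have "nrm e \<le> 1"
  proof (rule LIMSEQ_le_const)
    show "(\<lambda>n. 1 + nrm (\<sigma> (r n) - e)) \<longlonglongrightarrow> 1" using tendsto_add[OF tendsto_const elim, of 1] by simp
    have "nrm e \<le> 1 + nrm (\<sigma> (r n) - e)" for n
      using nrm_reverse_triangle[of "\<sigma> (r n)" e] \<sigma>(2)[of "r n"] by simp
    then show "\<exists>N. \<forall>n\<ge>N. nrm e \<le> 1 + nrm (\<sigma> (r n) - e)" by blast
  qed
  have "s \<le> nrm (T e)"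
  proof (rule LIMSEQ_le_const2)
    have "(\<lambda>n. nrm (T (\<sigma> (r n))) - opn * nrm (\<sigma> (r n) - e)) \<longlonglongrightarrow> s - opn * 0"
      by (intro tendsto_intros Tlim elim)
    then show "(\<lambda>n. nrm (T (\<sigma> (r n))) - opn * nrm (\<sigma> (r n) - e)) \<longlonglongrightarrow> s" by simp
    have "nrm (T (\<sigma> (r n))) - opn * nrm (\<sigma> (r n) - e) \<le> nrm (T e)" for n
      using nrm_reverse_triangle[of "T (\<sigma> (r n))" "T e"] T_bounded[of "\<sigma> (r n) - e"] by (simp add: T_diff)
    then show "\<exists>N. \<forall>n\<ge>N. nrm (T (\<sigma> (r n))) - opn * nrm (\<sigma> (r n) - e) \<le> nrm (T e)" by blast
  qed
  have Te: "nrm (T e) = s"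
    using \<open>s \<le> nrm (T e)\<close> opn_on_upper[OF eE \<open>nrm e \<le> 1\<close>] by (simp add: s_def)
  have "nrm e = 1" using le[OF eE] Te s \<open>nrm e \<le> 1\<close> by (simp add: field_simps)
  moreover have "S (T e) = of_real (s\<^sup>2) *s e"
    using defect[OF eE \<open>nrm e \<le> 1\<close>] Te nrm_eq_0[of "S (T e) - of_real (s\<^sup>2) *s e"] by simp
  ultimately show ?thesis using eE by (auto simp: s_def)
qed

text \<open>
  The singular vectors are chosen greedily, as maximisers of the norm of \<open>T f\<close> on the orthogonal
  complement of the previous ones. The sequence continues with zero vectors once \<open>T\<close> vanishes there.
\<close>

definition next_vec :: "'a set \<Rightarrow> 'a" where
  "next_vec E = (if opn_on E > 0 then SOME e. e \<in> orth E \<and> nrm e = 1 \<and> S (T e) = of_real ((opn_on E)\<^sup>2) *s e else 0)"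

primrec prev :: "nat \<Rightarrow> 'a set" where
  "prev 0 = {}"
| "prev (Suc n) = insert (next_vec (prev n)) (prev n)"

definition svec :: "nat \<Rightarrow> 'a" where "svec n = next_vec (prev n)"

definition sv :: "nat \<Rightarrow> real" where "sv n = opn_on (prev n)"

section \<open>Properties of the greedy singular vectors\<close>

lemma next_vec:
  assumes "E \<subseteq> H" "\<And>x. x \<in> E \<Longrightarrow> \<exists>t. S (T x) = of_real t *s x" "opn_on E > 0"
  shows "next_vec E \<in> orth E \<and> nrm (next_vec E) = 1 \<and> S (T (next_vec E)) = of_real ((opn_on E)\<^sup>2) *s next_vec E"
proof -
  have "\<exists>e. e \<in> orth E \<and> nrm e = 1 \<and> S (T e) = of_real ((opn_on E)\<^sup>2) *s e"
    using maximizer_exists[OF assms] by auto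
  from someI_ex[OF this] show ?thesis using assms(3) by (simp add: next_vec_def)
qed

lemma prev_props: "prev n \<subseteq> H \<and> (\<forall>x\<in>prev n. \<exists>t. S (T x) = of_real t *s x)"
proof (induction n)
  case (Suc n)
  have "next_vec (prev n) \<in> H \<and> (\<exists>t. S (T (next_vec (prev n))) = of_real t *s next_vec (prev n))"
  proof (cases "opn_on (prev n) > 0")
    case True
    then have "next_vec (prev n) \<in> orth (prev n)"
      "S (T (next_vec (prev n))) = of_real ((opn_on (prev n))\<^sup>2) *s next_vec (prev n)"
      using next_vec[of "prev n"] Suc by auto
    then show ?thesis using orth_H by blast
  qed (simp add: next_vec_def)
  then show ?case using Suc by simp
qed simp

lemma prev_H: "prev n \<subseteq> H" using prev_props by blast

lemma prev_eq: "prev n = svec ` {..<n}"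
  by (induction n) (auto simp: svec_def lessThan_Suc)

lemma sv_nonneg: "0 \<le> sv n"
  unfolding sv_def using prev_H by (rule opn_on_nonneg)

lemma sv_antimono: "m \<le> n \<Longrightarrow> sv n \<le> sv m"
  unfolding sv_def by (rule opn_on_antimono[OF prev_H]) (auto simp: prev_eq)

lemma vec_pos:
  assumes "0 < sv n"
  shows "svec n \<in> orth (prev n)" "nrm (svec n) = 1" "S (T (svec n)) = of_real ((sv n)\<^sup>2) *s svec n"
  using next_vec[of "prev n"] prev_props[of n] assms by (auto simp: svec_def sv_def)

lemma vec_zero: "\<not> 0 < sv n \<Longrightarrow> svec n = 0"
  by (simp add: svec_def sv_def next_vec_def)

lemma vec_H [simp]: "svec n \<in> H"
  using vec_pos(1)[of n] vec_zero[of n] orth_H by (cases "0 < sv n") auto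

lemma ST_vec: "S (T (svec n)) = of_real ((sv n)\<^sup>2) *s svec n"
  using vec_pos(3)[of n] vec_zero[of n] by (cases "0 < sv n") auto

lemma vec_orth_less: "m < n \<Longrightarrow> ip (svec n) (svec m) = 0"
  using vec_pos(1)[of n] vec_zero[of n] by (cases "0 < sv n") (auto simp: orth_def prev_eq)

lemma ip_vec: "ip (svec n) (svec m) = (if n = m \<and> 0 < sv n then 1 else 0)"
proof (cases m n rule: linorder_cases)
  case greater
  then show ?thesis using vec_orth_less[of n m] ip_cnj[of "svec m" "svec n"] by auto
qed (use vec_orth_less[of m n] vec_pos(2)[of n] vec_zero[of n] in \<open>auto simp: ip_self\<close>)

lemma sv_bound: "f \<in> H \<Longrightarrow> (\<And>j. j < n \<Longrightarrow> ip f (svec j) = 0) \<Longrightarrow> nrm (T f) \<le> sv n * nrm f"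
  unfolding sv_def by (rule opn_on_bound[OF prev_H]) (auto simp: orth_def prev_eq)

text \<open>If the values stayed above c > 0, the images of the singular vectors would be pairwise
  orthogonal with norms at least c, hence at mutual distance at least c, and no subsequence of them
  could converge.\<close>

lemma sv_tendsto_zero: "sv \<longlonglongrightarrow> 0"
proof (rule ccontr)
  assume "\<not> sv \<longlonglongrightarrow> 0"
  then obtain c where c: "c > 0" "\<And>n. c \<le> sv n"
  proof -
    obtain e where e: "e > 0" "\<And>N. \<exists>n\<ge>N. e \<le> sv n"
      using \<open>\<not> sv \<longlonglongrightarrow> 0\<close> sv_nonneg by (auto simp: LIMSEQ_iff not_less)
    have "e \<le> sv n" for n using e(2)[of n] sv_antimono[of n] order_trans by blast
    then show ?thesis using that e(1) by blast
  qed
  then have pos: "sv n > 0" for n using less_le_trans by blast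
  have sep: "c \<le> nrm (T (svec m) - T (svec n))" if "m \<noteq> n" for m n
  proof -
    have "ip (T (svec m)) (T (svec n)) = 0"
      using that by (simp add: adj ST_vec ip_scale_right ip_vec)
    moreover have "(nrm (T (svec m)))\<^sup>2 = (sv m)\<^sup>2"
      using pos[of m] by (simp add: nrm_sq adj ST_vec ip_scale_right ip_vec)
    ultimately have "(nrm (T (svec m) - T (svec n)))\<^sup>2 = (sv m)\<^sup>2 + (nrm (T (svec n)))\<^sup>2"
      by (simp add: nrm_diff_sq)
    then have "c\<^sup>2 \<le> (nrm (T (svec m) - T (svec n)))\<^sup>2"
      using c power_mono[OF c(2)[of m], of 2] by (simp add: add_increasing2)
    then show ?thesis by (rule power2_le_imp_le) (simp add: nrm_nonneg)
  qed
  have norm_le: "nrm (svec n) \<le> 1" for n using vec_pos(2)[OF pos] by simp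
  obtain r g where r: "strict_mono (r :: nat \<Rightarrow> nat)" "g \<in> H" "(\<lambda>n. nrm (T (svec (r n)) - g)) \<longlonglongrightarrow> 0"
    using compact[of svec, OF vec_H norm_le] by (elim exE conjE) (rule that)
  have "\<forall>\<^sub>F n in sequentially. nrm (T (svec (r n)) - g) < c / 2"
    using order_tendstoD(2)[OF r(3), of "c/2"] c by simp
  then obtain n where n: "\<And>m. m \<ge> n \<Longrightarrow> nrm (T (svec (r m)) - g) < c / 2"
    by (auto simp: eventually_sequentially)
  have "r n \<noteq> r (Suc n)" using strict_monoD[OF r(1), of n "Suc n"] by simp
  then have "c \<le> nrm (T (svec (r n)) - T (svec (r (Suc n))))" by (rule sep)
  also have "\<dots> \<le> nrm (T (svec (r n)) - g) + nrm (g - T (svec (r (Suc n))))"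
    using r(2) by (intro nrm_triangle_diff) auto
  also have "nrm (g - T (svec (r (Suc n)))) = nrm (T (svec (r (Suc n))) - g)"
    using r(2) by (intro nrm_minus_commute) auto
  finally show False using n[of n] n[of "Suc n"] by simp
qed

section \<open>Singular value expansion and eigenspaces\<close>

lemma cnj_mult_self: "cnj z * z = (complex_of_real (cmod z))\<^sup>2"
  by (metis complex_norm_square mult.commute of_real_power)

definition proj :: "nat \<Rightarrow> 'a \<Rightarrow> 'a" where "proj n f = (\<Sum>j<n. ip f (svec j) *s svec j)"

lemma proj_H [simp]: "proj n f \<in> H" by (simp add: proj_def)

text \<open>Orthonormality holds only at indices with positive singular value. At the other indices
  the vector is 0, so both sides vanish and no case distinction is left in the statement.\<close>

lemma ip_proj: "f \<in> H \<Longrightarrow> ip (proj n f) (svec j) = (if j < n then ip f (svec j) else 0)"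
proof -
  assume f: "f \<in> H"
  have "ip (proj n f) (svec j) = (\<Sum>i<n. ip f (svec i) * ip (svec i) (svec j))"
    unfolding proj_def by (subst ip_sum) (simp_all add: ip_scale)
  also have "\<dots> = (\<Sum>i<n. if i = j then ip f (svec i) * (if 0 < sv j then 1 else 0) else 0)"
    by (rule sum.cong) (auto simp: ip_vec)
  also have "\<dots> = (if j < n then ip f (svec j) * (if 0 < sv j then 1 else 0) else 0)" by simp
  finally show ?thesis using vec_zero[of j] f by auto
qed

lemma sum_ip_vec:
  assumes "f \<in> H"
  shows "ip f (\<Sum>j<n. a j *s svec j) = (\<Sum>j<n. cnj (a j) * ip f (svec j))"
  using assms by (simp add: ip_sum_right ip_scale_right)

lemma Bessel:
  assumes f: "f \<in> H"
  shows "(\<Sum>j<n. (cmod (ip f (svec j)))\<^sup>2) \<le> (nrm f)\<^sup>2"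
    and "nrm (f - proj n f) \<le> nrm f"
proof -
  have 1: "ip f (proj n f) = of_real (\<Sum>j<n. (cmod (ip f (svec j)))\<^sup>2)"
    unfolding proj_def sum_ip_vec[OF f] of_real_sum
    by (rule sum.cong) (auto simp: cnj_mult_self)
  have "ip (proj n f) (proj n f) = of_real (\<Sum>j<n. (cmod (ip f (svec j)))\<^sup>2)"
    unfolding proj_def[of n f] sum_ip_vec[OF proj_H[unfolded proj_def]] of_real_sum
    unfolding proj_def[symmetric]
    by (rule sum.cong) (auto simp: ip_proj f cnj_mult_self)
  then have "(nrm (proj n f))\<^sup>2 = (\<Sum>j<n. (cmod (ip f (svec j)))\<^sup>2)" by (simp add: nrm_sq)
  then have 2: "(nrm (f - proj n f))\<^sup>2 = (nrm f)\<^sup>2 - (\<Sum>j<n. (cmod (ip f (svec j)))\<^sup>2)"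
    using f by (simp add: nrm_diff_sq 1)
  then show "(\<Sum>j<n. (cmod (ip f (svec j)))\<^sup>2) \<le> (nrm f)\<^sup>2"
    using zero_le_power2[of "nrm (f - proj n f)"] by linarith
  have "0 \<le> (\<Sum>j<n. (cmod (ip f (svec j)))\<^sup>2)" by (intro sum_nonneg) auto
  with 2 have "(nrm (f - proj n f))\<^sup>2 \<le> (nrm f)\<^sup>2" by linarith
  then show "nrm (f - proj n f) \<le> nrm f" by (rule power2_le_imp_le) (simp add: nrm_nonneg f)
qed

lemma ST_proj: "S (T (proj n f)) = (\<Sum>j<n. (of_real ((sv j)\<^sup>2) * ip f (svec j)) *s svec j)"
  unfolding proj_def by (subst ST_sum) (auto simp: T_scale S_scale ST_vec mult.commute intro!: sum.cong)

text \<open>Pythagoras: \<open>S T\<close> keeps \<open>proj n f\<close> in the span of the first n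
  vectors, to which the remainder is orthogonal, so the images under \<open>T\<close> of projection
  and remainder are orthogonal as well.\<close>

lemma T_expansion_partial:
  assumes f: "f \<in> H"
  shows "(nrm (T f))\<^sup>2 = (\<Sum>j<n. (sv j)\<^sup>2 * (cmod (ip f (svec j)))\<^sup>2) + (nrm (T (f - proj n f)))\<^sup>2"
proof -
  let ?g = "f - proj n f"
  have gH: "?g \<in> H" using f by simp
  have g: "ip ?g (svec j) = 0" if "j < n" for j using that f by (simp add: ip_diff ip_proj)
  have "ip ?g (S (T (proj n f))) = 0"
    unfolding ST_proj sum_ip_vec[OF gH] using g by simp
  then have c: "ip (T ?g) (T (proj n f)) = 0" using f by (simp add: adj)
  have "ip (proj n f) (S (T (proj n f))) = of_real (\<Sum>j<n. (sv j)\<^sup>2 * (cmod (ip f (svec j)))\<^sup>2)"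
    unfolding ST_proj sum_ip_vec[OF proj_H] of_real_sum
    by (rule sum.cong) (auto simp: ip_proj f cnj_mult_self mult.assoc)
  then have p: "(nrm (T (proj n f)))\<^sup>2 = (\<Sum>j<n. (sv j)\<^sup>2 * (cmod (ip f (svec j)))\<^sup>2)"
    by (simp add: nrm_sq adj)
  have "T f = T ?g + T (proj n f)" using f by (simp add: T_add[symmetric])
  then have "(nrm (T f))\<^sup>2 = (nrm (T ?g))\<^sup>2 + (nrm (T (proj n f)))\<^sup>2"
    using nrm_add_sq[of "T ?g" "T (proj n f)"] gH c by simp
  then show ?thesis by (simp add: p)
qed

lemma T_remainder: "f \<in> H \<Longrightarrow> nrm (T (f - proj n f)) \<le> sv n * nrm f"
proof -
  assume f: "f \<in> H"
  have "nrm (T (f - proj n f)) \<le> sv n * nrm (f - proj n f)"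
    using f by (intro sv_bound) (auto simp: ip_diff ip_proj)
  also have "\<dots> \<le> sv n * nrm f" using Bessel(2)[OF f] sv_nonneg by (intro mult_left_mono) auto
  finally show ?thesis .
qed

text \<open>The singular vectors may fail to span the space, so the remainders themselves need not
  tend to 0. Their images do, being bounded by \<open>sv n * nrm f\<close>.\<close>

theorem T_expansion:
  assumes f: "f \<in> H"
  shows "(\<lambda>j. (sv j)\<^sup>2 * (cmod (ip f (svec j)))\<^sup>2) sums (nrm (T f))\<^sup>2"
proof -
  have "(\<lambda>n. nrm (T (f - proj n f))) \<longlonglongrightarrow> 0"
  proof (rule Lim_null_comparison)
    show "(\<lambda>n. sv n * nrm f) \<longlonglongrightarrow> 0" using tendsto_mult_left_zero[OF sv_tendsto_zero] by simp
    show "\<forall>\<^sub>F n in sequentially. norm (nrm (T (f - proj n f))) \<le> sv n * nrm f"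
      using T_remainder[OF f] f by (simp add: nrm_nonneg)
  qed
  then have "(\<lambda>n. (nrm (T f))\<^sup>2 - (nrm (T (f - proj n f)))\<^sup>2) \<longlonglongrightarrow> (nrm (T f))\<^sup>2 - 0\<^sup>2"
    by (intro tendsto_intros)
  moreover have "(nrm (T f))\<^sup>2 - (nrm (T (f - proj n f)))\<^sup>2 = (\<Sum>j<n. (sv j)\<^sup>2 * (cmod (ip f (svec j)))\<^sup>2)" for n
    using T_expansion_partial[OF f, of n] by simp
  ultimately show ?thesis by (simp add: sums_def)
qed

lemma sv_level_finite: "t > 0 \<Longrightarrow> finite {n. sv n = t}"
proof -
  assume "t > 0"
  then have "\<forall>\<^sub>F n in sequentially. sv n < t" using order_tendstoD(2)[OF sv_tendsto_zero] by simp
  then obtain N where "\<And>n. n \<ge> N \<Longrightarrow> sv n < t" by (auto simp: eventually_sequentially)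
  then have "{n. sv n = t} \<subseteq> {..<N}" by (metis (mono_tags) lessThan_iff mem_Collect_eq not_le order_less_irrefl subsetI)
  then show ?thesis by (rule finite_subset) simp
qed

text \<open>This ties the greedily chosen values to the definition of singular values by
  multiplicities: the singular vectors at level t form a basis of the eigenspace of
  \<open>S T\<close> for t^2.\<close>

theorem dim_eigenspace:
  assumes t: "t > 0"
  shows "dim {f \<in> H. S (T f) = of_real (t\<^sup>2) *s f} = card {n. sv n = t}"
proof -
  let ?I = "{n. sv n = t}" and ?V = "{f \<in> H. S (T f) = of_real (t\<^sup>2) *s f}"
  have inj: "inj_on svec ?I"
  proof (rule inj_onI)
    fix m n assume mn: "m \<in> ?I" "n \<in> ?I" "svec m = svec n"
    then show "m = n" using ip_vec[of m n] ip_vec[of n n] t by (auto split: if_splits)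
  qed
  have ind: "independent (svec ` ?I)"
  proof
    assume "dependent (svec ` ?I)"
    then obtain u v where v: "v \<in> svec ` ?I" "u v \<noteq> 0" and z: "(\<Sum>v\<in>svec ` ?I. u v *s v) = 0"
      using dependent_finite[of "svec ` ?I"] sv_level_finite[OF t] by auto
    from v obtain m where m: "m \<in> ?I" "v = svec m" by auto
    have "0 = ip (\<Sum>n\<in>?I. u (svec n) *s svec n) (svec m)"
      using z by (simp add: sum.reindex[OF inj] o_def)
    also have "\<dots> = (\<Sum>n\<in>?I. u (svec n) * ip (svec n) (svec m))"
      by (subst ip_sum) (auto simp: ip_scale)
    also have "\<dots> = (\<Sum>n\<in>?I. if n = m then u (svec m) else 0)"
      using t by (intro sum.cong) (auto simp: ip_vec)
    also have "\<dots> = u v" using m sv_level_finite[OF t] by (simp add: sum.delta)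
    finally show False using v by simp
  qed
  have sub: "svec ` ?I \<subseteq> ?V" by (auto simp: ST_vec)
  have span: "?V \<subseteq> span (svec ` ?I)"
  proof
    fix f assume "f \<in> ?V"
    then have f: "f \<in> H" "S (T f) = of_real (t\<^sup>2) *s f" by auto
    have other: "ip f (svec j) = 0" if "sv j \<noteq> t" for j
    proof -
      have "of_real (t\<^sup>2) * ip f (svec j) = of_real ((sv j)\<^sup>2) * ip f (svec j)"
        using ST_self[OF f(1) vec_H, of j] f by (simp add: ip_scale ip_scale_right ST_vec)
      then have "(of_real (t\<^sup>2) :: complex) = of_real ((sv j)\<^sup>2) \<or> ip f (svec j) = 0" by (simp only: mult_cancel_right) auto
      moreover have "t\<^sup>2 \<noteq> (sv j)\<^sup>2" using that t sv_nonneg[of j] by (simp add: power2_eq_iff_nonneg)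
      ultimately show ?thesis by (simp only: of_real_eq_iff) auto
    qed
    define p where "p = (\<Sum>n\<in>?I. ip f (svec n) *s svec n)"
    have pH: "p \<in> H" by (simp add: p_def)
    have STp: "S (T p) = of_real (t\<^sup>2) *s p"
      unfolding p_def by (subst ST_sum) (auto simp: T_scale S_scale ST_vec scale_sum_right mult.commute intro!: sum.cong)
    have ipp: "ip p (svec j) = ip f (svec j)" for j
    proof -
      have "ip p (svec j) = (\<Sum>n\<in>?I. if n = j then ip f (svec j) else 0)"
        unfolding p_def using t by (subst ip_sum) (auto simp: ip_scale ip_vec intro!: sum.cong)
      also have "\<dots> = ip f (svec j)" using other[of j] sv_level_finite[OF t] by (simp add: sum.delta)
      finally show ?thesis .
    qed
    \<comment> \<open>The part of \<open>f\<close> not captured at level t is orthogonal to every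
      singular vector, so \<open>T g\<close> = 0. It also lies in the eigenspace for t^2 > 0, hence
      it is 0.\<close>
    define g where "g = f - p"
    have gH: "g \<in> H" using f pH by (simp add: g_def)
    have "ip g (svec j) = 0" for j using f pH by (simp add: g_def ip_diff ipp)
    then have "nrm (T g) \<le> sv n * nrm g" for n using gH by (intro sv_bound) auto
    moreover have "(\<lambda>n. sv n * nrm g) \<longlonglongrightarrow> 0" using tendsto_mult_left_zero[OF sv_tendsto_zero] by simp
    ultimately have "nrm (T g) \<le> 0" by (intro LIMSEQ_le_const) auto
    then have "T g = 0" using nrm_eq_0[of "T g"] nrm_nonneg[of "T g"] gH by simp
    have "S (T g) = S (T f) - S (T p)"
      unfolding g_def using f(1) pH by (simp only: T_diff S_diff T_H)
    also have "\<dots> = of_real (t\<^sup>2) *s g"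
      unfolding f(2) STp g_def by (simp only: scale_right_diff_distrib)
    finally have "of_real (t\<^sup>2) *s g = 0" using \<open>T g = 0\<close> by simp
    then have "g = 0" using t by simp
    then have "f = p" by (simp add: g_def)
    moreover have "p \<in> span (svec ` ?I)"
      unfolding p_def by (intro span_sum span_scale span_base) auto
    ultimately show "f \<in> span (svec ` ?I)" by metis
  qed
  show ?thesis
    using basis_card_eq_dim[OF sub span ind] card_image[OF inj] by simp
qed

end

section \<open>The Fock space of a doubling measure\<close>

context fock_measure
begin

section \<open>The inner product space of entire functions of finite energy\<close>

definition gs :: "complex \<Rightarrow> real" where "gs z = exp (- \<alpha> * (cmod z)\<^sup>2)"

lemma gs_pos [simp]: "0 < gs z" "0 \<le> gs z" by (simp_all add: gs_def)

lemma gs_measurable [measurable]: "gs \<in> borel_measurable borel"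
  unfolding gs_def by measurable

lemma holomorphic_measurable [measurable_dest]: "f holomorphic_on UNIV \<Longrightarrow> f \<in> borel_measurable borel"
  by (intro borel_measurable_continuous_onI holomorphic_on_imp_continuous_on)

lemma ball_borel [measurable]: "ball (z::complex) r \<in> sets borel" "cball (z::complex) r \<in> sets borel"
  by simp_all

text \<open>The squared norm with values in the extended half-line. Estimates of \<open>W f\<close>
  are made at this level, before it is known that \<open>W f\<close> lies in
  \<open>F\<close>.\<close>

definition energy :: "(complex \<Rightarrow> complex) \<Rightarrow> ennreal" where
  "energy f = (\<integral>\<^sup>+z. ennreal ((cmod (f z))\<^sup>2 * gs z) \<partial>M)"

definition F :: "(complex \<Rightarrow> complex) set" where
  "F = {f. f holomorphic_on UNIV \<and> energy f < \<infinity>}"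

definition ipF :: "(complex \<Rightarrow> complex) \<Rightarrow> (complex \<Rightarrow> complex) \<Rightarrow> complex" where
  "ipF f g = (LINT z|M. f z * cnj (g z) * of_real (gs z))"

lemma F_D: "f \<in> F \<Longrightarrow> f holomorphic_on UNIV" "f \<in> F \<Longrightarrow> energy f < \<infinity>"
  by (simp_all add: F_def)

lemma F_measurable [measurable_dest]: "f \<in> F \<Longrightarrow> f \<in> borel_measurable borel"
  using F_D holomorphic_measurable by blast

lemma energy_add_le:
  assumes [measurable]: "f \<in> borel_measurable borel" "g \<in> borel_measurable borel"
  shows "energy (\<lambda>z. f z + g z) \<le> 2 * energy f + 2 * energy g"
proof -
  have le: "(cmod (f z + g z))\<^sup>2 * gs z \<le> 2 * ((cmod (f z))\<^sup>2 * gs z) + 2 * ((cmod (g z))\<^sup>2 * gs z)" for z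
  proof -
    have "(cmod (f z + g z))\<^sup>2 \<le> (cmod (f z) + cmod (g z))\<^sup>2"
      by (intro power_mono norm_triangle_ineq) simp
    also have "\<dots> \<le> 2 * (cmod (f z))\<^sup>2 + 2 * (cmod (g z))\<^sup>2"
      using sum_squares_bound[of "cmod (f z)" "cmod (g z)"] by (simp add: power2_sum)
    finally have "(cmod (f z + g z))\<^sup>2 * gs z \<le> (2 * (cmod (f z))\<^sup>2 + 2 * (cmod (g z))\<^sup>2) * gs z"
      by (intro mult_right_mono) simp_all
    then show ?thesis by (simp add: ring_distribs mult.assoc)
  qed
  have "energy (\<lambda>z. f z + g z) \<le> (\<integral>\<^sup>+z. 2 * ennreal ((cmod (f z))\<^sup>2 * gs z) + 2 * ennreal ((cmod (g z))\<^sup>2 * gs z) \<partial>M)"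
    unfolding energy_def
  proof (rule nn_integral_mono)
    fix z
    show "ennreal ((cmod (f z + g z))\<^sup>2 * gs z) \<le> 2 * ennreal ((cmod (f z))\<^sup>2 * gs z) + 2 * ennreal ((cmod (g z))\<^sup>2 * gs z)"
      using ennreal_leI[OF le[of z]] by (simp add: ennreal_mult ennreal_plus)
  qed
  also have "\<dots> = 2 * energy f + 2 * energy g"
    unfolding energy_def by (simp add: nn_integral_add nn_integral_cmult)
  finally show ?thesis .
qed

lemma energy_scale:
  assumes [measurable]: "f \<in> borel_measurable borel"
  shows "energy (\<lambda>z. a * f z) = ennreal ((cmod a)\<^sup>2) * energy f"
  unfolding energy_def
  by (subst nn_integral_cmult[symmetric]) (simp_all add: norm_mult power_mult_distrib ennreal_mult mult.assoc)

sublocale fs: vector_space fun_scale by (rule vector_space_fun_scale)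

lemma subspace_F: "fs.subspace F"
proof (rule fs.subspaceI)
  show "0 \<in> F" by (simp add: F_def energy_def zero_fun_def)
  show "f + g \<in> F" if fg: "f \<in> F" "g \<in> F" for f g
  proof -
    have "energy (\<lambda>z. f z + g z) \<le> 2 * energy f + 2 * energy g"
      using fg by (intro energy_add_le) (auto dest: F_measurable)
    also have "\<dots> < \<infinity>" using F_D(2)[OF fg(1)] F_D(2)[OF fg(2)] by (simp add: ennreal_mult_less_top)
    finally show ?thesis using fg by (simp add: F_def plus_fun_def holomorphic_on_add)
  qed
  show "fun_scale c f \<in> F" if f: "f \<in> F" for c f
    using f energy_scale[OF F_measurable[OF f], of c]
    by (simp add: F_def fun_scale_def ennreal_mult_less_top holomorphic_on_mult)
qed

lemma integrable_energy:
  assumes f: "f \<in> F"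
  shows "integrable M (\<lambda>z. (cmod (f z))\<^sup>2 * gs z)"
proof -
  have [measurable]: "f \<in> borel_measurable borel" using f by (rule F_measurable)
  show ?thesis
    using F_D(2)[OF f] by (intro integrableI_nonneg) (auto simp: energy_def)
qed

lemma energy_eq: "f \<in> F \<Longrightarrow> energy f = ennreal (LINT z|M. (cmod (f z))\<^sup>2 * gs z)"
  unfolding energy_def by (intro nn_integral_eq_integral integrable_energy) auto

lemma integrable_ip:
  assumes f: "f \<in> F" and g: "g \<in> F"
  shows "integrable M (\<lambda>z. f z * cnj (g z) * of_real (gs z))"
proof (rule Bochner_Integration.integrable_bound)
  have [measurable]: "f \<in> borel_measurable borel" "g \<in> borel_measurable borel"
    using f g by (auto dest: F_measurable)
  show "integrable M (\<lambda>z. (cmod (f z))\<^sup>2 * gs z + (cmod (g z))\<^sup>2 * gs z)"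
    using f g by (intro Bochner_Integration.integrable_add integrable_energy)
  have [measurable]: "(\<lambda>z. cnj (g z)) \<in> borel_measurable borel"
    by (rule measurable_compose[OF _ borel_measurable_continuous_onI[of cnj]]) (auto intro!: continuous_intros)
  have [measurable]: "(\<lambda>z. complex_of_real (gs z)) \<in> borel_measurable borel"
    unfolding gs_def by (intro borel_measurable_continuous_onI continuous_intros)
  show "(\<lambda>z. f z * cnj (g z) * of_real (gs z)) \<in> borel_measurable M" by measurable
  have "cmod (f z * cnj (g z) * of_real (gs z)) \<le> norm ((cmod (f z))\<^sup>2 * gs z + (cmod (g z))\<^sup>2 * gs z)" for z
  proof -
    have "2 * (cmod (f z) * cmod (g z)) \<le> (cmod (f z))\<^sup>2 + (cmod (g z))\<^sup>2"
      using sum_squares_bound[of "cmod (f z)" "cmod (g z)"] by simp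
    moreover have "0 \<le> cmod (f z) * cmod (g z)" by simp
    ultimately have "cmod (f z) * cmod (g z) \<le> (cmod (f z))\<^sup>2 + (cmod (g z))\<^sup>2" by linarith
    then have "cmod (f z) * cmod (g z) * gs z \<le> ((cmod (f z))\<^sup>2 + (cmod (g z))\<^sup>2) * gs z"
      by (intro mult_right_mono) simp_all
    then show ?thesis by (simp add: norm_mult ring_distribs)
  qed
  then show "AE z in M. cmod (f z * cnj (g z) * of_real (gs z)) \<le> norm ((cmod (f z))\<^sup>2 * gs z + (cmod (g z))\<^sup>2 * gs z)"
    by simp
qed

lemma ipF_self: "ipF f f = of_real (LINT z|M. (cmod (f z))\<^sup>2 * gs z)"
  unfolding ipF_def by (simp add: complex_norm_square[symmetric] flip: integral_complex_of_real of_real_mult of_real_power)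

lemma pointwise_energy:
  assumes f: "f holomorphic_on UNIV"
  shows "ennreal ((cmod (f z))\<^sup>2 * gs z * V z) \<le> ennreal (P h) * energy f"
proof -
  have "ennreal ((cmod (f z))\<^sup>2 * gs z * V z) \<le> ennreal (P h) *
    (\<integral>\<^sup>+\<xi>\<in>ball z h. ennreal ((cmod (f \<xi>))\<^sup>2 * gs \<xi>) \<partial>M)"
    unfolding gs_def by (rule pointwise_le[OF f h_pos order_refl])
  also have "\<dots> \<le> ennreal (P h) * energy f"
    unfolding energy_def by (intro mult_left_mono nn_integral_mono) (auto simp: indicator_def)
  finally show ?thesis .
qed

text \<open>Definiteness of the inner product: vanishing energy would directly give zeros only
  almost everywhere for \<open>M\<close>, but the pointwise estimate gives them at every
  point.\<close>

lemma energy_zero: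
  assumes f: "f holomorphic_on UNIV" and "energy f = 0"
  shows "f = 0"
proof
  fix z
  have "ennreal ((cmod (f z))\<^sup>2 * gs z * V z) = 0" using pointwise_energy[OF f, of z] assms(2) by simp
  then have "(cmod (f z))\<^sup>2 * gs z * V z \<le> 0" by (simp add: ennreal_eq_0_iff)
  then have "\<not> 0 < (cmod (f z))\<^sup>2 * (gs z * V z)" by (simp add: mult.assoc)
  moreover have "0 < gs z * V z" by (simp add: V_pos)
  ultimately show "f z = 0 z" by (auto simp: zero_less_mult_iff zero_fun_def)
qed

sublocale fs: complex_inner_on fun_scale F ipF
proof
  show "fs.subspace F" by (rule subspace_F)
  show "ipF (f + g) k = ipF f k + ipF g k" if "f \<in> F" "g \<in> F" "k \<in> F" for f g k
    using that by (simp add: ipF_def plus_fun_def ring_distribs integrable_ip)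
  show "ipF (fun_scale a f) k = a * ipF f k" if "f \<in> F" "k \<in> F" for a f k
    using that by (simp add: ipF_def fun_scale_def mult.assoc)
  show "cnj (ipF f k) = ipF k f" if "f \<in> F" "k \<in> F" for f k
    unfolding ipF_def by (subst Bochner_Integration.integral_cnj[symmetric]) (simp add: mult_ac)
  show "0 \<le> Re (ipF f f)" if "f \<in> F" for f
    unfolding ipF_self by (simp add: Bochner_Integration.integral_nonneg)
  show "f = 0" if "f \<in> F" "ipF f f = 0" for f
    using that energy_zero[OF F_D(1)[OF that(1)]] energy_eq[OF that(1)] by (simp add: ipF_self)
qed

lemma nrm_energy: "f \<in> F \<Longrightarrow> energy f = ennreal ((fs.nrm f)\<^sup>2)"
  by (simp add: energy_eq fs.nrm_sq) (simp add: ipF_self)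

lemma nrm_le_iff: "f \<in> F \<Longrightarrow> 0 \<le> B \<Longrightarrow> fs.nrm f \<le> B \<longleftrightarrow> energy f \<le> ennreal (B\<^sup>2)"
  by (simp add: nrm_energy abs_le_square_iff[symmetric] fs.nrm_nonneg)

section \<open>Normal families and completeness\<close>

lemma pointwise_nrm:
  assumes "f \<in> F"
  shows "(cmod (f z))\<^sup>2 \<le> P h * (fs.nrm f)\<^sup>2 / (gs z * V z)"
proof -
  have "ennreal ((cmod (f z))\<^sup>2 * gs z * V z) \<le> ennreal (P h * (fs.nrm f)\<^sup>2)"
    using pointwise_energy[OF F_D(1)[OF assms], of z] P_pos[OF h_pos] assms
    by (simp add: nrm_energy ennreal_mult)
  then have "(cmod (f z))\<^sup>2 * gs z * V z \<le> P h * (fs.nrm f)\<^sup>2"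
    using P_pos[OF h_pos] by (simp add: ennreal_le_iff)
  then show ?thesis using V_pos[of z] by (simp add: field_simps)
qed

lemma V_lower_on_ball: "cmod z \<le> R \<Longrightarrow> V 0 / (K * exp (k * R)) \<le> V z"
proof -
  assume "cmod z \<le> R"
  then have "exp (k * dist z 0) \<le> exp (k * R)" using k_nonneg by (simp add: mult_left_mono)
  then have "V 0 \<le> K * exp (k * R) * V z"
    using V_growth[of 0 z] K_pos V_pos[of z]
    by (meson less_imp_le mult_left_mono mult_right_mono order_trans)
  then show ?thesis using K_pos by (simp add: field_simps)
qed

text \<open>On the disk of radius \<open>R\<close> the denominator \<open>gs z * V z\<close> of the
  pointwise estimate is at least \<open>m\<close>, uniformly in the point. This is the hypothesis of
  Montel's theorem.\<close>

lemma locally_bounded: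
  assumes B: "\<And>n. \<sigma> n \<in> F" "\<And>n. fs.nrm (\<sigma> n) \<le> B"
  shows "\<exists>C. \<forall>n. \<forall>z. cmod z \<le> R \<longrightarrow> cmod (\<sigma> n z) \<le> C"
proof -
  define m where "m = exp (- \<alpha> * R\<^sup>2) * (V 0 / (K * exp (k * R)))"
  have m: "m > 0" using V_pos K_pos by (simp add: m_def)
  have "cmod (\<sigma> n z) \<le> sqrt (P h * B\<^sup>2 / m)" if z: "cmod z \<le> R" for n z
  proof (rule real_le_rsqrt)
    have "(cmod (\<sigma> n z))\<^sup>2 \<le> P h * (fs.nrm (\<sigma> n))\<^sup>2 / (gs z * V z)" by (rule pointwise_nrm[OF B(1)])
    also have "\<dots> \<le> P h * B\<^sup>2 / m"
    proof (rule frac_le)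
      show "P h * (fs.nrm (\<sigma> n))\<^sup>2 \<le> P h * B\<^sup>2"
        using P_pos[OF h_pos] B(2)[of n] fs.nrm_nonneg[OF B(1)[of n]] by (intro mult_left_mono power_mono) auto
      have "(cmod z)\<^sup>2 \<le> R\<^sup>2" using z by (intro power_mono) auto
      then have "exp (- \<alpha> * R\<^sup>2) \<le> gs z" using \<alpha>_pos by (simp add: gs_def)
      then show "m \<le> gs z * V z" unfolding m_def
        using V_lower_on_ball[OF z] V_pos K_pos by (intro mult_mono) (auto simp: less_imp_le)
    qed (use m P_pos[OF h_pos] in auto)
    finally show "(cmod (\<sigma> n z))\<^sup>2 \<le> P h * B\<^sup>2 / m" .
  qed
  then show ?thesis by blast
qed

text \<open>Fatou's lemma applied to the energies. The bound is asked for only eventually, so that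
  the lemma fits the tails of a Cauchy sequence.\<close>

lemma Fatou_F:
  assumes \<sigma>: "\<And>n. \<sigma> n \<in> F" and le: "\<forall>\<^sub>F n in sequentially. fs.nrm (\<sigma> n) \<le> B" and "0 \<le> B"
    and lim: "\<And>z. (\<lambda>n. \<sigma> n z) \<longlonglongrightarrow> f z" and f: "f holomorphic_on UNIV"
  shows "f \<in> F" "fs.nrm f \<le> B"
proof -
  have [measurable]: "\<sigma> n \<in> borel_measurable borel" for n using \<sigma> by (auto dest: F_measurable)
  have "energy f = (\<integral>\<^sup>+z. liminf (\<lambda>n. ennreal ((cmod (\<sigma> n z))\<^sup>2 * gs z)) \<partial>M)"
    unfolding energy_def
  proof (rule nn_integral_cong)
    fix z
    have "(\<lambda>n. ennreal ((cmod (\<sigma> n z))\<^sup>2 * gs z)) \<longlonglongrightarrow> ennreal ((cmod (f z))\<^sup>2 * gs z)"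
      by (intro tendsto_intros lim)
    then show "ennreal ((cmod (f z))\<^sup>2 * gs z) = liminf (\<lambda>n. ennreal ((cmod (\<sigma> n z))\<^sup>2 * gs z))"
      by (intro lim_imp_Liminf[symmetric]) simp
  qed
  also have "\<dots> \<le> liminf (\<lambda>n. energy (\<sigma> n))"
    unfolding energy_def by (rule nn_integral_liminf) measurable
  also have "\<dots> \<le> limsup (\<lambda>n. energy (\<sigma> n))" by (rule Liminf_le_Limsup) simp
  also have "\<dots> \<le> ennreal (B\<^sup>2)"
    using le by (intro Limsup_bounded, eventually_elim) (simp add: nrm_le_iff[symmetric] \<sigma> \<open>0 \<le> B\<close>)
  finally have e: "energy f \<le> ennreal (B\<^sup>2)" .
  then have "energy f < \<infinity>" by (auto intro: le_less_trans)
  then show "f \<in> F" using f by (simp add: F_def)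
  then show "fs.nrm f \<le> B" using e \<open>0 \<le> B\<close> by (simp add: nrm_le_iff)
qed

text \<open>Montel supplies the locally uniformly convergent subsequence, Fatou keeps the limit in
  the ball of radius \<open>B\<close>. Both completeness and the compactness criterion for
  \<open>W\<close> start from it.\<close>

lemma weakly_compact:
  assumes B: "\<And>n. \<sigma> n \<in> F" "\<And>n. fs.nrm (\<sigma> n) \<le> B"
  shows "\<exists>r f. strict_mono (r :: nat \<Rightarrow> nat) \<and> f \<in> F \<and> fs.nrm f \<le> B \<and> (\<forall>z. (\<lambda>n. \<sigma> (r n) z) \<longlonglongrightarrow> f z) \<and>
    (\<forall>R. uniform_limit (cball 0 R) (\<lambda>n. \<sigma> (r n)) f sequentially)"
proof -
  have B0: "0 \<le> B" using B(2)[of 0] fs.nrm_nonneg[OF B(1)[of 0]] by simp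
  obtain f r where f: "f holomorphic_on UNIV" and r: "strict_mono (r :: nat \<Rightarrow> nat)"
    and lim: "\<And>x. x \<in> UNIV \<Longrightarrow> ((\<lambda>n. \<sigma> (r n) x) \<longlongrightarrow> f x) sequentially"
    and unif: "\<And>S. \<lbrakk>compact S; S \<subseteq> UNIV\<rbrakk> \<Longrightarrow> uniform_limit S (\<sigma> \<circ> r) f sequentially"
  proof (rule Montel[of UNIV "range \<sigma>" \<sigma>])
    show "\<exists>C. \<forall>h\<in>range \<sigma>. \<forall>z\<in>S. cmod (h z) \<le> C" if S: "compact S" "S \<subseteq> UNIV" for S
    proof -
      obtain R where "\<And>z. z \<in> S \<Longrightarrow> cmod z \<le> R" using compact_imp_bounded[OF S(1)] by (auto simp: bounded_iff)
      moreover obtain C where "\<forall>n. \<forall>z. cmod z \<le> R \<longrightarrow> cmod (\<sigma> n z) \<le> C" using locally_bounded[of \<sigma>, OF B] by blast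
      ultimately show ?thesis by auto
    qed
  qed (use B(1) F_D in auto)
  have "f \<in> F" "fs.nrm f \<le> B"
    using Fatou_F[of "\<lambda>n. \<sigma> (r n)" B f] B B0 lim f by auto
  then show ?thesis using r lim unif[OF compact_cball]
    by (intro exI[of _ r] exI[of _ f]) (auto simp: o_def)
qed

text \<open>The candidate limit comes from local uniform convergence of a subsequence. Norm
  convergence of the whole sequence then follows by applying Fatou to the differences \<sigma>_m -
  \<sigma>_n with m fixed.\<close>

lemma complete_F:
  assumes \<sigma>: "\<And>n. \<sigma> n \<in> F"
    and Cauchy: "\<And>\<epsilon>. 0 < \<epsilon> \<Longrightarrow> \<exists>N. \<forall>m\<ge>N. \<forall>n\<ge>N. fs.nrm (\<sigma> m - \<sigma> n) < \<epsilon>"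
  shows "\<exists>g\<in>F. (\<lambda>n::nat. fs.nrm (\<sigma> n - g)) \<longlonglongrightarrow> 0"
proof -
  \<comment> \<open>Only the tail from \<open>N\<close> on is bounded with an explicit constant,
    which is why the subsequence is taken from the shifted sequence.\<close>
  obtain N where N: "\<And>m. m \<ge> N \<Longrightarrow> fs.nrm (\<sigma> m - \<sigma> N) < 1" using Cauchy[of 1] by auto
  have bdd: "fs.nrm (\<sigma> (n + N)) \<le> 1 + fs.nrm (\<sigma> N)" for n
    using fs.nrm_triangle[of "\<sigma> (n + N) - \<sigma> N" "\<sigma> N"] N[of "n + N"] \<sigma> by simp
  obtain r g where r: "strict_mono (r :: nat \<Rightarrow> nat)" and g: "g \<in> F" and lim: "\<And>z. (\<lambda>n. \<sigma> (r n + N) z) \<longlonglongrightarrow> g z"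
    using weakly_compact[of "\<lambda>n. \<sigma> (n + N)", OF \<sigma> bdd] by blast
  have "(\<lambda>n. fs.nrm (\<sigma> n - g)) \<longlonglongrightarrow> 0"
  proof (rule LIMSEQ_I)
    fix \<epsilon> :: real assume \<epsilon>: "0 < \<epsilon>"
    obtain N' where N': "\<And>m n. m \<ge> N' \<Longrightarrow> n \<ge> N' \<Longrightarrow> fs.nrm (\<sigma> m - \<sigma> n) < \<epsilon> / 2"
      using Cauchy[of "\<epsilon>/2"] \<epsilon> by auto
    have "fs.nrm (\<sigma> m - g) \<le> \<epsilon> / 2" if m: "m \<ge> N'" for m
    proof (rule Fatou_F(2)[of "\<lambda>n. \<sigma> m - \<sigma> (r n + N)"])
      show "\<sigma> m - \<sigma> (r n + N) \<in> F" for n using \<sigma> by simp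
      show "\<forall>\<^sub>F n in sequentially. fs.nrm (\<sigma> m - \<sigma> (r n + N)) \<le> \<epsilon> / 2"
        using eventually_ge_at_top[of N']
      proof eventually_elim
        case (elim n)
        then have "N' \<le> r n + N" using seq_suble[OF r, of n] by simp
        then show ?case using N'[OF m] by (simp add: less_imp_le)
      qed
      show "(\<lambda>n. (\<sigma> m - \<sigma> (r n + N)) z) \<longlonglongrightarrow> (\<sigma> m - g) z" for z
        using lim[of z] by (simp add: fun_diff_def tendsto_diff)
      have "\<sigma> m - g \<in> F" using \<sigma> g by simp
      then show "\<sigma> m - g holomorphic_on UNIV" by (rule F_D)
    qed (use \<epsilon> in simp)
    then show "\<exists>no. \<forall>n\<ge>no. norm (fs.nrm (\<sigma> n - g) - 0) < \<epsilon>"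
    proof (intro exI allI impI)
      fix n assume "N' \<le> n"
      from \<open>\<And>m. m \<ge> N' \<Longrightarrow> fs.nrm (\<sigma> m - g) \<le> \<epsilon> / 2\<close>[OF this] fs.nrm_nonneg[of "\<sigma> n - g"]
      show "norm (fs.nrm (\<sigma> n - g) - 0) < \<epsilon>" using \<epsilon> \<sigma> g by simp
    qed
  qed
  then show ?thesis using g by blast
qed

text \<open>The normalised reproducing kernel of the unweighted Fock space at \<open>z\<close>,
  divided by the square root of the local mass. Its weighted modulus is a Gaussian centred at
  \<open>z\<close>.\<close>

definition test_fun :: "complex \<Rightarrow> complex \<Rightarrow> complex" where
  "test_fun z \<xi> = exp (of_real \<alpha> * cnj z * \<xi> - of_real (\<alpha> * (cmod z)\<^sup>2 / 2)) / of_real (sqrt (V z))"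

lemma test_fun_holomorphic: "test_fun z holomorphic_on UNIV"
  unfolding test_fun_def using V_pos[of z] by (auto intro!: holomorphic_intros)

lemma test_fun_abs: "(cmod (test_fun z \<xi>))\<^sup>2 * gs \<xi> = exp (- \<alpha> * (dist \<xi> z)\<^sup>2) / V z"
proof -
  have d: "(dist \<xi> z)\<^sup>2 = (cmod \<xi>)\<^sup>2 - 2 * Re (cnj z * \<xi>) + (cmod z)\<^sup>2"
    by (simp add: dist_norm cmod_power2 power2_diff algebra_simps)
  have "(cmod (test_fun z \<xi>))\<^sup>2 = (exp (\<alpha> * Re (cnj z * \<xi>) - \<alpha> * (cmod z)\<^sup>2 / 2))\<^sup>2 / V z"
    unfolding test_fun_def using V_pos[of z]
    by (simp add: norm_divide power_divide mult.assoc)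
  also have "(exp (\<alpha> * Re (cnj z * \<xi>) - \<alpha> * (cmod z)\<^sup>2 / 2))\<^sup>2 = exp (2 * (\<alpha> * Re (cnj z * \<xi>) - \<alpha> * (cmod z)\<^sup>2 / 2))"
    by (rule exp_double[symmetric])
  also have "exp (2 * (\<alpha> * Re (cnj z * \<xi>) - \<alpha> * (cmod z)\<^sup>2 / 2)) / V z * gs \<xi>
    = exp (2 * (\<alpha> * Re (cnj z * \<xi>) - \<alpha> * (cmod z)\<^sup>2 / 2) + - \<alpha> * (cmod \<xi>)\<^sup>2) / V z"
    unfolding gs_def exp_add by simp
  also have "2 * (\<alpha> * Re (cnj z * \<xi>) - \<alpha> * (cmod z)\<^sup>2 / 2) + - \<alpha> * (cmod \<xi>)\<^sup>2 = - \<alpha> * (dist \<xi> z)\<^sup>2"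
    unfolding d by (simp only: right_diff_distrib distrib_left)
  finally show ?thesis .
qed

lemma test_fun_energy: "\<exists>C>0. \<forall>z. test_fun z \<in> F \<and> fs.nrm (test_fun z) \<le> C"
proof -
  obtain C where C: "C > 0" "\<And>z. (\<integral>\<^sup>+\<xi>. ennreal (exp (- \<alpha> * (dist \<xi> z)\<^sup>2)) \<partial>M) \<le> ennreal (C * V z)"
    using gaussian_integral_le[OF \<alpha>_pos] by blast
  have e: "energy (test_fun z) \<le> ennreal C" for z
  proof -
    have "energy (test_fun z) = (\<integral>\<^sup>+\<xi>. ennreal (1 / V z) * ennreal (exp (- \<alpha> * (dist \<xi> z)\<^sup>2)) \<partial>M)"
      unfolding energy_def test_fun_abs using V_pos[of z]
      by (intro nn_integral_cong) (simp flip: ennreal_mult)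
    also have "\<dots> = ennreal (1 / V z) * (\<integral>\<^sup>+\<xi>. ennreal (exp (- \<alpha> * (dist \<xi> z)\<^sup>2)) \<partial>M)"
      by (rule nn_integral_cmult) measurable
    also have "\<dots> \<le> ennreal (1 / V z) * ennreal (C * V z)" by (intro mult_left_mono C) simp
    also have "\<dots> = ennreal C" using V_pos[of z] C by (simp flip: ennreal_mult)
    finally show ?thesis .
  qed
  have F: "test_fun z \<in> F" for z
    using test_fun_holomorphic le_less_trans[OF e] by (simp add: F_def)
  moreover have "fs.nrm (test_fun z) \<le> sqrt C" for z
    using e[of z] C by (subst nrm_le_iff[OF F]) auto
  ultimately show ?thesis using C by (intro exI[of _ "sqrt C"]) auto
qed

text \<open>Allows the denominator of \<Phi> to be exchanged for \<open>V z\<close> in either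
  direction, at the cost of the doubling factor in one of them.\<close>

lemma inverse_emeasure_ball:
  assumes r: "0 < r" "r \<le> h"
  shows "ennreal (1 / V z) \<le> inverse (emeasure M (ball z r))"
    and "inverse (emeasure M (ball z r)) \<le> ennreal (1 / (c * r powr (2 * q) * V z))"
proof -
  have le: "emeasure M (ball z r) \<le> ennreal (V z)" using r by (intro emeasure_ball_le)
  have ge: "ennreal (c * r powr (2 * q) * V z) \<le> emeasure M (ball z r)"
    using r by (intro emeasure_ball_ge) auto
  define b where "b = enn2real (emeasure M (ball z r))"
  have b: "emeasure M (ball z r) = ennreal b" using neq_top_trans[OF _ le] by (simp add: b_def less_top)
  have pos: "0 < c * r powr (2 * q) * V z" using c_pos r V_pos by simp
  have b2: "c * r powr (2 * q) * V z \<le> b"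
    using ge pos unfolding b by (metis ennreal_le_iff2 not_le)
  have b1: "b \<le> V z" using le V_pos[of z] unfolding b by (simp add: ennreal_le_iff)
  show "ennreal (1 / V z) \<le> inverse (emeasure M (ball z r))"
    unfolding b using b1 b2 pos V_pos[of z] by (subst inverse_ennreal) (auto intro!: ennreal_leI simp: field_simps)
  show "inverse (emeasure M (ball z r)) \<le> ennreal (1 / (c * r powr (2 * q) * V z))"
    unfolding b using b2 pos by (subst inverse_ennreal) (auto intro!: ennreal_leI le_imp_inverse_le simp: divide_inverse simp del: inverse_mult_distrib)
qed

end

section \<open>Weighted composition operators\<close>

locale weighted_composition = fock_measure +
  fixes \<phi> \<psi> :: "complex \<Rightarrow> complex"
  assumes hol_\<phi>: "\<phi> holomorphic_on UNIV" and hol_\<psi>: "\<psi> holomorphic_on UNIV"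
begin

section \<open>The pull-back measure and its averages\<close>

lemma \<phi>_meas [measurable]: "\<phi> \<in> borel_measurable borel" and \<psi>_meas [measurable]: "\<psi> \<in> borel_measurable borel"
  using hol_\<phi> hol_\<psi> by (auto intro: holomorphic_measurable)

text \<open>The factor left over when |W f|^2 e^{-\<alpha>|\<xi>|^2} is written as |f|^2
  e^{-\<alpha>|.|^2} evaluated at \<phi>(\<xi>).\<close>

definition u :: "complex \<Rightarrow> ennreal" where
  "u \<xi> = ennreal ((cmod (\<psi> \<xi>))\<^sup>2 * exp (- \<alpha> * ((cmod \<xi>)\<^sup>2 - (cmod (\<phi> \<xi>))\<^sup>2)))"

lemma u_meas [measurable]: "u \<in> borel_measurable borel"
  unfolding u_def by measurable

text \<open>The mass of the disk under the image of \<open>u\<close> times \<open>M\<close> by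
  \<phi>. That image measure need not be finite on disks, and only its values on disks are
  used.\<close>

definition pull :: "real \<Rightarrow> complex \<Rightarrow> ennreal" where
  "pull r z = (\<integral>\<^sup>+\<xi>. u \<xi> * indicator (ball z r) (\<phi> \<xi>) \<partial>M)"

definition \<Phi> :: "real \<Rightarrow> complex \<Rightarrow> ennreal" where
  "\<Phi> r z = pull r z / emeasure M (ball z r)"

abbreviation W :: "(complex \<Rightarrow> complex) \<Rightarrow> (complex \<Rightarrow> complex)" where "W \<equiv> weighted_comp \<phi> \<psi>"

lemma W_holomorphic: "f holomorphic_on UNIV \<Longrightarrow> W f holomorphic_on UNIV"
  unfolding weighted_comp_def using hol_\<phi> hol_\<psi>
  by (intro holomorphic_on_mult holomorphic_on_compose_gen[of \<phi> UNIV f UNIV]) auto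

lemma W_add: "W (f + g) = W f + W g" and W_scale: "W (fun_scale a f) = fun_scale a (W f)" and W_diff: "W (f - g) = W f - W g"
  by (auto simp: weighted_comp_def fun_scale_def fun_eq_iff algebra_simps)

lemma W_energy: "energy (W f) = (\<integral>\<^sup>+\<xi>. ennreal ((cmod (f (\<phi> \<xi>)))\<^sup>2 * gs (\<phi> \<xi>)) * u \<xi> \<partial>M)"
  unfolding energy_def
proof (rule nn_integral_cong)
  fix \<xi>
  have "gs \<xi> = gs (\<phi> \<xi>) * exp (- \<alpha> * ((cmod \<xi>)\<^sup>2 - (cmod (\<phi> \<xi>))\<^sup>2))"
    by (simp add: gs_def algebra_simps flip: exp_add)
  then have "(cmod (W f \<xi>))\<^sup>2 * gs \<xi> =
      ((cmod (f (\<phi> \<xi>)))\<^sup>2 * gs (\<phi> \<xi>)) * ((cmod (\<psi> \<xi>))\<^sup>2 * exp (- \<alpha> * ((cmod \<xi>)\<^sup>2 - (cmod (\<phi> \<xi>))\<^sup>2)))"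
    by (simp only: weighted_comp_def norm_mult power_mult_distrib o_def mult_ac)
  then show "ennreal ((cmod (W f \<xi>))\<^sup>2 * gs \<xi>) = ennreal ((cmod (f (\<phi> \<xi>)))\<^sup>2 * gs (\<phi> \<xi>)) * u \<xi>"
    by (simp add: u_def ennreal_mult)
qed

lemma pull_meas [measurable]: "pull r \<in> borel_measurable borel"
proof -
  have "(\<lambda>p. u (snd p) * indicator {p. dist (fst p) (snd p) < r} (fst p, \<phi> (snd p))) \<in> borel_measurable (borel \<Otimes>\<^sub>M M)"
  proof -
    have "Measurable.pred (borel \<Otimes>\<^sub>M M) (\<lambda>p. dist (fst p) (\<phi> (snd p)) < r)" by measurable
    then show ?thesis by (simp add: indicator_def)
  qed
  from borel_measurable_nn_integral_fst[OF this] show ?thesis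
    unfolding pull_def by (simp add: indicator_def)
qed

lemma emeasure_ball_meas [measurable]: "(\<lambda>z. emeasure M (ball z r)) \<in> borel_measurable borel"
proof -
  have "Measurable.pred (borel \<Otimes>\<^sub>M M) (\<lambda>p. dist (fst p) (snd p) < r)" by measurable
  then have "{p \<in> space (borel \<Otimes>\<^sub>M M). dist (fst p) (snd p) < r} \<in> sets (borel \<Otimes>\<^sub>M M)" by measurable
  from measurable_emeasure_Pair[OF this] show ?thesis
    by (simp add: vimage_def space_pair_measure ball_def)
qed

lemma \<Phi>_meas [measurable]: "\<Phi> r \<in> borel_measurable borel"
  unfolding \<Phi>_def by measurable

lemma V_inverse_near: "dist z z' \<le> h \<Longrightarrow> ennreal (1 / V z) \<le> ennreal (K / V z')"
  using V_le_near[of z z'] V_pos[of z] V_pos[of z'] by (intro ennreal_leI) (simp add: field_simps)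

text \<open>The pointwise estimate is applied at \<phi>(\<xi>), and Fubini exchanges \<xi> with the
  point \<zeta> of the disk. The condition |\<phi>(\<xi>) - \<zeta>| < r is symmetric, so the inner
  integral becomes \<open>pull r \<zeta>\<close>; replacing the mass at \<phi>(\<xi>) by the mass at
  \<zeta> costs the factor \<open>K\<close>.\<close>

lemma upper_bound:
  assumes f: "f holomorphic_on UNIV" and r: "0 < r" "r \<le> h"
  shows "energy (W f) \<le> ennreal (P r * K) * (\<integral>\<^sup>+\<zeta>. ennreal ((cmod (f \<zeta>))\<^sup>2 * gs \<zeta>) * \<Phi> r \<zeta> \<partial>M)"
proof -
  have [measurable]: "f \<in> borel_measurable borel" using f by (rule holomorphic_measurable)
  let ?E = "\<lambda>\<zeta>. ennreal ((cmod (f \<zeta>))\<^sup>2 * gs \<zeta>)"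
  let ?I = "\<lambda>\<xi> \<zeta>. indicator {p. dist (fst p) (snd p) < r} (\<phi> \<xi>, \<zeta>) :: ennreal"
  have I: "?I \<xi> \<zeta> = indicator (ball (\<phi> \<xi>) r) \<zeta>" "?I \<xi> \<zeta> = indicator (ball \<zeta> r) (\<phi> \<xi>)" for \<xi> \<zeta>
    by (auto simp: indicator_def dist_commute)
  have meas: "(\<lambda>(\<xi>, \<zeta>). ennreal (P r / V (\<phi> \<xi>)) * u \<xi> * (?E \<zeta> * ?I \<xi> \<zeta>)) \<in> borel_measurable (M \<Otimes>\<^sub>M M)"
  proof -
    have "Measurable.pred (M \<Otimes>\<^sub>M M) (\<lambda>p. dist (\<phi> (fst p)) (snd p) < r)" by measurable
    then have [measurable]: "(\<lambda>p. ?I (fst p) (snd p)) \<in> borel_measurable (M \<Otimes>\<^sub>M M)" by (simp add: indicator_def)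
    show ?thesis unfolding split_beta by measurable
  qed
  have "energy (W f) \<le> (\<integral>\<^sup>+\<xi>. ennreal (P r / V (\<phi> \<xi>)) * (\<integral>\<^sup>+\<zeta>. ?E \<zeta> * ?I \<xi> \<zeta> \<partial>M) * u \<xi> \<partial>M)"
    unfolding W_energy
  proof (intro nn_integral_mono mult_right_mono)
    fix \<xi>
    have "?E (\<phi> \<xi>) = ennreal (1 / V (\<phi> \<xi>)) * ennreal ((cmod (f (\<phi> \<xi>)))\<^sup>2 * gs (\<phi> \<xi>) * V (\<phi> \<xi>))"
      using V_pos[of "\<phi> \<xi>"] by (simp flip: ennreal_mult)
    also have "\<dots> \<le> ennreal (1 / V (\<phi> \<xi>)) * (ennreal (P r) * (\<integral>\<^sup>+\<zeta>. ?E \<zeta> * ?I \<xi> \<zeta> \<partial>M))"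
      unfolding I(1) gs_def by (intro mult_left_mono pointwise_le f r) simp
    also have "\<dots> = ennreal (P r / V (\<phi> \<xi>)) * (\<integral>\<^sup>+\<zeta>. ?E \<zeta> * ?I \<xi> \<zeta> \<partial>M)"
      using V_pos[of "\<phi> \<xi>"] P_pos[OF r(1)] by (simp add: mult.assoc[symmetric] flip: ennreal_mult)
    finally show "?E (\<phi> \<xi>) \<le> ennreal (P r / V (\<phi> \<xi>)) * (\<integral>\<^sup>+\<zeta>. ?E \<zeta> * ?I \<xi> \<zeta> \<partial>M)" .
  qed simp
  also have "\<dots> = (\<integral>\<^sup>+\<xi>. (\<integral>\<^sup>+\<zeta>. ennreal (P r / V (\<phi> \<xi>)) * u \<xi> * (?E \<zeta> * ?I \<xi> \<zeta>) \<partial>M) \<partial>M)"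
  proof (rule nn_integral_cong)
    fix \<xi>
    show "ennreal (P r / V (\<phi> \<xi>)) * (\<integral>\<^sup>+\<zeta>. ?E \<zeta> * ?I \<xi> \<zeta> \<partial>M) * u \<xi> = (\<integral>\<^sup>+\<zeta>. ennreal (P r / V (\<phi> \<xi>)) * u \<xi> * (?E \<zeta> * ?I \<xi> \<zeta>) \<partial>M)"
      unfolding I(1) by (subst nn_integral_cmult) (auto simp: mult_ac)
  qed
  also have "\<dots> = (\<integral>\<^sup>+\<zeta>. (\<integral>\<^sup>+\<xi>. ennreal (P r / V (\<phi> \<xi>)) * u \<xi> * (?E \<zeta> * ?I \<xi> \<zeta>) \<partial>M) \<partial>M)"
  proof -
    interpret pair_sigma_finite M M ..
    show ?thesis by (rule Fubini'[OF meas, symmetric])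
  qed
  also have "\<dots> \<le> (\<integral>\<^sup>+\<zeta>. ennreal (P r * K) * (?E \<zeta> * \<Phi> r \<zeta>) \<partial>M)"
  proof (rule nn_integral_mono)
    fix \<zeta>
    have "(\<integral>\<^sup>+\<xi>. ennreal (P r / V (\<phi> \<xi>)) * u \<xi> * (?E \<zeta> * ?I \<xi> \<zeta>) \<partial>M)
      \<le> (\<integral>\<^sup>+\<xi>. (ennreal (P r * K / V \<zeta>) * ?E \<zeta>) * (u \<xi> * indicator (ball \<zeta> r) (\<phi> \<xi>)) \<partial>M)"
    proof (rule nn_integral_mono)
      fix \<xi>
      show "ennreal (P r / V (\<phi> \<xi>)) * u \<xi> * (?E \<zeta> * ?I \<xi> \<zeta>) \<le> (ennreal (P r * K / V \<zeta>) * ?E \<zeta>) * (u \<xi> * indicator (ball \<zeta> r) (\<phi> \<xi>))"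
      proof (cases "\<phi> \<xi> \<in> ball \<zeta> r")
        case True
        then have "ennreal (1 / V (\<phi> \<xi>)) \<le> ennreal (K / V \<zeta>)"
          using r by (intro V_inverse_near) (auto simp: dist_commute)
        then have "ennreal (P r) * ennreal (1 / V (\<phi> \<xi>)) \<le> ennreal (P r) * ennreal (K / V \<zeta>)" by (rule mult_left_mono) (rule zero_le)
        then have "ennreal (P r / V (\<phi> \<xi>)) \<le> ennreal (P r * K / V \<zeta>)"
          using P_pos[OF r(1)] V_pos K_pos by (simp add: less_imp_le flip: ennreal_mult)
        then show ?thesis using True unfolding I(2) by (simp add: mult_ac mult_left_mono mult_right_mono)
      qed (simp add: I(2))
    qed
    also have "\<dots> = (ennreal (P r * K / V \<zeta>) * ?E \<zeta>) * pull r \<zeta>"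
      unfolding pull_def by (rule nn_integral_cmult) (use ball_borel in measurable)
    also have "\<dots> = ennreal (P r * K) * (?E \<zeta> * (pull r \<zeta> * ennreal (1 / V \<zeta>)))"
      using P_pos[OF r(1)] V_pos[of \<zeta>] K_pos
      by (simp add: ennreal_mult' divide_inverse mult_ac)
    also have "\<dots> \<le> ennreal (P r * K) * (?E \<zeta> * \<Phi> r \<zeta>)"
      unfolding \<Phi>_def divide_ennreal_def
      by (intro mult_left_mono inverse_emeasure_ball r) simp_all
    finally show "(\<integral>\<^sup>+\<xi>. ennreal (P r / V (\<phi> \<xi>)) * u \<xi> * (?E \<zeta> * ?I \<xi> \<zeta>) \<partial>M) \<le> ennreal (P r * K) * (?E \<zeta> * \<Phi> r \<zeta>)" .
  qed
  also have "\<dots> = ennreal (P r * K) * (\<integral>\<^sup>+\<zeta>. ?E \<zeta> * \<Phi> r \<zeta> \<partial>M)"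
    by (rule nn_integral_cmult) measurable
  finally show ?thesis .
qed

text \<open>The constant of \<open>lower_bound\<close>: the exponential is the reciprocal of the
  least value of the Gaussian on the disk, the denominator is the doubling factor at radius
  \<open>r\<close>.\<close>

definition Q :: "real \<Rightarrow> real" where "Q r = exp (\<alpha> * r\<^sup>2) / (c * r powr (2 * q))"

lemma Q_pos: "0 < r \<Longrightarrow> 0 < Q r" using c_pos by (simp add: Q_def)

text \<open>On the disk around \<open>z\<close> the weighted modulus squared of the test function is
  at least e^{-\<alpha> r^2} / V z, so its energy after composition dominates the mass of the disk
  divided by \<open>V z\<close>.\<close>

lemma lower_bound:
  assumes r: "0 < r" "r \<le> h"
  shows "\<Phi> r z \<le> ennreal (Q r) * energy (W (test_fun z))"
proof -
  have [measurable]: "ball z r \<in> sets borel" by simp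
  have "\<Phi> r z \<le> pull r z * ennreal (1 / (c * r powr (2 * q) * V z))"
    unfolding \<Phi>_def divide_ennreal_def by (intro mult_left_mono inverse_emeasure_ball r) simp
  also have "\<dots> = (\<integral>\<^sup>+\<xi>. ennreal (1 / (c * r powr (2 * q) * V z)) * (u \<xi> * indicator (ball z r) (\<phi> \<xi>)) \<partial>M)"
    unfolding pull_def by (subst nn_integral_cmult) (measurable, simp add: mult.commute)
  also have "\<dots> \<le> (\<integral>\<^sup>+\<xi>. ennreal (Q r) * (ennreal ((cmod (test_fun z (\<phi> \<xi>)))\<^sup>2 * gs (\<phi> \<xi>)) * u \<xi>) \<partial>M)"
  proof (rule nn_integral_mono)
    fix \<xi>
    show "ennreal (1 / (c * r powr (2 * q) * V z)) * (u \<xi> * indicator (ball z r) (\<phi> \<xi>))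
      \<le> ennreal (Q r) * (ennreal ((cmod (test_fun z (\<phi> \<xi>)))\<^sup>2 * gs (\<phi> \<xi>)) * u \<xi>)"
    proof (cases "\<phi> \<xi> \<in> ball z r")
      case True
      then have "(dist (\<phi> \<xi>) z)\<^sup>2 \<le> r\<^sup>2" by (intro power_mono) (auto simp: dist_commute)
      then have "exp (- \<alpha> * r\<^sup>2) \<le> exp (- \<alpha> * (dist (\<phi> \<xi>) z)\<^sup>2)" using \<alpha>_pos by simp
      then have "exp (\<alpha> * r\<^sup>2) * exp (- \<alpha> * r\<^sup>2) \<le> exp (\<alpha> * r\<^sup>2) * exp (- \<alpha> * (dist (\<phi> \<xi>) z)\<^sup>2)"
        by (intro mult_left_mono) simp_all
      then have "1 \<le> exp (\<alpha> * r\<^sup>2) * exp (- \<alpha> * (dist (\<phi> \<xi>) z)\<^sup>2)" by (simp flip: exp_add)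
      then have "1 / (c * r powr (2 * q) * V z) \<le> Q r * (exp (- \<alpha> * (dist (\<phi> \<xi>) z)\<^sup>2) / V z)"
        using c_pos r V_pos[of z] by (simp add: Q_def divide_right_mono)
      then have "ennreal (1 / (c * r powr (2 * q) * V z)) \<le> ennreal (Q r) * ennreal (exp (- \<alpha> * (dist (\<phi> \<xi>) z)\<^sup>2) / V z)"
        using Q_pos[OF r(1)] by (simp add: ennreal_leI flip: ennreal_mult')
      then show ?thesis using True unfolding test_fun_abs by (simp add: mult.assoc[symmetric] mult_right_mono)
    qed simp
  qed
  also have "\<dots> = ennreal (Q r) * energy (W (test_fun z))"
  proof -
    have [measurable]: "test_fun z \<in> borel_measurable borel" by (rule holomorphic_measurable[OF test_fun_holomorphic])
    show ?thesis unfolding W_energy by (rule nn_integral_cmult) measurable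
  qed
  finally show ?thesis .
qed

lemma gs_nonzero [simp]: "gs z \<noteq> 0" by (simp add: gs_def)

text \<open>The normalisation 1/V may grow with \<open>z\<close>, but at most exponentially, and the
  Gaussian in the distance from \<xi> to \<open>z n\<close> outweighs it.\<close>

lemma test_fun_tendsto_zero:
  assumes z: "filterlim (\<lambda>n. cmod (z n)) at_top sequentially"
  shows "(\<lambda>n. test_fun (z n) \<xi>) \<longlonglongrightarrow> 0"
proof -
  define t where "t n = dist \<xi> (z n)" for n
  define A where "A = K * exp (k * cmod \<xi>) / (V 0 * gs \<xi>)"
  have A: "A > 0" using K_pos V_pos by (simp add: A_def)
  have "filterlim t at_top sequentially"
  proof (rule filterlim_at_top_mono)
    show "filterlim (\<lambda>n. - cmod \<xi> + cmod (z n)) at_top sequentially"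
      by (rule filterlim_tendsto_add_at_top[OF tendsto_const z])
    show "\<forall>\<^sub>F n in sequentially. - cmod \<xi> + cmod (z n) \<le> t n"
      using norm_triangle_ineq2[of "z _" \<xi>] by (auto simp: t_def dist_norm norm_minus_commute)
  qed
  moreover have "((\<lambda>x. exp (- \<alpha> * x\<^sup>2 + k * x)) \<longlongrightarrow> 0) at_top"
    using \<alpha>_pos by real_asymp
  ultimately have lim: "(\<lambda>n. A * exp (- \<alpha> * (t n)\<^sup>2 + k * t n)) \<longlonglongrightarrow> 0"
    using filterlim_compose[of _ _ at_top t] tendsto_mult_right_zero by blast
  have "(cmod (test_fun (z n) \<xi>))\<^sup>2 \<le> A * exp (- \<alpha> * (t n)\<^sup>2 + k * t n)" for n
  proof -
    have "V 0 / (K * exp (k * cmod (z n))) \<le> V (z n)" by (rule V_lower_on_ball) simp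
    then have inv: "1 / V (z n) \<le> K * exp (k * cmod (z n)) / V 0"
      using V_pos[of 0] V_pos[of "z n"] K_pos by (simp add: field_simps)
    have "cmod (z n) \<le> cmod \<xi> + t n"
      using norm_triangle_ineq[of \<xi> "z n - \<xi>"] by (simp add: t_def dist_norm norm_minus_commute)
    then have "exp (k * cmod (z n)) \<le> exp (k * (cmod \<xi> + t n))" using k_nonneg by (simp add: mult_left_mono)
    then have le: "exp (k * cmod (z n)) \<le> exp (k * cmod \<xi>) * exp (k * t n)" by (simp add: distrib_left exp_add)
    have "(cmod (test_fun (z n) \<xi>))\<^sup>2 * gs \<xi> = exp (- \<alpha> * (t n)\<^sup>2) * (1 / V (z n))"
      unfolding test_fun_abs t_def by simp
    also have "\<dots> \<le> exp (- \<alpha> * (t n)\<^sup>2) * (K * exp (k * cmod (z n)) / V 0)"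
      by (intro mult_left_mono inv) simp
    also have "\<dots> \<le> exp (- \<alpha> * (t n)\<^sup>2) * (K * (exp (k * cmod \<xi>) * exp (k * t n)) / V 0)"
      using le K_pos V_pos[of 0] by (intro mult_left_mono divide_right_mono) simp_all
    also have "\<dots> = A * gs \<xi> * exp (- \<alpha> * (t n)\<^sup>2 + k * t n)"
      unfolding exp_add A_def using V_pos[of 0] gs_pos[of \<xi>] by (simp add: field_simps)
    finally have "(cmod (test_fun (z n) \<xi>))\<^sup>2 * gs \<xi> \<le> A * exp (- \<alpha> * (t n)\<^sup>2 + k * t n) * gs \<xi>" by (simp add: mult_ac)
    then show ?thesis by (rule mult_right_le_imp_le) simp
  qed
  then have "(\<lambda>n. (cmod (test_fun (z n) \<xi>))\<^sup>2) \<longlonglongrightarrow> 0"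
    by (intro Lim_null_comparison[OF _ lim]) simp
  then have "(\<lambda>n. sqrt ((cmod (test_fun (z n) \<xi>))\<^sup>2)) \<longlonglongrightarrow> sqrt 0" by (rule tendsto_real_sqrt)
  then show ?thesis by (simp add: tendsto_norm_zero_iff)
qed

section \<open>Boundedness and compactness in terms of the averages\<close>

definition bounded_W :: bool where
  "bounded_W \<longleftrightarrow> (\<exists>C. \<forall>f\<in>F. W f \<in> F \<and> fs.nrm (W f) \<le> C * fs.nrm f)"

text \<open>Sequential compactness on the unit ball, the same form as in
  \<open>compact_operator\<close>. \<open>compact_operator_on_iff\<close> identifies it with the
  topological definition.\<close>

definition compact_W :: bool where
  "compact_W \<longleftrightarrow> (\<forall>f\<in>F. W f \<in> F) \<and> (\<forall>\<sigma>. (\<forall>n. \<sigma> n \<in> F \<and> fs.nrm (\<sigma> n) \<le> 1) \<longrightarrow>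
    (\<exists>r g. strict_mono (r :: nat \<Rightarrow> nat) \<and> g \<in> F \<and> (\<lambda>n. fs.nrm (W (\<sigma> (r n)) - g)) \<longlonglongrightarrow> 0))"

lemma upper_bound_F:
  assumes f: "f \<in> F" and r: "0 < r" "r \<le> h" and S: "\<And>z. \<Phi> r z \<le> ennreal S" "0 \<le> S"
  shows "W f \<in> F" "fs.nrm (W f) \<le> sqrt (P r * K * S) * fs.nrm f"
proof -
  have [measurable]: "f \<in> borel_measurable borel" using f by (rule F_measurable)
  have PK: "0 < P r * K" using P_pos[OF r(1)] K_pos by simp
  have "energy (W f) \<le> ennreal (P r * K) * (\<integral>\<^sup>+\<zeta>. ennreal ((cmod (f \<zeta>))\<^sup>2 * gs \<zeta>) * \<Phi> r \<zeta> \<partial>M)"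
    by (rule upper_bound[OF F_D(1)[OF f] r])
  also have "\<dots> \<le> ennreal (P r * K) * (\<integral>\<^sup>+\<zeta>. ennreal ((cmod (f \<zeta>))\<^sup>2 * gs \<zeta>) * ennreal S \<partial>M)"
    by (intro mult_left_mono nn_integral_mono S) simp_all
  also have "\<dots> = ennreal (P r * K) * (energy f * ennreal S)"
    unfolding energy_def by (subst nn_integral_multc) simp_all
  also have "\<dots> = ennreal (P r * K * S * (fs.nrm f)\<^sup>2)"
    using PK S(2) f by (simp add: nrm_energy mult_ac flip: ennreal_mult)
  finally have e: "energy (W f) \<le> ennreal (P r * K * S * (fs.nrm f)\<^sup>2)" .
  show WF: "W f \<in> F"
    using le_less_trans[OF e] W_holomorphic[OF F_D(1)[OF f]] by (simp add: F_def)
  show "fs.nrm (W f) \<le> sqrt (P r * K * S) * fs.nrm f"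
    using e PK S(2) fs.nrm_nonneg[OF f] by (subst nrm_le_iff[OF WF]) (simp_all add: power_mult_distrib)
qed

theorem bounded_if_sup_finite:
  assumes r: "0 < r" "r \<le> h" and sup: "(SUP z. \<Phi> r z) < \<infinity>"
  shows bounded_W
proof -
  define S where "S = enn2real (SUP z. \<Phi> r z)"
  have "(SUP z. \<Phi> r z) = ennreal S" using sup by (simp add: S_def)
  then have "\<Phi> r z \<le> ennreal S" for z by (metis SUP_upper UNIV_I)
  moreover have "0 \<le> S" by (simp add: S_def)
  ultimately show ?thesis unfolding bounded_W_def using upper_bound_F[OF _ r] by blast
qed

theorem sup_finite_if_bounded:
  assumes r: "0 < r" "r \<le> h" and bounded_W
  shows "(SUP z. \<Phi> r z) < \<infinity>"
proof -
  obtain C where C: "\<And>f. f \<in> F \<Longrightarrow> W f \<in> F" "\<And>f. f \<in> F \<Longrightarrow> fs.nrm (W f) \<le> C * fs.nrm f"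
    using assms(3) unfolding bounded_W_def by blast
  obtain D where D: "D > 0" "\<And>z. test_fun z \<in> F" "\<And>z. fs.nrm (test_fun z) \<le> D"
    using test_fun_energy by blast
  have "\<Phi> r z \<le> ennreal (Q r * (\<bar>C\<bar> * D)\<^sup>2)" for z
  proof -
    have "fs.nrm (W (test_fun z)) \<le> \<bar>C\<bar> * fs.nrm (test_fun z)"
      using C(2)[OF D(2)] fs.nrm_nonneg[OF D(2)] by (meson abs_ge_self mult_right_mono order_trans)
    also have "\<dots> \<le> \<bar>C\<bar> * D" using D(3) by (intro mult_left_mono) auto
    finally have "energy (W (test_fun z)) \<le> ennreal ((\<bar>C\<bar> * D)\<^sup>2)"
      using D(1) by (subst nrm_le_iff[symmetric]) (auto intro: C D)
    then have "ennreal (Q r) * energy (W (test_fun z)) \<le> ennreal (Q r) * ennreal ((\<bar>C\<bar> * D)\<^sup>2)"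
      by (rule mult_left_mono) simp
    then show ?thesis using lower_bound[OF r, of z] Q_pos[OF r(1)] by (simp add: ennreal_mult)
  qed
  then have "(SUP z. \<Phi> r z) \<le> ennreal (Q r * (\<bar>C\<bar> * D)\<^sup>2)" by (intro SUP_least)
  then show ?thesis by (rule le_less_trans) simp
qed

text \<open>Finiteness at every point is part of vanishing at infinity. It follows from membership
  of the images in \<open>F\<close>, before any limit is considered.\<close>

lemma \<Phi>_finite_if_bounded_image:
  assumes r: "0 < r" "r \<le> h" and W: "\<And>f. f \<in> F \<Longrightarrow> W f \<in> F"
  shows "\<Phi> r z < \<infinity>"
proof -
  have "energy (W (test_fun z)) < \<infinity>" using test_fun_energy W F_D by blast
  then have "ennreal (Q r) * energy (W (test_fun z)) < \<infinity>" by (simp add: ennreal_mult_less_top)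
  then show ?thesis using lower_bound[OF r, of z] by (rule le_less_trans[rotated])
qed

lemma pointwise_tendsto:
  assumes "\<And>n. \<sigma> n \<in> F" "g \<in> F" "(\<lambda>n. fs.nrm (\<sigma> n - g)) \<longlonglongrightarrow> 0"
  shows "(\<lambda>n. \<sigma> n x) \<longlonglongrightarrow> g x"
proof -
  have "(\<lambda>n. P h * (fs.nrm (\<sigma> n - g))\<^sup>2 / (gs x * V x)) \<longlonglongrightarrow> P h * 0\<^sup>2 / (gs x * V x)"
    using V_pos[of x] gs_pos[of x] by (intro tendsto_intros assms) simp
  then have lim: "(\<lambda>n. P h * (fs.nrm (\<sigma> n - g))\<^sup>2 / (gs x * V x)) \<longlonglongrightarrow> 0" by simp
  have "(cmod ((\<sigma> n - g) x))\<^sup>2 \<le> P h * (fs.nrm (\<sigma> n - g))\<^sup>2 / (gs x * V x)" for n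
    by (intro pointwise_nrm fs.H_closed assms)
  then have "(\<lambda>n. (cmod (\<sigma> n x - g x))\<^sup>2) \<longlonglongrightarrow> 0"
    by (intro Lim_null_comparison[OF _ lim]) simp
  then have "(\<lambda>n. sqrt ((cmod (\<sigma> n x - g x))\<^sup>2)) \<longlonglongrightarrow> sqrt 0" by (rule tendsto_real_sqrt)
  then show ?thesis by (simp add: tendsto_norm_zero_iff LIM_zero_iff)
qed

text \<open>Along points escaping to infinity the test functions tend to 0 pointwise, hence so do
  their images. A norm limit of a subsequence of the images is also a pointwise limit, so it is 0,
  and \<open>lower_bound\<close> then contradicts \<Phi> \<ge> \<epsilon> along these
  points.\<close>

theorem vanishes_if_compact:
  assumes r: "0 < r" "r \<le> h" and comp: compact_W
  shows "vanishes_at_infinity (\<Phi> r)"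
  unfolding vanishes_at_infinity_def
proof (intro conjI allI)
  have W: "\<And>f. f \<in> F \<Longrightarrow> W f \<in> F" using comp by (simp add: compact_W_def)
  show "\<Phi> r z < \<infinity>" for z by (rule \<Phi>_finite_if_bounded_image[OF r W])
  show "(\<Phi> r \<longlongrightarrow> 0) at_infinity"
  proof (rule ccontr)
    assume "\<not> (\<Phi> r \<longlongrightarrow> 0) at_infinity"
    then obtain \<epsilon> where \<epsilon>: "\<epsilon> > 0" "\<not> (\<forall>\<^sub>F z in at_infinity. \<Phi> r z < \<epsilon>)"
      unfolding order_tendsto_iff by auto
    have "\<forall>n::nat. \<exists>z. real n \<le> cmod z \<and> \<epsilon> \<le> \<Phi> r z"
      using \<epsilon>(2) unfolding eventually_at_infinity by (metis not_le)
    from choice[OF this] obtain z where z: "\<And>n. real n \<le> cmod (z n)" "\<And>n. \<epsilon> \<le> \<Phi> r (z n)" by auto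
    have zlim: "filterlim (\<lambda>n. cmod (z n)) at_top sequentially"
      by (rule filterlim_at_top_mono[OF filterlim_real_sequentially]) (simp add: z)
    obtain D where D: "D > 0" "\<And>z. test_fun z \<in> F" "\<And>z. fs.nrm (test_fun z) \<le> D"
      using test_fun_energy by blast
    \<comment> \<open>Division by the common bound \<open>D\<close> moves the test functions into
      the unit ball, to which compactness refers.\<close>
    define \<sigma> where "\<sigma> n = fun_scale (of_real (1 / D)) (test_fun (z n))" for n
    have \<sigma>: "\<sigma> n \<in> F" "fs.nrm (\<sigma> n) \<le> 1" for n
      using D by (simp_all add: \<sigma>_def fs.nrm_scale norm_divide)
    obtain s g where s: "strict_mono (s :: nat \<Rightarrow> nat)" and g: "g \<in> F"
      and lim: "(\<lambda>n. fs.nrm (W (\<sigma> (s n)) - g)) \<longlonglongrightarrow> 0"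
      using comp \<sigma> unfolding compact_W_def by meson
    have "g = 0"
    proof
      fix x
      have "(\<lambda>n. W (\<sigma> (s n)) x) \<longlonglongrightarrow> g x"
        by (rule pointwise_tendsto[OF W[OF \<sigma>(1)] g lim])
      moreover have "(\<lambda>n. W (\<sigma> (s n)) x) \<longlonglongrightarrow> 0"
      proof -
        have "filterlim (\<lambda>n. cmod (z (s n))) at_top sequentially"
          using filterlim_compose[OF zlim filterlim_subseq[OF s]] by simp
        then have "(\<lambda>n. \<psi> x * (of_real (1 / D) * test_fun (z (s n)) (\<phi> x))) \<longlonglongrightarrow> \<psi> x * (of_real (1 / D) * 0)"
          by (intro tendsto_mult tendsto_const test_fun_tendsto_zero)
        then show ?thesis by (simp add: weighted_comp_def \<sigma>_def fun_scale_def)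
      qed
      ultimately show "g x = 0 x" using LIMSEQ_unique by (simp add: zero_fun_def) blast
    qed
    then have lim: "(\<lambda>n. fs.nrm (W (\<sigma> (s n)))) \<longlonglongrightarrow> 0" using lim by simp
    have le: "\<epsilon> \<le> ennreal (Q r * D\<^sup>2 * (fs.nrm (W (\<sigma> (s n))))\<^sup>2)" for n
    proof -
      have "test_fun (z (s n)) = fun_scale (of_real D) (\<sigma> (s n))"
        using D(1) by (simp add: \<sigma>_def fun_scale_def fun_eq_iff)
      then have "W (test_fun (z (s n))) = fun_scale (of_real D) (W (\<sigma> (s n)))" by (simp only: W_scale)
      then have "energy (W (test_fun (z (s n)))) = ennreal ((D * fs.nrm (W (\<sigma> (s n))))\<^sup>2)"
        using D W[OF \<sigma>(1)] by (simp add: nrm_energy fs.nrm_scale)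
      then have "\<Phi> r (z (s n)) \<le> ennreal (Q r * D\<^sup>2 * (fs.nrm (W (\<sigma> (s n))))\<^sup>2)"
        using lower_bound[OF r, of "z (s n)"] Q_pos[OF r(1)] by (simp add: power_mult_distrib ennreal_mult mult.assoc)
      then show ?thesis using z(2)[of "s n"] by simp
    qed
    have "(\<lambda>n. ennreal (Q r * D\<^sup>2 * (fs.nrm (W (\<sigma> (s n))))\<^sup>2)) \<longlonglongrightarrow> ennreal (Q r * D\<^sup>2 * 0\<^sup>2)"
      by (intro tendsto_intros lim)
    then have "\<epsilon> \<le> ennreal (Q r * D\<^sup>2 * 0\<^sup>2)" using le by (intro LIMSEQ_le_const) auto
    then show False using \<epsilon>(1) by simp
  qed
qed

text \<open>Far away \<Phi> is below 1. Near the origin finitely many disks cover everything that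
  can meet the disk around \<open>z\<close>, their pulled-back masses are finite, and the
  denominators are bounded below.\<close>

lemma \<Phi>_bounded_if_vanishes:
  assumes r: "0 < r" "r \<le> h" and van: "vanishes_at_infinity (\<Phi> r)"
  shows "\<exists>S\<ge>0. \<forall>z. \<Phi> r z \<le> ennreal S"
proof -
  have fin: "\<Phi> r z < \<infinity>" for z
    using van by (auto simp: vanishes_at_infinity_def)
  have lim: "(\<Phi> r \<longlongrightarrow> 0) at_infinity"
    using van by (auto simp: vanishes_at_infinity_def)
  \<comment> \<open>An infinite numerator over a finite denominator would make \<Phi> infinite; this
    is where pointwise finiteness enters.\<close>
  have pull_fin: "pull r z < \<infinity>" for z
  proof (rule ccontr)
    assume "\<not> pull r z < \<infinity>"
    then have "pull r z = \<infinity>" by (simp add: not_less top_unique)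
    moreover have "emeasure M (ball z r) < \<infinity>"
      using emeasure_ball_le[OF r(2), of z] by (auto intro: le_less_trans)
    ultimately show False using fin[of z] by (simp add: \<Phi>_def ennreal_top_divide split: if_splits)
  qed
  have "\<forall>\<^sub>F z in at_infinity. \<Phi> r z < 1" using order_tendstoD(2)[OF lim, of 1] by simp
  then obtain R where R: "\<And>z. R \<le> cmod z \<Longrightarrow> \<Phi> r z < 1" by (auto simp: eventually_at_infinity)
  obtain D where D: "finite D" "cball (0::complex) (R + r) \<subseteq> (\<Union>z\<in>D. ball z r)"
    using compactE_image[OF compact_cball, of UNIV "\<lambda>z. ball z r" "0::complex" "R + r"] r
    by (metis UNIV_I UN_I centre_in_ball open_ball subsetI)
  define A where "A = (\<Sum>z\<in>D. pull r z)"
  have A: "A < \<infinity>" using D pull_fin by (simp add: A_def)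
  define m where "m = c * r powr (2 * q) * (V 0 / (K * exp (k * R)))"
  have m: "m > 0" using c_pos r V_pos[of 0] K_pos by (simp add: m_def)
  \<comment> \<open>The summand 1 serves the points with modulus at least \<open>R\<close>, the
    other one the points inside.\<close>
  define S where "S = enn2real A * (1 / m) + 1"
  have "\<Phi> r z \<le> ennreal S" for z
  proof (cases "R \<le> cmod z")
    case True
    have "\<Phi> r z \<le> ennreal 1" using R[OF True] by simp
    also have "\<dots> \<le> ennreal S" using m by (intro ennreal_leI) (simp add: S_def)
    finally show ?thesis .
  next
    case False
    have "pull r z \<le> (\<integral>\<^sup>+\<xi>. (\<Sum>w\<in>D. u \<xi> * indicator (ball w r) (\<phi> \<xi>)) \<partial>M)"
      unfolding pull_def
    proof (rule nn_integral_mono)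
      fix \<xi>
      show "u \<xi> * indicator (ball z r) (\<phi> \<xi>) \<le> (\<Sum>w\<in>D. u \<xi> * indicator (ball w r) (\<phi> \<xi>))"
      proof (cases "\<phi> \<xi> \<in> ball z r")
        case True
        then have "cmod (\<phi> \<xi>) \<le> R + r"
          using False norm_triangle_ineq[of z "\<phi> \<xi> - z"] by (simp add: dist_norm norm_minus_commute)
        then obtain w where w: "w \<in> D" "\<phi> \<xi> \<in> ball w r" using D(2) by (auto simp: subset_iff)
        have "u \<xi> * indicator (ball w r) (\<phi> \<xi>) \<le> (\<Sum>w\<in>D. u \<xi> * indicator (ball w r) (\<phi> \<xi>))"
          using w(1) D(1) by (intro member_le_sum) auto
        then show ?thesis using w True by simp
      qed simp
    qed
    also have "\<dots> = A"
      unfolding A_def pull_def using ball_borel by (intro nn_integral_sum) measurable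
    finally have 1: "pull r z \<le> A" .
    have "m \<le> c * r powr (2 * q) * V z"
      unfolding m_def using V_lower_on_ball[of z R] False c_pos by (intro mult_left_mono) auto
    then have "1 / (c * r powr (2 * q) * V z) \<le> 1 / m"
      using m c_pos r V_pos[of z] by (intro divide_left_mono mult_pos_pos) auto
    then have 2: "inverse (emeasure M (ball z r)) \<le> ennreal (1 / m)"
      using inverse_emeasure_ball(2)[OF r, of z] by (meson ennreal_leI order_trans)
    have "\<Phi> r z \<le> A * ennreal (1 / m)"
      unfolding \<Phi>_def divide_ennreal_def using 1 2 by (intro mult_mono) auto
    also have "\<dots> = ennreal (enn2real A * (1 / m))" using A m ennreal_mult[of "enn2real A" "1 / m"] by simp
    also have "\<dots> \<le> ennreal S" by (intro ennreal_leI) (simp add: S_def)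
    finally show ?thesis .
  qed
  moreover have "S \<ge> 0" using m by (simp add: S_def)
  ultimately show ?thesis by blast
qed

text \<open>A bounded sequence has a locally uniformly convergent subsequence, so it suffices that
  \<open>W\<close> sends bounded sequences tending to 0 locally uniformly to null sequences. In
  \<open>upper_bound\<close> the disk of radius \<open>R\<close> is handled by uniform convergence
  and its complement by the smallness of \<Phi>.\<close>

theorem compact_if_vanishes:
  assumes r: "0 < r" "r \<le> h" and van: "vanishes_at_infinity (\<Phi> r)"
  shows compact_W
proof -
  obtain S where S: "0 \<le> S" "\<And>z. \<Phi> r z \<le> ennreal S" using \<Phi>_bounded_if_vanishes[OF assms] by blast
  have lim: "(\<Phi> r \<longlongrightarrow> 0) at_infinity" using van by (simp add: vanishes_at_infinity_def)
  have W: "W f \<in> F" if "f \<in> F" for f by (rule upper_bound_F(1)[OF that r S(2,1)])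
  have PK: "0 < P r * K" using P_pos[OF r(1)] K_pos by simp
  have conv: "(\<lambda>n. energy (W (g n))) \<longlonglongrightarrow> 0"
    if g: "\<And>n. g n \<in> F" "\<And>n. fs.nrm (g n) \<le> 2" and unif: "\<And>R. uniform_limit (cball 0 R) g (\<lambda>_. 0) sequentially" for g
  proof (rule tendsto_0_if_Limsup_eq_0_ennreal, rule antisym[OF _ zero_le], rule ennreal_le_epsilon)
    fix e :: real assume e: "0 < e"
    \<comment> \<open>The energies of \<open>g n\<close> are at most 4, so the part outside the disk
      contributes at most P K * 4 \<epsilon> = e / 2.\<close>
    define \<epsilon> where "\<epsilon> = e / (8 * (P r * K))"
    have \<epsilon>: "\<epsilon> > 0" using e PK by (simp add: \<epsilon>_def)
    have "\<forall>\<^sub>F z in at_infinity. \<Phi> r z < ennreal \<epsilon>" using order_tendstoD(2)[OF lim, of "ennreal \<epsilon>"] \<epsilon> by simp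
    then obtain R where R: "\<And>z. R \<le> cmod z \<Longrightarrow> \<Phi> r z < ennreal \<epsilon>" by (auto simp: eventually_at_infinity)
    define m where "m = measure M (cball 0 R)"
    have m: "emeasure M (cball 0 R) = ennreal m"
      using emeasure_compact_finite[of "cball 0 R"] by (simp add: m_def emeasure_eq_ennreal_measure)
    \<comment> \<open>Makes the part inside the disk at most e / 2; the added 1 allows the product
      \<open>S * m\<close> to be 0.\<close>
    define d where "d = sqrt (e / (2 * (P r * K) * (S * m + 1)))"
    have "m \<ge> 0" by (simp add: m_def)
    then have Sm: "S * m + 1 > 0" using S(1) by (simp add: add_nonneg_pos)
    have d: "d > 0" using e PK Sm by (simp add: d_def)
    have d2: "P r * K * (S * m * d\<^sup>2) \<le> e / 2"
    proof -
      have "P r * K * (S * m * d\<^sup>2) \<le> P r * K * ((S * m + 1) * d\<^sup>2)"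
        using PK by (intro mult_left_mono mult_right_mono) auto
      also have "\<dots> = e / 2"
      proof -
        have "d\<^sup>2 = e / (2 * (P r * K) * (S * m + 1))"
          unfolding d_def using e Sm P_pos[OF r(1)] K_pos by (intro real_sqrt_pow2 divide_nonneg_pos mult_pos_pos) auto
        moreover have "A * (B * (e / (2 * A * B))) = e / 2" if "A \<noteq> 0" "B \<noteq> 0" for A B :: real
          using that by (simp add: field_simps)
        ultimately show ?thesis using PK Sm by (metis less_irrefl)
      qed
      finally show ?thesis .
    qed
    have "\<forall>\<^sub>F n in sequentially. \<forall>x\<in>cball 0 R. dist (g n x) 0 < d"
      using uniform_limitD[OF unif d] .
    then have "\<forall>\<^sub>F n in sequentially. energy (W (g n)) \<le> ennreal e"
    proof eventually_elim
      case (elim n)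
      have [measurable]: "g n \<in> borel_measurable borel" by (rule F_measurable[OF g(1)])
      let ?E = "\<lambda>\<zeta>. ennreal ((cmod (g n \<zeta>))\<^sup>2 * gs \<zeta>)"
      have "(\<integral>\<^sup>+\<zeta>. ?E \<zeta> * \<Phi> r \<zeta> \<partial>M) \<le> (\<integral>\<^sup>+\<zeta>. ennreal (S * d\<^sup>2) * indicator (cball 0 R) \<zeta> + ennreal \<epsilon> * ?E \<zeta> \<partial>M)"
      proof (rule nn_integral_mono)
        fix \<zeta>
        show "?E \<zeta> * \<Phi> r \<zeta> \<le> ennreal (S * d\<^sup>2) * indicator (cball 0 R) \<zeta> + ennreal \<epsilon> * ?E \<zeta>"
        proof (cases "\<zeta> \<in> cball 0 R")
          case True
          have "gs \<zeta> \<le> 1" using \<alpha>_pos by (simp add: gs_def)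
          moreover have "(cmod (g n \<zeta>))\<^sup>2 \<le> d\<^sup>2" using bspec[OF elim True] by (intro power_mono) auto
          ultimately have "(cmod (g n \<zeta>))\<^sup>2 * gs \<zeta> \<le> d\<^sup>2 * 1" by (intro mult_mono) auto
          then have "?E \<zeta> * \<Phi> r \<zeta> \<le> ennreal (d\<^sup>2) * ennreal S" by (intro mult_mono S ennreal_leI) auto
          then show ?thesis using True S(1) by (simp add: ennreal_mult' mult.commute add_increasing2)
        next
          case False
          then have "\<Phi> r \<zeta> \<le> ennreal \<epsilon>" using R[of \<zeta>] by (simp add: less_imp_le)
          then have "?E \<zeta> * \<Phi> r \<zeta> \<le> ?E \<zeta> * ennreal \<epsilon>" by (rule mult_left_mono) simp
          then show ?thesis using False by (simp add: mult.commute)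
        qed
      qed
      also have "\<dots> = ennreal (S * d\<^sup>2) * emeasure M (cball 0 R) + ennreal \<epsilon> * energy (g n)"
        unfolding energy_def by (simp add: nn_integral_add nn_integral_cmult)
      also have "\<dots> \<le> ennreal (S * d\<^sup>2) * ennreal m + ennreal \<epsilon> * ennreal 4"
        using g(2)[of n] unfolding m by (intro add_mono mult_left_mono) (auto simp: nrm_le_iff[OF g(1)])
      also have "\<dots> = ennreal (S * m * d\<^sup>2 + 4 * \<epsilon>)"
      proof -
        have "ennreal (S * d\<^sup>2) * ennreal m = ennreal (S * m * d\<^sup>2)"
          using S(1) \<open>m \<ge> 0\<close> by (simp add: mult_ac flip: ennreal_mult)
        moreover have "ennreal \<epsilon> * ennreal 4 = ennreal (4 * \<epsilon>)"
          using \<epsilon> by (subst ennreal_mult[symmetric]) (simp_all add: mult.commute)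
        moreover have "ennreal (S * m * d\<^sup>2) + ennreal (4 * \<epsilon>) = ennreal (S * m * d\<^sup>2 + 4 * \<epsilon>)"
          using S(1) \<epsilon> \<open>m \<ge> 0\<close> by (intro ennreal_plus[symmetric]) auto
        ultimately show ?thesis by metis
      qed
      finally have "energy (W (g n)) \<le> ennreal (P r * K) * ennreal (S * m * d\<^sup>2 + 4 * \<epsilon>)"
        using upper_bound[OF F_D(1)[OF g(1)[of n]] r] by (meson mult_left_mono order_trans zero_le)
      also have "\<dots> = ennreal (P r * K * (S * m * d\<^sup>2 + 4 * \<epsilon>))" using PK by (simp add: ennreal_mult')
      also have "P r * K * (S * m * d\<^sup>2 + 4 * \<epsilon>) = P r * K * (S * m * d\<^sup>2) + e / 2"
        using P_pos[OF r(1)] K_pos by (simp add: \<epsilon>_def field_simps)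
      also have "ennreal \<dots> \<le> ennreal e" using d2 by (intro ennreal_leI) simp
      finally show ?case .
    qed
    then have "limsup (\<lambda>n. energy (W (g n))) \<le> ennreal e" by (rule Limsup_bounded)
    then show "limsup (\<lambda>n. energy (W (g n))) \<le> 0 + ennreal e" by simp
  qed
  show ?thesis
    unfolding compact_W_def
  proof (intro conjI ballI allI impI)
    show "W f \<in> F" if "f \<in> F" for f using that by (rule W)
    fix \<sigma> :: "nat \<Rightarrow> complex \<Rightarrow> complex"
    assume "\<forall>n. \<sigma> n \<in> F \<and> fs.nrm (\<sigma> n) \<le> 1"
    then have \<sigma>: "\<And>n. \<sigma> n \<in> F" "\<And>n. fs.nrm (\<sigma> n) \<le> 1" by auto
    obtain s f where s: "strict_mono (s :: nat \<Rightarrow> nat)" and f: "f \<in> F" "fs.nrm f \<le> 1"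
      and unif: "\<And>R. uniform_limit (cball 0 R) (\<lambda>n. \<sigma> (s n)) f sequentially"
      using weakly_compact[of \<sigma>, OF \<sigma>] by blast
    have "(\<lambda>n. energy (W (\<sigma> (s n) - f))) \<longlonglongrightarrow> 0"
    proof (rule conv)
      show "\<sigma> (s n) - f \<in> F" for n using \<sigma> f by simp
      show "fs.nrm (\<sigma> (s n) - f) \<le> 2" for n
      proof -
        have "fs.nrm (\<sigma> (s n) - f) \<le> fs.nrm (\<sigma> (s n) - 0) + fs.nrm (0 - f)"
          using \<sigma> f by (intro fs.nrm_triangle_diff) auto
        also have "fs.nrm (0 - f) = fs.nrm (f - 0)" using f by (intro fs.nrm_minus_commute) auto
        finally show ?thesis using \<sigma>(2)[of "s n"] f(2) unfolding diff_zero by linarith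
      qed
      show "uniform_limit (cball 0 R) (\<lambda>n. \<sigma> (s n) - f) (\<lambda>_. 0) sequentially" for R
        using unif[of R] by (simp add: uniform_limit_iff dist_norm)
    qed
    moreover have "energy (W (\<sigma> (s n) - f)) = ennreal ((fs.nrm (W (\<sigma> (s n)) - W f))\<^sup>2)" for n
      using \<sigma> f W by (simp add: W_diff nrm_energy)
    ultimately have "(\<lambda>n. ennreal ((fs.nrm (W (\<sigma> (s n)) - W f))\<^sup>2)) \<longlonglongrightarrow> ennreal 0" by simp
    then have "(\<lambda>n. (fs.nrm (W (\<sigma> (s n)) - W f))\<^sup>2) \<longlonglongrightarrow> 0" by (rule tendsto_ennrealD) auto
    then have "(\<lambda>n. sqrt ((fs.nrm (W (\<sigma> (s n)) - W f))\<^sup>2)) \<longlonglongrightarrow> sqrt 0" by (rule tendsto_real_sqrt)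
    then have "(\<lambda>n. fs.nrm (W (\<sigma> (s n)) - W f)) \<longlonglongrightarrow> 0"
      using \<sigma> f W by (simp add: fs.nrm_nonneg)
    then show "\<exists>r g. strict_mono (r :: nat \<Rightarrow> nat) \<and> g \<in> F \<and> (\<lambda>n. fs.nrm (W (\<sigma> (r n)) - g)) \<longlonglongrightarrow> 0"
      using s W[OF f(1)] by blast
  qed
qed

end

section \<open>Schatten classes\<close>

text \<open>The convex function y^s lies above its tangent at \<open>b\<close>; written without
  subtraction so that it carries over to extended values.\<close>

lemma young_tangent:
  assumes "0 \<le> y" "0 < b" "1 \<le> (s::real)"
  shows "s * b powr (s - 1) * y \<le> y powr s + (s - 1) * b powr s"
proof (cases "s = 1")
  case False
  then have s: "s > 1" using assms by simp
  have "y * b powr (s - 1) \<le> y powr s / s + (b powr (s - 1)) powr (s / (s - 1)) / (s / (s - 1))"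
    using s assms by (intro Youngs_inequality) (auto simp: field_simps)
  also have "(b powr (s - 1)) powr (s / (s - 1)) = b powr s" using s by (simp add: powr_powr)
  finally have "s * (y * b powr (s - 1)) \<le> s * (y powr s / s + b powr s / (s / (s - 1)))"
    using s by (intro mult_left_mono) auto
  also have "\<dots> = y powr s + (s - 1) * b powr s" using s by (simp add: field_simps)
  finally show ?thesis by (simp add: mult_ac)
qed (use assms in simp)

lemma ennreal_rpow_measurable [measurable]:
  fixes f :: "'a \<Rightarrow> ennreal"
  assumes [measurable]: "f \<in> borel_measurable M"
  shows "(\<lambda>x. ennreal_rpow (f x) s) \<in> borel_measurable M"
  unfolding ennreal_rpow_def by measurable

lemma ennreal_rpow_ennreal: "0 \<le> x \<Longrightarrow> ennreal_rpow (ennreal x) s = ennreal (x powr s)"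
  by (simp add: ennreal_rpow_def)

lemma ennreal_rpow_mono: "x \<le> y \<Longrightarrow> 0 \<le> s \<Longrightarrow> ennreal_rpow x s \<le> ennreal_rpow y s"
  by (cases x; cases y) (auto simp: ennreal_rpow_def top_unique intro!: ennreal_leI powr_mono2)

lemma ennreal_rpow_mult: "0 < C \<Longrightarrow> ennreal_rpow (ennreal C * x) s = ennreal (C powr s) * ennreal_rpow x s"
  by (cases x) (auto simp: ennreal_rpow_def ennreal_mult_top powr_mult simp flip: ennreal_mult)

text \<open>Stated for arbitrary measures and total mass at most \<open>C\<close>, so that it serves
  both for sums over singular vectors and for integrals over the plane. The tangent inequality is
  integrated; its constant term is nonnegative, so an upper bound on the mass is enough.\<close>

lemma jensen_rpow:
  assumes [measurable]: "a \<in> borel_measurable M" "X \<in> borel_measurable M"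
    and mass: "(\<integral>\<^sup>+z. a z \<partial>M) \<le> ennreal C" "0 < C" and s: "1 \<le> s"
    and x: "(\<integral>\<^sup>+z. a z * X z \<partial>M) = ennreal x" "0 \<le> x"
  shows "ennreal (x powr s) \<le> ennreal (C powr (s - 1)) * (\<integral>\<^sup>+z. a z * ennreal_rpow (X z) s \<partial>M)"
proof (cases "x = 0 \<or> (\<integral>\<^sup>+z. a z * ennreal_rpow (X z) s \<partial>M) = \<infinity>")
  case True
  then show ?thesis using s mass(2) by (auto simp: ennreal_mult_top)
next
  case False
  define I where "I = enn2real (\<integral>\<^sup>+z. a z * ennreal_rpow (X z) s \<partial>M)"
  have I: "(\<integral>\<^sup>+z. a z * ennreal_rpow (X z) s \<partial>M) = ennreal I" "0 \<le> I" using False by (simp_all add: I_def less_top)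
  \<comment> \<open>The tangent point is the mean value when the mass is exactly
    \<open>C\<close>.\<close>
  define b where "b = x / C"
  have b: "b > 0" using False x mass by (simp add: b_def)
  have tangent: "ennreal (s * b powr (s - 1)) * y \<le> ennreal_rpow y s + ennreal ((s - 1) * b powr s)" for y
  proof (cases y)
    case (real t)
    then show ?thesis using young_tangent[of t b s] b s
      by (simp add: ennreal_rpow_ennreal flip: ennreal_mult ennreal_plus)
  qed (simp add: ennreal_rpow_def)
  have "ennreal (s * b powr (s - 1) * x) = ennreal (s * b powr (s - 1)) * (\<integral>\<^sup>+z. a z * X z \<partial>M)"
    using x s by (simp add: ennreal_mult)
  also have "\<dots> = (\<integral>\<^sup>+z. a z * (ennreal (s * b powr (s - 1)) * X z) \<partial>M)"
    by (subst nn_integral_cmult[symmetric]) (simp_all add: mult_ac)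
  also have "\<dots> \<le> (\<integral>\<^sup>+z. a z * (ennreal_rpow (X z) s + ennreal ((s - 1) * b powr s)) \<partial>M)"
    by (intro nn_integral_mono mult_left_mono tangent) simp
  also have "\<dots> = ennreal I + (\<integral>\<^sup>+z. a z \<partial>M) * ennreal ((s - 1) * b powr s)"
    unfolding I(1)[symmetric] by (simp add: distrib_left nn_integral_add nn_integral_multc)
  also have "\<dots> \<le> ennreal I + ennreal C * ennreal ((s - 1) * b powr s)"
    by (intro add_left_mono mult_right_mono mass) simp
  also have "\<dots> = ennreal (I + C * ((s - 1) * b powr s))"
    using I s mass by (simp add: ennreal_mult ennreal_plus)
  finally have "s * b powr (s - 1) * x \<le> I + C * ((s - 1) * b powr s)"
    using I s mass by (subst (asm) ennreal_le_iff) auto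
  moreover have "b powr (s - 1) * x = C * b powr s"
    using b mass powr_mult_base[of b "s - 1"] by (simp add: b_def field_simps)
  ultimately have "s * (C * b powr s) \<le> I + C * ((s - 1) * b powr s)" by (simp only: mult.assoc)
  then have "C * b powr s \<le> I" by (simp add: algebra_simps)
  then have "C powr (s - 1) * (C * b powr s) \<le> C powr (s - 1) * I" by (intro mult_left_mono) auto
  also have "C powr (s - 1) * (C * b powr s) = x powr s"
  proof -
    have "C powr (s - 1) * (C * b powr s) = (C * C powr (s - 1)) * b powr s" by simp
    also have "\<dots> = C powr s * (x powr s / C powr s)"
      using mass x powr_mult_base[of C "s - 1"] by (simp only: b_def powr_divide) simp
    finally show ?thesis using mass by simp
  qed
  finally show ?thesis unfolding I(1) by (simp add: ennreal_leI flip: ennreal_mult')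
qed

text \<open>The definition of singular values fixes only how often each positive value occurs.
  Grouping a partial sum by values moves summability from one such sequence to another.\<close>

lemma summable_equal_multiplicities:
  fixes s t :: "nat \<Rightarrow> real"
  assumes nonneg: "\<And>n. 0 \<le> s n" "\<And>n. 0 \<le> t n"
    and mult: "\<And>x. 0 < x \<Longrightarrow> finite {n. s n = x} \<and> card {n. t n = x} = card {n. s n = x} \<and> finite {n. t n = x}"
    and sum: "summable (\<lambda>n. s n powr p)"
  shows "summable (\<lambda>n. t n powr p)"
proof (rule summableI_nonneg_bounded)
  fix N :: nat
  define X where "X = t ` {..<N} \<inter> {0<..}"
  have X: "finite X" "\<And>x. x \<in> X \<Longrightarrow> 0 < x" by (auto simp: X_def)
  have "(\<Sum>n<N. t n powr p) = (\<Sum>n\<in>{n\<in>{..<N}. 0 < t n}. t n powr p)"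
    by (rule sum.mono_neutral_right) (use nonneg(2) in \<open>auto simp: less_le\<close>)
  also have "\<dots> = (\<Sum>x\<in>t ` {n\<in>{..<N}. 0 < t n}. \<Sum>n\<in>{n\<in>{n\<in>{..<N}. 0 < t n}. t n = x}. t n powr p)"
    by (rule sum.image_gen) simp
  also have "t ` {n\<in>{..<N}. 0 < t n} = X" by (auto simp: X_def)
  also have "(\<Sum>x\<in>X. \<Sum>n\<in>{n\<in>{n\<in>{..<N}. 0 < t n}. t n = x}. t n powr p) \<le> (\<Sum>x\<in>X. \<Sum>n\<in>{n. t n = x}. t n powr p)"
    using X mult by (intro sum_mono sum_mono2) auto
  also have "\<dots> = (\<Sum>x\<in>X. \<Sum>n\<in>{n. s n = x}. s n powr p)"
  proof (rule sum.cong[OF refl])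
    fix x assume x: "x \<in> X"
    have "(\<Sum>n\<in>{n. t n = x}. t n powr p) = (\<Sum>n\<in>{n. t n = x}. x powr p)"
      by (rule sum.cong) auto
    also have "\<dots> = (\<Sum>n\<in>{n. s n = x}. x powr p)" using mult[OF X(2)[OF x]] by simp
    also have "\<dots> = (\<Sum>n\<in>{n. s n = x}. s n powr p)"
      by (rule sum.cong) auto
    finally show "(\<Sum>n\<in>{n. t n = x}. t n powr p) = (\<Sum>n\<in>{n. s n = x}. s n powr p)" .
  qed
  also have "\<dots> = (\<Sum>n\<in>(\<Union>x\<in>X. {n. s n = x}). s n powr p)"
    using X mult by (subst sum.UNION_disjoint) auto
  also have "\<dots> \<le> (\<Sum>n. s n powr p)"
    using X mult by (intro sum_le_suminf sum) auto
  finally show "(\<Sum>n<N. t n powr p) \<le> (\<Sum>n. s n powr p)" .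
qed simp

section \<open>Adjoint, reproducing kernel and singular values of the composition operator\<close>

context weighted_composition
begin

text \<open>Read off from the averages: compactness makes \<Phi> at radius \<open>h\<close> vanish
  at infinity, hence bounded, and this bounds the operator. The bound is what the construction of
  the adjoint requires.\<close>

lemma bounded_if_compact:
  assumes compact_W
  shows "\<exists>C\<ge>0. \<forall>f\<in>F. W f \<in> F \<and> fs.nrm (W f) \<le> C * fs.nrm f"
proof -
  obtain S where S: "0 \<le> S" "\<And>z. \<Phi> h z \<le> ennreal S"
    using \<Phi>_bounded_if_vanishes[OF h_pos order_refl vanishes_if_compact[OF h_pos order_refl assms]] by blast
  show ?thesis
    using upper_bound_F[OF _ h_pos order_refl S(2,1)] P_pos[OF h_pos] K_pos S(1)
    by (intro exI[of _ "sqrt (P h * K * S)"]) auto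
qed

lemma lincomb_eq: "(\<lambda>z. a * f z + b * g z) = fun_scale a f + fun_scale b g"
  by (simp add: fun_eq_iff fun_scale_def)

lemma ip_ext:
  assumes "x \<in> F" "y \<in> F" "\<And>f. f \<in> F \<Longrightarrow> ipF f x = ipF f y"
  shows "x = y"
proof -
  have "ipF (x - y) (x - y) = 0"
    using assms(3)[of "x - y"] assms(1,2) by (simp only: fs.ip_diff_right fs.H_closed) simp
  then have "x - y = 0" using assms(1,2) by (intro fs.ip_eq_0) simp_all
  then show ?thesis by simp
qed

text \<open>Riesz representation of f -> <W f, g> for each \<open>g\<close>; linearity of the
  resulting map follows from uniqueness of the representing vectors.\<close>

lemma adjoint_exists:
  assumes compact_W
  shows "\<exists>S. is_adjoint_on F ipF W S"
proof -
  obtain C where C: "0 \<le> C" "\<And>f. f \<in> F \<Longrightarrow> W f \<in> F" "\<And>f. f \<in> F \<Longrightarrow> fs.nrm (W f) \<le> C * fs.nrm f"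
    using bounded_if_compact[OF assms] by blast
  have "\<forall>g\<in>F. \<exists>k\<in>F. \<forall>f\<in>F. ipF (W f) g = ipF f k"
  proof
    fix g assume g: "g \<in> F"
    show "\<exists>k\<in>F. \<forall>f\<in>F. ipF (W f) g = ipF f k"
    proof (rule fs.riesz_representation)
      show "\<exists>g\<in>F. (\<lambda>n. fs.nrm (\<sigma> n - g)) \<longlonglongrightarrow> 0"
        if "\<And>n. \<sigma> n \<in> F" "\<And>\<epsilon>. 0 < \<epsilon> \<Longrightarrow> \<exists>N. \<forall>m\<ge>N. \<forall>n\<ge>N. fs.nrm (\<sigma> m - \<sigma> n) < \<epsilon>" for \<sigma>
        using that by (rule complete_F)
      show "cmod (ipF (W f) g) \<le> (C * fs.nrm g) * fs.nrm f" if f: "f \<in> F" for f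
      proof -
        have "cmod (ipF (W f) g) \<le> fs.nrm (W f) * fs.nrm g" by (rule fs.Cauchy_Schwarz[OF C(2)[OF f] g])
        also have "\<dots> \<le> (C * fs.nrm f) * fs.nrm g" by (intro mult_right_mono C(3) f fs.nrm_nonneg g)
        finally show ?thesis by (simp add: mult_ac)
      qed
    qed (use g C(2) in \<open>simp_all add: W_add W_scale fs.ip_add fs.ip_scale\<close>)
  qed
  from bchoice[OF this[unfolded Bex_def]] obtain S where S: "\<And>g. g \<in> F \<Longrightarrow> S g \<in> F" "\<And>f g. g \<in> F \<Longrightarrow> f \<in> F \<Longrightarrow> ipF (W f) g = ipF f (S g)"
    by blast
  have "S (fun_scale a f + fun_scale b g) = fun_scale a (S f) + fun_scale b (S g)" if fg: "f \<in> F" "g \<in> F" for a b f g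
  proof (rule ip_ext)
    fix k assume k: "k \<in> F"
    have "ipF k (S (fun_scale a f + fun_scale b g)) = ipF (W k) (fun_scale a f + fun_scale b g)"
      using fg k by (simp only: S(2) fs.H_closed)
    also have "\<dots> = cnj a * ipF (W k) f + cnj b * ipF (W k) g"
      using fg C(2)[OF k] by (simp only: fs.ip_add_right fs.ip_scale_right fs.H_closed)
    also have "\<dots> = ipF k (fun_scale a (S f) + fun_scale b (S g))"
      using fg k S(1) by (simp only: fs.ip_add_right fs.ip_scale_right fs.H_closed S(2))
    finally show "ipF k (S (fun_scale a f + fun_scale b g)) = ipF k (fun_scale a (S f) + fun_scale b (S g))" .
  qed (use fg S(1) in \<open>simp_all only: fs.H_closed\<close>)
  then have "operator_on F S" using S(1) unfolding operator_on_def lincomb_eq by blast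
  then have "is_adjoint_on F ipF W S" using S(2) unfolding is_adjoint_on_def by blast
  then show ?thesis by blast
qed

lemma compact_operator_W:
  assumes comp: compact_W and adj: "is_adjoint_on F ipF W S"
  shows "compact_operator fun_scale F ipF W S"
proof
  have W: "\<And>f. f \<in> F \<Longrightarrow> W f \<in> F" using comp by (simp add: compact_W_def)
  have S: "\<And>f. f \<in> F \<Longrightarrow> S f \<in> F"
    and lin: "\<And>f g a b. f \<in> F \<Longrightarrow> g \<in> F \<Longrightarrow> S (fun_scale a f + fun_scale b g) = fun_scale a (S f) + fun_scale b (S g)"
    and ip: "\<And>f g. f \<in> F \<Longrightarrow> g \<in> F \<Longrightarrow> ipF (W f) g = ipF f (S g)"
    using adj unfolding is_adjoint_on_def operator_on_def lincomb_eq by blast+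
  fix f g :: "complex \<Rightarrow> complex" and a
  show "f \<in> F \<Longrightarrow> W f \<in> F" "f \<in> F \<Longrightarrow> S f \<in> F" "f \<in> F \<Longrightarrow> g \<in> F \<Longrightarrow> ipF (W f) g = ipF f (S g)"
    using W S ip by blast+
  show "W (f + g) = W f + W g" "W (fun_scale a f) = fun_scale a (W f)" by (rule W_add W_scale)+
  show "S (f + g) = S f + S g" if "f \<in> F" "g \<in> F"
    using lin[OF that, of 1 1] by (simp only: fs.scale_one)
  show "S (fun_scale a f) = fun_scale a (S f)" if "f \<in> F"
    using lin[OF that that, of a 0] by (simp only: fs.scale_zero_left add_0_right)
  fix \<sigma> :: "nat \<Rightarrow> complex \<Rightarrow> complex"
  assume "\<And>n. \<sigma> n \<in> F" "\<And>n. fs.nrm (\<sigma> n) \<le> 1"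
  then show "\<exists>r g. strict_mono (r :: nat \<Rightarrow> nat) \<and> g \<in> F \<and> (\<lambda>n. fs.nrm (W (\<sigma> (r n)) - g)) \<longlonglongrightarrow> 0"
    using comp unfolding compact_W_def by blast
qed

text \<open>The reproducing kernel of the weighted space has no explicit formula here, but its norm
  is controlled by point evaluation: |k|^2 = k(z) \<le> C |k|.\<close>

lemma kernel_exists:
  "\<exists>k\<in>F. (\<forall>f\<in>F. f z = ipF f k) \<and> (fs.nrm k)\<^sup>2 \<le> P h / (gs z * V z)"
proof -
  define C where "C = sqrt (P h / (gs z * V z))"
  have pos: "0 < P h / (gs z * V z)" using P_pos[OF h_pos] V_pos[of z] by (simp add: zero_less_mult_iff)
  have C: "C\<^sup>2 = P h / (gs z * V z)" "0 < C" using pos by (simp_all add: C_def)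
  have le: "cmod (f z) \<le> C * fs.nrm f" if f: "f \<in> F" for f
  proof -
    have "(cmod (f z))\<^sup>2 \<le> (C * fs.nrm f)\<^sup>2"
      using pointwise_nrm[OF f, of z] by (simp add: power_mult_distrib C)
    then show ?thesis by (rule power2_le_imp_le) (use C fs.nrm_nonneg[OF f] in auto)
  qed
  have "\<exists>k\<in>F. \<forall>f\<in>F. f z = ipF f k"
  proof (rule fs.riesz_representation)
    show "\<exists>g\<in>F. (\<lambda>n. fs.nrm (\<sigma> n - g)) \<longlonglongrightarrow> 0"
      if "\<And>n. \<sigma> n \<in> F" "\<And>\<epsilon>. 0 < \<epsilon> \<Longrightarrow> \<exists>N. \<forall>m\<ge>N. \<forall>n\<ge>N. fs.nrm (\<sigma> m - \<sigma> n) < \<epsilon>" for \<sigma>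
      using that by (rule complete_F)
    show "cmod (f z) \<le> C * fs.nrm f" if "f \<in> F" for f by (rule le[OF that])
  qed (simp_all add: fun_scale_def)
  then obtain k where k: "k \<in> F" "\<And>f. f \<in> F \<Longrightarrow> f z = ipF f k" by blast
  have "k z = of_real ((fs.nrm k)\<^sup>2)" using k(2)[OF k(1)] fs.ip_self[OF k(1)] by (rule trans)
  then have "(fs.nrm k)\<^sup>2 = cmod (k z)" by (simp add: norm_power)
  also have "\<dots> \<le> C * fs.nrm k" by (rule le[OF k(1)])
  finally have "fs.nrm k \<le> C" using fs.nrm_nonneg[OF k(1)] C(2)
    by (cases "fs.nrm k = 0") (auto simp: power2_eq_square)
  then have "(fs.nrm k)\<^sup>2 \<le> C\<^sup>2" using fs.nrm_nonneg[OF k(1)] by (intro power_mono) auto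
  then show ?thesis using k C by auto
qed

definition schatten_W :: "real \<Rightarrow> bool" where
  "schatten_W p \<longleftrightarrow> compact_W \<and> (\<exists>s. singular_values_on F ipF W s \<and> summable (\<lambda>n. s n powr p))"

text \<open>The small disk around \<xi> lies in the large disk around every nearby \<zeta>, which
  compares the numerators; the denominators are compared through \<open>V\<close>.\<close>

lemma \<Phi>_half_le:
  assumes r: "0 < r" "r \<le> h" and d: "dist \<zeta> \<xi> < r / 2"
  shows "\<Phi> (r / 2) \<xi> \<le> ennreal (K / (c * (r / 2) powr (2 * q))) * \<Phi> r \<zeta>"
proof -
  let ?D = "c * (r / 2) powr (2 * q)"
  have D: "?D > 0" using c_pos r by simp
  have pull: "pull (r / 2) \<xi> \<le> pull r \<zeta>"
    unfolding pull_def
  proof (intro nn_integral_mono mult_left_mono)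
    fix x
    show "indicator (ball \<xi> (r / 2)) (\<phi> x) \<le> (indicator (ball \<zeta> r) (\<phi> x) :: ennreal)"
      using d dist_triangle[of "\<zeta>" "\<phi> x" \<xi>] by (auto simp: indicator_def dist_commute)
  qed simp
  have "inverse (emeasure M (ball \<xi> (r / 2))) \<le> ennreal (1 / (?D * V \<xi>))"
    using r by (intro inverse_emeasure_ball) auto
  also have "\<dots> \<le> ennreal (K / ?D * (1 / V \<zeta>))"
  proof (rule ennreal_leI)
    have "V \<zeta> \<le> K * V \<xi>" using d r by (intro V_le_near) (auto simp: dist_commute)
    then have "1 / V \<xi> \<le> K / V \<zeta>" using V_pos[of \<xi>] V_pos[of \<zeta>] by (simp add: field_simps)
    then have "1 / ?D * (1 / V \<xi>) \<le> 1 / ?D * (K / V \<zeta>)" using D by (intro mult_left_mono) auto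
    then show "1 / (?D * V \<xi>) \<le> K / ?D * (1 / V \<zeta>)" by (simp add: mult.commute)
  qed
  also have "\<dots> = ennreal (K / ?D) * ennreal (1 / V \<zeta>)"
    using D K_pos V_pos[of \<zeta>] by (intro ennreal_mult) auto
  also have "\<dots> \<le> ennreal (K / ?D) * inverse (emeasure M (ball \<zeta> r))"
    by (intro mult_left_mono inverse_emeasure_ball r) simp
  finally have "\<Phi> (r / 2) \<xi> \<le> pull r \<zeta> * (ennreal (K / ?D) * inverse (emeasure M (ball \<zeta> r)))"
    unfolding \<Phi>_def divide_ennreal_def by (intro mult_mono pull) auto
  then show ?thesis by (simp add: \<Phi>_def divide_ennreal_def mult_ac)
qed

text \<open>Integrating \<open>\<Phi>_half_le\<close> over \<zeta> near \<xi> bounds a value of the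
  average at a point by a local integral. Half the radius is the price.\<close>

lemma \<Phi>_half_average:
  assumes r: "0 < r" "r \<le> h" and s: "1 \<le> s"
  shows "\<exists>C>0. \<forall>\<xi>. ennreal_rpow (\<Phi> (r / 2) \<xi>) s \<le> ennreal C * (\<integral>\<^sup>+\<zeta>\<in>ball \<xi> (r / 2). ennreal_rpow (\<Phi> r \<zeta>) s \<partial>lborel)"
proof -
  define B where "B = measure lborel (ball (0::complex) (r / 2))"
  have B: "emeasure lborel (ball \<xi> (r / 2)) = ennreal B" for \<xi> :: complex
    using r by (simp add: B_def emeasure_ball content_ball)
  have B_pos: "B > 0" unfolding B_def using r by (simp add: content_ball_pos)
  define A where "A = (K / (c * (r / 2) powr (2 * q))) powr s"
  have K': "0 < K / (c * (r / 2) powr (2 * q))" using K_pos c_pos r by simp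
  have A_pos: "A > 0" using K_pos c_pos r by (simp add: A_def)
  have "ennreal_rpow (\<Phi> (r / 2) \<xi>) s \<le> ennreal (A / B) * (\<integral>\<^sup>+\<zeta>\<in>ball \<xi> (r / 2). ennreal_rpow (\<Phi> r \<zeta>) s \<partial>lborel)" for \<xi>
  proof -
    have "ennreal_rpow (\<Phi> (r / 2) \<xi>) s * ennreal B = (\<integral>\<^sup>+\<zeta>. ennreal_rpow (\<Phi> (r / 2) \<xi>) s * indicator (ball \<xi> (r / 2)) \<zeta> \<partial>lborel)"
      by (subst nn_integral_cmult_indicator) (simp_all add: B)
    also have "\<dots> \<le> (\<integral>\<^sup>+\<zeta>. ennreal A * (ennreal_rpow (\<Phi> r \<zeta>) s * indicator (ball \<xi> (r / 2)) \<zeta>) \<partial>lborel)"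
    proof (rule nn_integral_mono)
      fix \<zeta>
      show "ennreal_rpow (\<Phi> (r / 2) \<xi>) s * indicator (ball \<xi> (r / 2)) \<zeta>
         \<le> ennreal A * (ennreal_rpow (\<Phi> r \<zeta>) s * indicator (ball \<xi> (r / 2)) \<zeta>)"
      proof (cases "\<zeta> \<in> ball \<xi> (r / 2)")
        case True
        then have "ennreal_rpow (\<Phi> (r / 2) \<xi>) s \<le> ennreal_rpow (ennreal (K / (c * (r / 2) powr (2 * q))) * \<Phi> r \<zeta>) s"
          using s r by (intro ennreal_rpow_mono \<Phi>_half_le) (auto simp: dist_commute)
        also have "\<dots> = ennreal A * ennreal_rpow (\<Phi> r \<zeta>) s"
          unfolding A_def by (rule ennreal_rpow_mult[OF K'])
        finally show ?thesis using True by simp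
      qed simp
    qed
    also have "\<dots> = ennreal A * (\<integral>\<^sup>+\<zeta>\<in>ball \<xi> (r / 2). ennreal_rpow (\<Phi> r \<zeta>) s \<partial>lborel)"
      using ball_borel by (intro nn_integral_cmult) measurable
    finally have "ennreal (1 / B) * (ennreal_rpow (\<Phi> (r / 2) \<xi>) s * ennreal B) \<le>
        ennreal (1 / B) * (ennreal A * (\<integral>\<^sup>+\<zeta>\<in>ball \<xi> (r / 2). ennreal_rpow (\<Phi> r \<zeta>) s \<partial>lborel))"
      by (intro mult_left_mono) simp_all
    moreover have "ennreal (1 / B) * (ennreal_rpow (\<Phi> (r / 2) \<xi>) s * ennreal B) = ennreal_rpow (\<Phi> (r / 2) \<xi>) s"
    proof -
      have "ennreal (1 / B) * ennreal B = 1" using B_pos by (simp flip: ennreal_mult)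
      then show ?thesis by (metis mult.commute mult.left_commute mult.right_neutral)
    qed
    moreover have "ennreal (1 / B) * ennreal A = ennreal (A / B)"
      using A_pos B_pos by (simp flip: ennreal_mult)
    ultimately show ?thesis by (simp only: mult.assoc[symmetric])
  qed
  then show ?thesis using A_pos B_pos by (intro exI[of _ "A / B"]) auto
qed

text \<open>The powers of \<Phi> are the density of a finite measure \<nu>, so the disks that drift
  to infinity have \<nu>-mass tending to 0. The halved radius is harmless, as compactness may be
  deduced from any admissible radius.\<close>

lemma vanishes_if_in_Lp:
  assumes r: "0 < r" "r \<le> h" and s: "1 \<le> s"
    and Lp: "(\<integral>\<^sup>+\<zeta>. ennreal_rpow (\<Phi> r \<zeta>) s \<partial>lborel) < \<infinity>"
  shows "vanishes_at_infinity (\<Phi> (r / 2))"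
proof -
  obtain C where C: "C > 0" "\<And>\<xi>. ennreal_rpow (\<Phi> (r / 2) \<xi>) s \<le> ennreal C * (\<integral>\<^sup>+\<zeta>\<in>ball \<xi> (r / 2). ennreal_rpow (\<Phi> r \<zeta>) s \<partial>lborel)"
    using \<Phi>_half_average[OF r s] by blast
  define \<nu> where "\<nu> = density lborel (\<lambda>\<zeta>. ennreal_rpow (\<Phi> r \<zeta>) s)"
  have \<nu>: "emeasure \<nu> E = (\<integral>\<^sup>+\<zeta>\<in>E. ennreal_rpow (\<Phi> r \<zeta>) s \<partial>lborel)" if "E \<in> sets borel" for E
    using that unfolding \<nu>_def by (simp add: emeasure_density)
  have sets: "sets \<nu> = sets borel" by (simp add: \<nu>_def)
  have fin: "emeasure \<nu> E < \<infinity>" if "E \<in> sets borel" for E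
  proof -
    have "emeasure \<nu> E \<le> (\<integral>\<^sup>+\<zeta>. ennreal_rpow (\<Phi> r \<zeta>) s \<partial>lborel)"
      unfolding \<nu>[OF that] by (intro nn_integral_mono) (auto simp: indicator_def)
    then show ?thesis using Lp by (rule le_less_trans)
  qed
  have C': "ennreal_rpow (\<Phi> (r / 2) \<xi>) s \<le> ennreal C * emeasure \<nu> (ball \<xi> (r / 2))" for \<xi>
    using C(2)[of \<xi>] by (simp add: \<nu>)
  have finite: "\<Phi> (r / 2) \<xi> < \<infinity>" for \<xi>
  proof (rule ccontr)
    assume "\<not> \<Phi> (r / 2) \<xi> < \<infinity>"
    then have "ennreal_rpow (\<Phi> (r / 2) \<xi>) s = \<infinity>" by (simp add: ennreal_rpow_def not_less top_unique)
    moreover have "ennreal C * emeasure \<nu> (ball \<xi> (r / 2)) < \<infinity>" using fin by (simp add: ennreal_mult_less_top)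
    ultimately show False using C'[of \<xi>] by (simp add: top_unique)
  qed
  have tail: "(\<lambda>n. emeasure \<nu> (- ball 0 (real n))) \<longlonglongrightarrow> 0"
  proof -
    have "(\<lambda>n. emeasure \<nu> (- ball 0 (real n))) \<longlonglongrightarrow> emeasure \<nu> (\<Inter>n. - ball 0 (real n))"
    proof (rule Lim_emeasure_decseq)
      show "range (\<lambda>n. - ball (0::complex) (real n)) \<subseteq> sets \<nu>" by (auto simp: sets)
      show "decseq (\<lambda>n. - ball (0::complex) (real n))" by (auto simp: decseq_def)
      show "emeasure \<nu> (- ball 0 (real n)) \<noteq> \<infinity>" for n using fin[of "- ball 0 (real n)"] by simp
    qed
    moreover have "(\<Inter>n. - ball (0::complex) (real n)) = {}"
    proof (rule equals0I)
      fix x :: complex assume x: "x \<in> (\<Inter>n. - ball 0 (real n))"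
      obtain n where "cmod x < real n" using reals_Archimedean2 by blast
      then show False using x by auto
    qed
    ultimately show ?thesis by simp
  qed
  have "(\<Phi> (r / 2) \<longlongrightarrow> 0) at_infinity"
    unfolding order_tendsto_iff
  proof (intro conjI allI impI)
    fix \<epsilon> :: ennreal assume \<epsilon>: "\<epsilon> > 0"
    \<comment> \<open>The threshold \<epsilon> may be infinite; capping it at 1 gives a positive
      real to work with.\<close>
    define e where "e = enn2real (min \<epsilon> 1)"
    have "min \<epsilon> 1 < \<infinity>" by (simp add: min_less_iff_disj)
    then have e: "ennreal e = min \<epsilon> 1" by (simp only: e_def ennreal_enn2real infinity_ennreal_def)
    have e_pos: "0 < e"
    proof -
      have "0 < ennreal e" using \<epsilon> e by simp
      then show ?thesis by simp
    qed
    have "\<forall>\<^sub>F n in sequentially. emeasure \<nu> (- ball 0 (real n)) < ennreal (e powr s / C)"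
      using order_tendstoD(2)[OF tail] e_pos C(1) by simp
    then obtain n where n: "emeasure \<nu> (- ball 0 (real n)) < ennreal (e powr s / C)"
      by (auto simp: eventually_sequentially)
    have "\<Phi> (r / 2) \<xi> < \<epsilon>" if \<xi>: "real n + r \<le> cmod \<xi>" for \<xi>
    proof -
      have sub: "ball \<xi> (r / 2) \<subseteq> - ball 0 (real n)"
      proof
        fix x assume "x \<in> ball \<xi> (r / 2)"
        then have "cmod (\<xi> - x) < r / 2" by (simp add: dist_norm)
        moreover have "cmod \<xi> \<le> cmod x + cmod (\<xi> - x)" using norm_triangle_ineq[of x "\<xi> - x"] by simp
        ultimately show "x \<in> - ball 0 (real n)" using \<xi> r by simp
      qed
      have "ennreal_rpow (\<Phi> (r / 2) \<xi>) s \<le> ennreal C * emeasure \<nu> (- ball 0 (real n))"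
      proof -
        have "emeasure \<nu> (ball \<xi> (r / 2)) \<le> emeasure \<nu> (- ball 0 (real n))"
          by (rule emeasure_mono[OF sub]) (simp add: sets)
        from order_trans[OF C'[of \<xi>] mult_left_mono[OF this zero_le]] show ?thesis .
      qed
      also have "\<dots> < ennreal C * ennreal (e powr s / C)"
        using n C(1) by (intro ennreal_mult_strict_left_mono) auto
      also have "\<dots> = ennreal (e powr s)" using C(1) by (simp flip: ennreal_mult)
      finally have lt: "ennreal_rpow (\<Phi> (r / 2) \<xi>) s < ennreal_rpow (ennreal e) s"
        using e_pos by (simp add: ennreal_rpow_ennreal)
      have "\<Phi> (r / 2) \<xi> < ennreal e"
      proof (rule ccontr)
        assume "\<not> \<Phi> (r / 2) \<xi> < ennreal e"
        then have "ennreal_rpow (ennreal e) s \<le> ennreal_rpow (\<Phi> (r / 2) \<xi>) s"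
          using s by (intro ennreal_rpow_mono) (auto simp: not_less)
        then show False using lt by simp
      qed
      then show ?thesis using e by (metis min.strict_boundedE)
    qed
    then show "\<forall>\<^sub>F \<xi> in at_infinity. \<Phi> (r / 2) \<xi> < \<epsilon>" by (auto simp: eventually_at_infinity)
  qed simp
  then show ?thesis using finite by (simp add: vanishes_at_infinity_def)
qed

lemma singular_values_sv:
  assumes comp: compact_W and adj: "is_adjoint_on F ipF W S"
  shows "singular_values_on F ipF W (compact_operator.sv fun_scale F ipF W S)"
proof -
  interpret co: compact_operator fun_scale F ipF W S using assms by (rule compact_operator_W)
  show ?thesis
    unfolding singular_values_on_def
  proof (intro conjI exI allI impI)
    show "decseq co.sv" by (simp add: decseq_def co.sv_antimono)
    show "is_adjoint_on F ipF W S" by (rule adj)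
  qed (simp_all only: co.sv_nonneg co.sv_level_finite co.dim_eigenspace)
qed

text \<open>The given singular values and the greedy ones for the same adjoint have equal
  multiplicities, both being the dimensions of the same eigenspaces.\<close>

lemma summable_sv_if_schatten:
  assumes "schatten_W p"
  shows "\<exists>S. is_adjoint_on F ipF W S \<and> summable (\<lambda>n. compact_operator.sv fun_scale F ipF W S n powr p)"
proof -
  obtain s S where comp: compact_W and adj: "is_adjoint_on F ipF W S" and nn: "\<And>n. 0 \<le> s n"
    and mult: "\<And>t. t > 0 \<Longrightarrow> finite {n. s n = t} \<and>
         card {n. s n = t} = fs.dim {f \<in> F. S (W f) = fun_scale (complex_of_real (t\<^sup>2)) f}"
    and sum: "summable (\<lambda>n. s n powr p)"
    using assms unfolding schatten_W_def singular_values_on_def by blast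
  interpret co: compact_operator fun_scale F ipF W S using comp adj by (rule compact_operator_W)
  have "summable (\<lambda>n. co.sv n powr p)"
    using nn co.sv_nonneg _ sum
  proof (rule summable_equal_multiplicities)
    fix x :: real assume "0 < x"
    then show "finite {n. s n = x} \<and> card {n. co.sv n = x} = card {n. s n = x} \<and> finite {n. co.sv n = x}"
      using mult[of x] co.dim_eigenspace[of x] co.sv_level_finite[of x] by simp
  qed
  then show ?thesis using adj by blast
qed

text \<open>\<open>lower_bound\<close> and the singular value expansion bound \<Phi>(z) by a sum of
  squared singular values weighted by |<t_z, e_j>|^2, t_z being the test function. Jensen moves the
  power p/2 onto the singular values, and integrating over z costs a factor independent of
  j.\<close>

theorem in_Lp_if_schatten:
  assumes r: "0 < r" "r \<le> h" and p: "2 \<le> p" and sch: "schatten_W p"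
  shows "(\<integral>\<^sup>+z. ennreal_rpow (\<Phi> r z) (p / 2) \<partial>lborel) < \<infinity>"
proof -
  define s where "s = p / 2"
  have s: "1 \<le> s" using p by (simp add: s_def)
  have comp: compact_W using sch by (simp add: schatten_W_def)
  obtain S where adj: "is_adjoint_on F ipF W S"
    and sum: "summable (\<lambda>n. compact_operator.sv fun_scale F ipF W S n powr p)"
    using summable_sv_if_schatten[OF sch] by blast
  interpret co: compact_operator fun_scale F ipF W S using comp adj by (rule compact_operator_W)
  have e_F: "co.svec j \<in> F" for j by (rule co.vec_H)
  have [measurable]: "co.svec j \<in> borel_measurable borel" for j by (rule F_measurable[OF e_F])
  have [measurable]: "test_fun z \<in> borel_measurable borel" for z by (rule holomorphic_measurable[OF test_fun_holomorphic])
  obtain D where D: "D > 0" "\<And>z. test_fun z \<in> F" "\<And>z. fs.nrm (test_fun z) \<le> D"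
    using test_fun_energy by blast
  obtain G where G: "G > 0" "\<And>z. (\<integral>\<^sup>+\<xi>. ennreal (exp (- (\<alpha> / 2) * (dist \<xi> z)\<^sup>2)) \<partial>M) \<le> ennreal (G * V z)"
    using gaussian_integral_le[of "\<alpha> / 2"] \<alpha>_pos by auto
  \<comment> \<open>A Gaussian average of the density |e_j|^2 e^{-\<alpha>|.|^2} around
    \<open>z\<close>. It dominates the squared coefficients and, unlike them, can be integrated over
    \<open>z\<close> by Fubini.\<close>
  define B where "B = (\<lambda>j z. \<integral>\<^sup>+\<xi>. ennreal (exp (- (\<alpha> / 2) * (dist \<xi> z)\<^sup>2) * ((cmod (co.svec j \<xi>))\<^sup>2 * gs \<xi>)) \<partial>M)"
  have B_meas [measurable]: "B j \<in> borel_measurable borel" for j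
  proof -
    have "(\<lambda>p. ennreal (exp (- (\<alpha> / 2) * (dist (snd p) (fst p))\<^sup>2) * ((cmod (co.svec j (snd p)))\<^sup>2 * gs (snd p)))) \<in> borel_measurable (borel \<Otimes>\<^sub>M M)"
      by measurable
    from borel_measurable_nn_integral_fst[OF this] show ?thesis by (simp add: B_def)
  qed
  \<comment> \<open>Schur test: the Gaussian is split evenly between the two factors of the Cauchy-Schwarz inequality.\<close>
  have coeff: "ennreal ((cmod (ipF (test_fun z) (co.svec j)))\<^sup>2) \<le> ennreal G * B j z" for j z
  proof -
    define a where "a \<xi> = exp (- (\<alpha> / 4) * (dist \<xi> z)\<^sup>2)" for \<xi>
    have [measurable]: "a \<in> borel_measurable borel" unfolding a_def by measurable
    have a2: "(a \<xi>)\<^sup>2 = exp (- (\<alpha> / 2) * (dist \<xi> z)\<^sup>2)" for \<xi>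
      unfolding a_def by (simp flip: exp_double)
    have tf: "cmod (test_fun z \<xi>) * sqrt (gs \<xi>) = (a \<xi>)\<^sup>2 / sqrt (V z)" for \<xi>
    proof -
      have "cmod (test_fun z \<xi>) * sqrt (gs \<xi>) = sqrt ((cmod (test_fun z \<xi>))\<^sup>2 * gs \<xi>)"
        by (simp add: real_sqrt_mult)
      also have "\<dots> = sqrt (exp (- \<alpha> * (dist \<xi> z)\<^sup>2) / V z)" by (simp only: test_fun_abs)
      also have "exp (- \<alpha> * (dist \<xi> z)\<^sup>2) = ((a \<xi>)\<^sup>2)\<^sup>2" unfolding a2 by (simp flip: exp_double)
      finally show ?thesis by (simp only: real_sqrt_divide real_sqrt_abs) simp
    qed
    have "ennreal (cmod (ipF (test_fun z) (co.svec j))) \<le> (\<integral>\<^sup>+\<xi>. ennreal (cmod (test_fun z \<xi> * cnj (co.svec j \<xi>) * of_real (gs \<xi>))) \<partial>M)"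
      unfolding ipF_def[of "test_fun z" "co.svec j"] by (rule integral_norm_bound_ennreal[OF integrable_ip[OF D(2) e_F]])
    also have "\<dots> = (\<integral>\<^sup>+\<xi>. ennreal (a \<xi> / sqrt (V z)) * ennreal (a \<xi> * (cmod (co.svec j \<xi>) * sqrt (gs \<xi>))) \<partial>M)"
    proof (rule nn_integral_cong)
      fix \<xi>
      have "cmod (test_fun z \<xi> * cnj (co.svec j \<xi>) * of_real (gs \<xi>))
        = (cmod (test_fun z \<xi>) * sqrt (gs \<xi>)) * (cmod (co.svec j \<xi>) * sqrt (gs \<xi>))"
        by (simp add: norm_mult)
      also have "\<dots> = (a \<xi> / sqrt (V z)) * (a \<xi> * (cmod (co.svec j \<xi>) * sqrt (gs \<xi>)))"
        unfolding tf by (simp add: power2_eq_square)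
      finally show "ennreal (cmod (test_fun z \<xi> * cnj (co.svec j \<xi>) * of_real (gs \<xi>)))
        = ennreal (a \<xi> / sqrt (V z)) * ennreal (a \<xi> * (cmod (co.svec j \<xi>) * sqrt (gs \<xi>)))"
        using V_pos[of z] by (simp add: a_def flip: ennreal_mult)
    qed
    finally have "(ennreal (cmod (ipF (test_fun z) (co.svec j))))\<^sup>2
      \<le> (\<integral>\<^sup>+\<xi>. ennreal (a \<xi> / sqrt (V z)) * ennreal (a \<xi> * (cmod (co.svec j \<xi>) * sqrt (gs \<xi>))) \<partial>M)\<^sup>2"
      by (rule power_mono) simp
    also have "\<dots> \<le> (\<integral>\<^sup>+\<xi>. (ennreal (a \<xi> / sqrt (V z)))\<^sup>2 \<partial>M) * (\<integral>\<^sup>+\<xi>. (ennreal (a \<xi> * (cmod (co.svec j \<xi>) * sqrt (gs \<xi>))))\<^sup>2 \<partial>M)"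
      by (rule Cauchy_Schwarz_nn_integral) measurable
    also have "(\<integral>\<^sup>+\<xi>. (ennreal (a \<xi> * (cmod (co.svec j \<xi>) * sqrt (gs \<xi>))))\<^sup>2 \<partial>M) = B j z"
    proof -
      have "(ennreal (a \<xi> * (cmod (co.svec j \<xi>) * sqrt (gs \<xi>))))\<^sup>2
          = ennreal (exp (- (\<alpha> / 2) * (dist \<xi> z)\<^sup>2) * ((cmod (co.svec j \<xi>))\<^sup>2 * gs \<xi>))" for \<xi>
        unfolding a2[symmetric] by (subst ennreal_power) (simp_all add: power_mult_distrib a_def)
      then show ?thesis unfolding B_def by simp
    qed
    also have "(\<integral>\<^sup>+\<xi>. (ennreal (a \<xi> / sqrt (V z)))\<^sup>2 \<partial>M) = (\<integral>\<^sup>+\<xi>. ennreal (1 / V z) * ennreal (exp (- (\<alpha> / 2) * (dist \<xi> z)\<^sup>2)) \<partial>M)"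
    proof -
      have "(ennreal (a \<xi> / sqrt (V z)))\<^sup>2 = ennreal (1 / V z) * ennreal (exp (- (\<alpha> / 2) * (dist \<xi> z)\<^sup>2))" for \<xi>
        unfolding a2[symmetric] using V_pos[of z]
        by (subst ennreal_power) (simp_all add: power_divide a_def less_imp_le flip: ennreal_mult)
      then show ?thesis by simp
    qed
    also have "\<dots> = ennreal (1 / V z) * (\<integral>\<^sup>+\<xi>. ennreal (exp (- (\<alpha> / 2) * (dist \<xi> z)\<^sup>2)) \<partial>M)"
      by (rule nn_integral_cmult) measurable
    also have "\<dots> \<le> ennreal (1 / V z) * ennreal (G * V z)" by (intro mult_left_mono G) simp
    also have "\<dots> = ennreal G" using V_pos[of z] G(1) by (simp flip: ennreal_mult)
    finally show ?thesis by (simp add: ennreal_power mult_right_mono)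
  qed
  have pw: "ennreal_rpow (\<Phi> r z) s \<le> ennreal (Q r powr s * (D\<^sup>2) powr (s - 1) * G) * (\<Sum>j. ennreal (co.sv j powr p) * B j z)" for z
  proof -
    define b where "b j = (cmod (ipF (test_fun z) (co.svec j)))\<^sup>2" for j
    define x where "x = (fs.nrm (W (test_fun z)))\<^sup>2"
    have sums: "(\<lambda>j. (co.sv j)\<^sup>2 * b j) sums x"
      unfolding b_def x_def by (rule co.T_expansion[OF D(2)])
    \<comment> \<open>The sum is read as an integral over the counting measure; the coefficients are
      the weights, with total mass at most \<open>D\<close>^2 by Bessel.\<close>
    have "ennreal (x powr s) \<le> ennreal ((D\<^sup>2) powr (s - 1)) * (\<integral>\<^sup>+j. ennreal (b j) * ennreal_rpow (ennreal ((co.sv j)\<^sup>2)) s \<partial>count_space UNIV)"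
    proof (rule jensen_rpow)
      show "(\<integral>\<^sup>+j. ennreal (b j) \<partial>count_space UNIV) \<le> ennreal (D\<^sup>2)"
        unfolding nn_integral_count_space_nat
      proof (rule suminf_le_const)
        show "(\<Sum>j<n. ennreal (b j)) \<le> ennreal (D\<^sup>2)" for n
        proof -
          have "(\<Sum>j<n. b j) \<le> (fs.nrm (test_fun z))\<^sup>2" unfolding b_def by (rule co.Bessel(1)[OF D(2)])
          also have "\<dots> \<le> D\<^sup>2" using D(3)[of z] fs.nrm_nonneg[OF D(2)] by (intro power_mono) auto
          finally show ?thesis by (simp add: sum_ennreal b_def ennreal_leI)
        qed
      qed simp
      show "(\<integral>\<^sup>+j. ennreal (b j) * ennreal ((co.sv j)\<^sup>2) \<partial>count_space UNIV) = ennreal x"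
        unfolding nn_integral_count_space_nat
      proof (rule sums_unique[symmetric])
        have "(\<lambda>j. ennreal ((co.sv j)\<^sup>2 * b j)) sums ennreal x"
          using sums by (subst sums_ennreal) (auto simp: b_def x_def)
        then show "(\<lambda>j. ennreal (b j) * ennreal ((co.sv j)\<^sup>2)) sums ennreal x"
          by (simp add: ennreal_mult b_def mult.commute)
      qed
    qed (use D s in \<open>simp_all add: x_def\<close>)
    also have "(\<integral>\<^sup>+j. ennreal (b j) * ennreal_rpow (ennreal ((co.sv j)\<^sup>2)) s \<partial>count_space UNIV)
      \<le> (\<integral>\<^sup>+j. ennreal G * (ennreal (co.sv j powr p) * B j z) \<partial>count_space UNIV)"
    proof (rule nn_integral_mono)
      fix j
      have "ennreal_rpow (ennreal ((co.sv j)\<^sup>2)) s = ennreal (co.sv j powr p)"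
        using co.sv_nonneg[of j] p by (cases "co.sv j = 0")
          (simp_all add: ennreal_rpow_ennreal ennreal_rpow_def s_def powr_powr flip: powr_numeral)
      then show "ennreal (b j) * ennreal_rpow (ennreal ((co.sv j)\<^sup>2)) s \<le> ennreal G * (ennreal (co.sv j powr p) * B j z)"
        using mult_right_mono[OF coeff[of z j], of "ennreal (co.sv j powr p)"] by (simp add: b_def mult_ac)
    qed
    also have "\<dots> = ennreal G * (\<Sum>j. ennreal (co.sv j powr p) * B j z)"
      by (simp add: nn_integral_cmult nn_integral_count_space_nat)
    finally have x_le: "ennreal (x powr s) \<le> ennreal ((D\<^sup>2) powr (s - 1)) * (ennreal G * (\<Sum>j. ennreal (co.sv j powr p) * B j z))"
      by (simp add: mult_left_mono)
    have "ennreal_rpow (\<Phi> r z) s \<le> ennreal_rpow (ennreal (Q r) * ennreal x) s"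
      using lower_bound[OF r, of z] s D(2)[of z] co.T_H by (intro ennreal_rpow_mono) (simp_all add: x_def nrm_energy)
    also have "\<dots> = ennreal (Q r powr s) * ennreal (x powr s)"
      using Q_pos[OF r(1)] by (simp add: ennreal_rpow_mult ennreal_rpow_ennreal x_def)
    also have "\<dots> \<le> ennreal (Q r powr s) * (ennreal ((D\<^sup>2) powr (s - 1)) * (ennreal G * (\<Sum>j. ennreal (co.sv j powr p) * B j z)))"
      by (intro mult_left_mono x_le) simp
    also have "\<dots> = ennreal (Q r powr s * (D\<^sup>2) powr (s - 1) * G) * (\<Sum>j. ennreal (co.sv j powr p) * B j z)"
      using G(1) by (simp add: ennreal_mult mult.assoc)
    finally show ?thesis .
  qed
  define J where "J = (\<integral>\<^sup>+(z::complex). ennreal (exp (- (\<alpha> / 2) * (cmod z)\<^sup>2)) \<partial>lborel)"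
  have J: "J < \<infinity>" unfolding J_def using \<alpha>_pos by (intro nn_integral_gaussian_finite) simp
  \<comment> \<open>After the exchange of integrals the Gaussian is integrated against Lebesgue
    measure, with a value independent of its centre; what remains is the energy of a vector of norm
    at most 1.\<close>
  have B_int: "(\<integral>\<^sup>+z. B j z \<partial>lborel) \<le> J" for j
  proof -
    have "(\<integral>\<^sup>+z. B j z \<partial>lborel) = (\<integral>\<^sup>+\<xi>. (\<integral>\<^sup>+z. ennreal (exp (- (\<alpha> / 2) * (dist \<xi> z)\<^sup>2) * ((cmod (co.svec j \<xi>))\<^sup>2 * gs \<xi>)) \<partial>lborel) \<partial>M)"
    proof -
      interpret pair_sigma_finite lborel M ..
      show ?thesis unfolding B_def by (rule Fubini'[symmetric]) measurable
    qed
    also have "\<dots> = (\<integral>\<^sup>+\<xi>. J * ennreal ((cmod (co.svec j \<xi>))\<^sup>2 * gs \<xi>) \<partial>M)"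
    proof (rule nn_integral_cong)
      fix \<xi> :: complex
      have "(\<integral>\<^sup>+z. ennreal (exp (- (\<alpha> / 2) * (dist \<xi> z)\<^sup>2)) \<partial>lborel) = J"
        unfolding J_def by (subst lborel_distr_plus[of "\<xi>", symmetric])
          (simp add: nn_integral_distr dist_norm)
      moreover have "(\<integral>\<^sup>+z. ennreal (exp (- (\<alpha> / 2) * (dist \<xi> z)\<^sup>2) * ((cmod (co.svec j \<xi>))\<^sup>2 * gs \<xi>)) \<partial>lborel)
         = (\<integral>\<^sup>+z. ennreal (exp (- (\<alpha> / 2) * (dist \<xi> z)\<^sup>2)) \<partial>lborel) * ennreal ((cmod (co.svec j \<xi>))\<^sup>2 * gs \<xi>)"
        by (subst nn_integral_multc[symmetric]) (simp_all add: ennreal_mult)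
      ultimately show "(\<integral>\<^sup>+z. ennreal (exp (- (\<alpha> / 2) * (dist \<xi> z)\<^sup>2) * ((cmod (co.svec j \<xi>))\<^sup>2 * gs \<xi>)) \<partial>lborel)
         = J * ennreal ((cmod (co.svec j \<xi>))\<^sup>2 * gs \<xi>)" by simp
    qed
    also have "\<dots> = J * energy (co.svec j)"
      unfolding energy_def by (rule nn_integral_cmult) measurable
    also have "\<dots> \<le> J * 1"
    proof (rule mult_left_mono)
      have "fs.nrm (co.svec j) \<le> 1"
        using co.vec_pos(2)[of j] co.vec_zero[of j] by (cases "0 < co.sv j") auto
      then show "energy (co.svec j) \<le> 1" using nrm_le_iff[OF e_F, of 1 j] by simp
    qed simp
    finally show ?thesis by simp
  qed
  let ?C = "Q r powr s * (D\<^sup>2) powr (s - 1) * G"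
  have "(\<integral>\<^sup>+z. ennreal_rpow (\<Phi> r z) s \<partial>lborel) \<le> (\<integral>\<^sup>+z. ennreal ?C * (\<Sum>j. ennreal (co.sv j powr p) * B j z) \<partial>lborel)"
    by (intro nn_integral_mono pw)
  also have "\<dots> = ennreal ?C * (\<Sum>j. ennreal (co.sv j powr p) * (\<integral>\<^sup>+z. B j z \<partial>lborel))"
    by (simp add: nn_integral_cmult nn_integral_suminf)
  also have "\<dots> \<le> ennreal ?C * (\<Sum>j. ennreal (co.sv j powr p) * J)"
    by (intro mult_left_mono suminf_le) (auto intro!: mult_left_mono B_int)
  also have "\<dots> = ennreal ?C * (ennreal (\<Sum>j. co.sv j powr p) * J)"
    using sum by (simp add: suminf_ennreal2)
  also have "\<dots> < \<infinity>" using J by (simp add: ennreal_mult_less_top)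
  finally show ?thesis by (simp add: s_def)
qed

text \<open>The values of the singular vectors at \<open>z\<close> are, up to conjugation, the
  coefficients of the reproducing kernel at \<open>z\<close>. Bessel's inequality bounds their
  squares by its squared norm.\<close>

lemma sum_orthonormal_le:
  assumes comp: compact_W and adj: "is_adjoint_on F ipF W S"
  shows "(\<Sum>j<n. (cmod (compact_operator.svec fun_scale F ipF W S j z))\<^sup>2) * gs z \<le> P h / V z"
proof -
  interpret co: compact_operator fun_scale F ipF W S using assms by (rule compact_operator_W)
  obtain k where k: "k \<in> F" "\<And>f. f \<in> F \<Longrightarrow> f z = ipF f k" "(fs.nrm k)\<^sup>2 \<le> P h / (gs z * V z)"
    using kernel_exists[of z] by blast
  have "(\<Sum>j<n. (cmod (co.svec j z))\<^sup>2) = (\<Sum>j<n. (cmod (ipF k (co.svec j)))\<^sup>2)"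
  proof (rule sum.cong[OF refl])
    fix j
    have "cmod (co.svec j z) = cmod (cnj (ipF k (co.svec j)))"
      unfolding fs.ip_cnj[OF k(1) co.vec_H] by (simp only: k(2)[OF co.vec_H])
    then show "(cmod (co.svec j z))\<^sup>2 = (cmod (ipF k (co.svec j)))\<^sup>2" by simp
  qed
  also have "\<dots> \<le> (fs.nrm k)\<^sup>2" by (rule co.Bessel(1)[OF k(1)])
  also note k(3)
  finally have "(\<Sum>j<n. (cmod (co.svec j z))\<^sup>2) * gs z \<le> P h / (gs z * V z) * gs z"
    by (rule mult_right_mono) simp
  then show ?thesis by simp
qed

text \<open>A singular value is the norm of the image of its unit vector, which
  \<open>upper_bound\<close> estimates by the mean of \<Phi> for the probability measure given by
  that vector. Jensen then takes the power p/2 inside.\<close>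

lemma sv_power_le:
  assumes comp: compact_W and adj: "is_adjoint_on F ipF W S" and r: "0 < r" "r \<le> h" and p: "2 \<le> p"
  defines "sv \<equiv> compact_operator.sv fun_scale F ipF W S" and "e \<equiv> compact_operator.svec fun_scale F ipF W S"
  shows "ennreal (sv j powr p) \<le> ennreal ((P r * K) powr (p / 2)) *
    (\<integral>\<^sup>+\<zeta>. ennreal ((cmod (e j \<zeta>))\<^sup>2 * gs \<zeta>) * ennreal_rpow (\<Phi> r \<zeta>) (p / 2) \<partial>M)"
proof -
  interpret co: compact_operator fun_scale F ipF W S using comp adj by (rule compact_operator_W)
  define s where "s = p / 2"
  have s: "1 \<le> s" using p by (simp add: s_def)
  show ?thesis
  proof (cases "0 < co.sv j")
    case False
    then have "co.sv j = 0" using co.sv_nonneg[of j] by simp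
    then show ?thesis using p by (simp add: sv_def)
  next
    case True
    have eF: "co.svec j \<in> F" by (rule co.vec_H)
    have [measurable]: "co.svec j \<in> borel_measurable borel" by (rule F_measurable[OF eF])
    let ?a = "\<lambda>\<zeta>. ennreal ((cmod (co.svec j \<zeta>))\<^sup>2 * gs \<zeta>)"
    \<comment> \<open>Boundedness of \<Phi> makes its mean finite, as \<open>jensen_rpow\<close>
      requires a real mean.\<close>
    obtain S' where S': "0 \<le> S'" "\<And>z. \<Phi> r z \<le> ennreal S'"
      using \<Phi>_bounded_if_vanishes[OF r vanishes_if_compact[OF r comp]] by blast
    have mass: "(\<integral>\<^sup>+\<zeta>. ?a \<zeta> \<partial>M) = ennreal 1"
      using nrm_energy[OF eF] co.vec_pos(2)[OF True] by (simp add: energy_def)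
    have "(\<integral>\<^sup>+\<zeta>. ?a \<zeta> * \<Phi> r \<zeta> \<partial>M) \<le> (\<integral>\<^sup>+\<zeta>. ?a \<zeta> * ennreal S' \<partial>M)"
      by (intro nn_integral_mono mult_left_mono S') simp
    also have "\<dots> = (\<integral>\<^sup>+\<zeta>. ?a \<zeta> \<partial>M) * ennreal S'" by (rule nn_integral_multc) measurable
    also have "\<dots> < \<infinity>" unfolding mass by (simp add: ennreal_mult_less_top)
    finally have fin: "(\<integral>\<^sup>+\<zeta>. ?a \<zeta> * \<Phi> r \<zeta> \<partial>M) < \<infinity>" .
    define x where "x = enn2real (\<integral>\<^sup>+\<zeta>. ?a \<zeta> * \<Phi> r \<zeta> \<partial>M)"
    have x: "(\<integral>\<^sup>+\<zeta>. ?a \<zeta> * \<Phi> r \<zeta> \<partial>M) = ennreal x" "0 \<le> x"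
      using fin by (simp_all add: x_def)
    have PK: "0 < P r * K" using P_pos[OF r(1)] K_pos by simp
    have "ipF (W (co.svec j)) (W (co.svec j)) = of_real ((co.sv j)\<^sup>2)"
      using True by (simp only: co.adj co.vec_H co.T_H co.ST_vec fs.ip_scale_right co.ip_vec) simp
    then have "(fs.nrm (W (co.svec j)))\<^sup>2 = (co.sv j)\<^sup>2" using fs.nrm_sq[OF co.T_H[OF eF]] by simp
    then have "ennreal ((co.sv j)\<^sup>2) = energy (W (co.svec j))" using nrm_energy[OF co.T_H[OF eF]] by simp
    also have "\<dots> \<le> ennreal (P r * K) * ennreal x"
      using upper_bound[OF F_D(1)[OF eF] r] unfolding x(1) .
    also have "\<dots> = ennreal (P r * K * x)" using PK x(2) by (simp add: ennreal_mult)
    finally have "(co.sv j)\<^sup>2 \<le> P r * K * x" using PK x(2) by (subst (asm) ennreal_le_iff) auto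
    then have "((co.sv j)\<^sup>2) powr s \<le> (P r * K * x) powr s" using s by (intro powr_mono2) auto
    moreover have "((co.sv j)\<^sup>2) powr s = co.sv j powr p"
      using True by (simp add: s_def powr_powr flip: powr_numeral)
    moreover have "(P r * K * x) powr s = (P r * K) powr s * x powr s" using PK x(2) by (simp add: powr_mult)
    ultimately have "ennreal (co.sv j powr p) \<le> ennreal ((P r * K) powr s * x powr s)" by (intro ennreal_leI) simp
    also have "\<dots> = ennreal ((P r * K) powr s) * ennreal (x powr s)" by (rule ennreal_mult) auto
    also have "\<dots> \<le> ennreal ((P r * K) powr s) * (ennreal (1 powr (s - 1)) * (\<integral>\<^sup>+\<zeta>. ?a \<zeta> * ennreal_rpow (\<Phi> r \<zeta>) s \<partial>M))"
      using s x mass by (intro mult_left_mono jensen_rpow) simp_all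
    finally show ?thesis by (simp add: sv_def e_def s_def)
  qed
qed

text \<open>Summing \<open>sv_power_le\<close> replaces the singular vectors by the kernel bound P h
  / V and leaves the integral of \<Phi>^(p/2) / V against \<open>M\<close>. Bounding each value by a
  local Lebesgue integral and exchanging the integrals, the mass of a disk cancels 1/V.\<close>

theorem schatten_if_in_Lp:
  assumes r: "0 < r" "r \<le> h" and p: "2 \<le> p"
    and Lp: "(\<integral>\<^sup>+z. ennreal_rpow (\<Phi> r z) (p / 2) \<partial>lborel) < \<infinity>"
  shows "schatten_W p"
proof -
  define s where "s = p / 2"
  have s: "1 \<le> s" using p by (simp add: s_def)
  \<comment> \<open>The singular values are estimated at half the radius, so that
    \<open>\<Phi>_half_average\<close> can return to the radius of the hypothesis.\<close>
  define \<rho> where "\<rho> = r / 2"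
  have \<rho>: "0 < \<rho>" "\<rho> \<le> h" using r by (simp_all add: \<rho>_def)
  have comp: compact_W
    using compact_if_vanishes[OF \<rho>] vanishes_if_in_Lp[OF r s] Lp by (simp add: s_def \<rho>_def)
  obtain S where adj: "is_adjoint_on F ipF W S" using adjoint_exists[OF comp] by blast
  interpret co: compact_operator fun_scale F ipF W S using comp adj by (rule compact_operator_W)
  have [measurable]: "co.svec j \<in> borel_measurable borel" for j by (rule F_measurable[OF co.vec_H])
  obtain C where C: "C > 0" "\<And>\<xi>. ennreal_rpow (\<Phi> \<rho> \<xi>) s \<le> ennreal C * (\<integral>\<^sup>+\<zeta>\<in>ball \<xi> \<rho>. ennreal_rpow (\<Phi> r \<zeta>) s \<partial>lborel)"
    using \<Phi>_half_average[OF r s] unfolding \<rho>_def by blast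
  define A where "A = (P \<rho> * K) powr s"
  let ?G = "\<lambda>\<zeta>. ennreal_rpow (\<Phi> r \<zeta>) s"
  let ?I = "\<lambda>\<zeta> \<xi>. indicator {q. dist (fst q) (snd q) < \<rho>} (\<zeta>, \<xi>) :: ennreal"
  have I: "?I \<zeta> \<xi> = indicator (ball \<zeta> \<rho>) \<xi>" "?I \<zeta> \<xi> = indicator (ball \<xi> \<rho>) \<zeta>" for \<zeta> \<xi>
    by (auto simp: indicator_def dist_commute)
  have partial: "(\<Sum>j<n. ennreal (co.sv j powr p)) \<le> ennreal (A * (P h * C * K)) * (\<integral>\<^sup>+\<xi>. ?G \<xi> \<partial>lborel)" for n
  proof -
    have "(\<Sum>j<n. ennreal (co.sv j powr p)) \<le> (\<Sum>j<n. ennreal A * (\<integral>\<^sup>+\<zeta>. ennreal ((cmod (co.svec j \<zeta>))\<^sup>2 * gs \<zeta>) * ennreal_rpow (\<Phi> \<rho> \<zeta>) s \<partial>M))"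
      unfolding A_def s_def by (intro sum_mono sv_power_le[OF comp adj \<rho> p])
    also have "\<dots> = ennreal A * (\<integral>\<^sup>+\<zeta>. (\<Sum>j<n. ennreal ((cmod (co.svec j \<zeta>))\<^sup>2 * gs \<zeta>) * ennreal_rpow (\<Phi> \<rho> \<zeta>) s) \<partial>M)"
      by (subst nn_integral_sum) (simp_all add: sum_distrib_left)
    also have "\<dots> \<le> ennreal A * (\<integral>\<^sup>+\<zeta>. (\<integral>\<^sup>+\<xi>. ennreal (P h * C * (1 / V \<zeta>)) * (?G \<xi> * ?I \<zeta> \<xi>) \<partial>lborel) \<partial>M)"
    proof (intro mult_left_mono nn_integral_mono)
      fix \<zeta>
      have "(\<Sum>j<n. ennreal ((cmod (co.svec j \<zeta>))\<^sup>2 * gs \<zeta>) * ennreal_rpow (\<Phi> \<rho> \<zeta>) s)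
        = ennreal ((\<Sum>j<n. (cmod (co.svec j \<zeta>))\<^sup>2) * gs \<zeta>) * ennreal_rpow (\<Phi> \<rho> \<zeta>) s"
        by (simp add: sum_distrib_right[symmetric] sum_ennreal)
      also have "\<dots> \<le> ennreal (P h / V \<zeta>) * (ennreal C * (\<integral>\<^sup>+\<xi>. ?G \<xi> * ?I \<zeta> \<xi> \<partial>lborel))"
        unfolding I(1) by (intro mult_mono ennreal_leI sum_orthonormal_le[OF comp adj] C(2)) auto
      also have "\<dots> = ennreal (P h * C * (1 / V \<zeta>)) * (\<integral>\<^sup>+\<xi>. ?G \<xi> * ?I \<zeta> \<xi> \<partial>lborel)"
        using P_pos[OF h_pos] C(1) V_pos[of \<zeta>] by (simp add: mult.assoc[symmetric] flip: ennreal_mult)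
      also have "\<dots> = (\<integral>\<^sup>+\<xi>. ennreal (P h * C * (1 / V \<zeta>)) * (?G \<xi> * ?I \<zeta> \<xi>) \<partial>lborel)"
        unfolding I(1) using ball_borel by (intro nn_integral_cmult[symmetric]) measurable
      finally show "(\<Sum>j<n. ennreal ((cmod (co.svec j \<zeta>))\<^sup>2 * gs \<zeta>) * ennreal_rpow (\<Phi> \<rho> \<zeta>) s)
        \<le> (\<integral>\<^sup>+\<xi>. ennreal (P h * C * (1 / V \<zeta>)) * (?G \<xi> * ?I \<zeta> \<xi>) \<partial>lborel)" .
    qed simp
    also have "(\<integral>\<^sup>+\<zeta>. (\<integral>\<^sup>+\<xi>. ennreal (P h * C * (1 / V \<zeta>)) * (?G \<xi> * ?I \<zeta> \<xi>) \<partial>lborel) \<partial>M)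
      = (\<integral>\<^sup>+\<xi>. (\<integral>\<^sup>+\<zeta>. ennreal (P h * C * (1 / V \<zeta>)) * (?G \<xi> * ?I \<zeta> \<xi>) \<partial>M) \<partial>lborel)"
    proof -
      interpret pair_sigma_finite M lborel ..
      have "Measurable.pred (M \<Otimes>\<^sub>M lborel) (\<lambda>q. dist (fst q) (snd q) < \<rho>)" by measurable
      then have [measurable]: "(\<lambda>q. ?I (fst q) (snd q)) \<in> borel_measurable (M \<Otimes>\<^sub>M lborel)" by (simp add: indicator_def)
      have "(\<lambda>(\<zeta>, \<xi>). ennreal (P h * C * (1 / V \<zeta>)) * (?G \<xi> * ?I \<zeta> \<xi>)) \<in> borel_measurable (M \<Otimes>\<^sub>M lborel)"
        unfolding split_beta by measurable
      then show ?thesis by (rule Fubini'[symmetric])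
    qed
    also have "\<dots> \<le> (\<integral>\<^sup>+\<xi>. ennreal (P h * C * K) * ?G \<xi> \<partial>lborel)"
    proof (rule nn_integral_mono)
      fix \<xi>
      have "(\<integral>\<^sup>+\<zeta>. ennreal (P h * C * (1 / V \<zeta>)) * (?G \<xi> * ?I \<zeta> \<xi>) \<partial>M)
        \<le> (\<integral>\<^sup>+\<zeta>. (ennreal (P h * C * K / V \<xi>) * ?G \<xi>) * indicator (ball \<xi> \<rho>) \<zeta> \<partial>M)"
      proof (rule nn_integral_mono)
        fix \<zeta>
        show "ennreal (P h * C * (1 / V \<zeta>)) * (?G \<xi> * ?I \<zeta> \<xi>) \<le> (ennreal (P h * C * K / V \<xi>) * ?G \<xi>) * indicator (ball \<xi> \<rho>) \<zeta>"
        proof (cases "\<zeta> \<in> ball \<xi> \<rho>")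
          case True
          then have "V \<xi> \<le> K * V \<zeta>" using \<rho> by (intro V_le_near) (auto simp: dist_commute)
          then have "1 / V \<zeta> \<le> K / V \<xi>" using V_pos[of \<xi>] V_pos[of \<zeta>] by (simp add: field_simps)
          then have "P h * C * (1 / V \<zeta>) \<le> P h * C * (K / V \<xi>)"
            using P_pos[OF h_pos] C(1) by (intro mult_left_mono) auto
          then have "ennreal (P h * C * (1 / V \<zeta>)) \<le> ennreal (P h * C * K / V \<xi>)" by (intro ennreal_leI) simp
          then have "ennreal (P h * C * (1 / V \<zeta>)) * ?G \<xi> \<le> ennreal (P h * C * K / V \<xi>) * ?G \<xi>"
            by (rule mult_right_mono) simp
          then show ?thesis unfolding I(2) using True by simp
        qed (simp add: I(2))
      qed
      also have "\<dots> = (ennreal (P h * C * K / V \<xi>) * ?G \<xi>) * emeasure M (ball \<xi> \<rho>)"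
        by (rule nn_integral_cmult_indicator) simp
      also have "\<dots> \<le> (ennreal (P h * C * K / V \<xi>) * ?G \<xi>) * ennreal (V \<xi>)"
        by (intro mult_left_mono emeasure_ball_le \<rho>) simp
      also have "\<dots> = (ennreal (P h * C * K / V \<xi>) * ennreal (V \<xi>)) * ?G \<xi>" by (simp only: mult_ac)
      also have "ennreal (P h * C * K / V \<xi>) * ennreal (V \<xi>) = ennreal (P h * C * K)"
        using P_pos[OF h_pos] C(1) K_pos V_pos[of \<xi>] by (simp flip: ennreal_mult)
      finally show "(\<integral>\<^sup>+\<zeta>. ennreal (P h * C * (1 / V \<zeta>)) * (?G \<xi> * ?I \<zeta> \<xi>) \<partial>M) \<le> ennreal (P h * C * K) * ?G \<xi>" .
    qed
    also have "\<dots> = ennreal (P h * C * K) * (\<integral>\<^sup>+\<xi>. ?G \<xi> \<partial>lborel)" by (rule nn_integral_cmult) measurable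
    finally have "(\<Sum>j<n. ennreal (co.sv j powr p)) \<le> ennreal A * (ennreal (P h * C * K) * (\<integral>\<^sup>+\<xi>. ?G \<xi> \<partial>lborel))"
      by (simp add: mult_left_mono)
    moreover have "ennreal A * ennreal (P h * C * K) = ennreal (A * (P h * C * K))"
      using P_pos[OF h_pos] C(1) K_pos by (intro ennreal_mult[symmetric]) (auto simp: A_def)
    ultimately show ?thesis by (simp only: mult.assoc[symmetric])
  qed
  have "(\<Sum>j. ennreal (co.sv j powr p)) \<le> ennreal (A * (P h * C * K)) * (\<integral>\<^sup>+\<xi>. ?G \<xi> \<partial>lborel)"
    by (rule suminf_le_const[OF summableI partial])
  also have "\<dots> < \<infinity>" using Lp by (simp add: s_def ennreal_mult_less_top)
  finally have "(\<Sum>j. ennreal (co.sv j powr p)) \<noteq> top" by simp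
  then have "summable (\<lambda>j. co.sv j powr p)"
    by (rule summable_suminf_not_top[rotated]) simp
  from conjI[OF comp exI[of "\<lambda>s. singular_values_on F ipF W s \<and> summable (\<lambda>n. s n powr p)", OF conjI[OF singular_values_sv[OF comp adj] this]]]
  show ?thesis unfolding schatten_W_def .
qed

section \<open>Agreement with the general operator-theoretic definitions\<close>

context
  fixes N :: "(complex \<Rightarrow> complex) \<Rightarrow> real" and ip :: "(complex \<Rightarrow> complex) \<Rightarrow> (complex \<Rightarrow> complex) \<Rightarrow> complex"
  assumes N: "\<And>f. f \<in> F \<Longrightarrow> N f = fs.nrm f" and N_nonneg: "\<And>f. 0 \<le> N f"
    and N_commute: "\<And>f g. N (\<lambda>z. f z - g z) = N (\<lambda>z. g z - f z)"
    and ip: "\<And>f g. f \<in> F \<Longrightarrow> g \<in> F \<Longrightarrow> ip f g = ipF f g"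
begin

lemma N_diff: "f \<in> F \<Longrightarrow> g \<in> F \<Longrightarrow> N (\<lambda>z. f z - g z) = fs.nrm (f - g)"
proof -
  assume fg: "f \<in> F" "g \<in> F"
  have "(\<lambda>z. f z - g z) = f - g" by (simp add: fun_eq_iff)
  then show ?thesis using N[OF fs.H_closed(4)[OF fg]] by simp
qed

text \<open>\<open>N\<close> agrees with the norm of \<open>F\<close> only on \<open>F\<close>, but
  nonnegativity and symmetry of the metric are demanded for all functions; this is why both are
  separate assumptions on \<open>N\<close>.\<close>

lemma metric_F: "Metric_space F (\<lambda>f g. N (\<lambda>z. f z - g z))"
proof
  fix f g k
  show "0 \<le> N (\<lambda>z. f z - g z)" by (rule N_nonneg)
  show "N (\<lambda>z. f z - g z) = N (\<lambda>z. g z - f z)" by (rule N_commute)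
  show "N (\<lambda>z. f z - g z) = 0 \<longleftrightarrow> f = g" if "f \<in> F" "g \<in> F"
    using fs.nrm_eq_0[OF fs.H_closed(4)[OF that]] unfolding N_diff[OF that] right_minus_eq .
  show "N (\<lambda>z. f z - k z) \<le> N (\<lambda>z. f z - g z) + N (\<lambda>z. g z - k z)" if "f \<in> F" "g \<in> F" "k \<in> F"
    unfolding N_diff[OF that(1,3)] N_diff[OF that(1,2)] N_diff[OF that(2,3)] by (rule fs.nrm_triangle_diff[OF that])
qed

interpretation metric: Metric_space F "\<lambda>f g. N (\<lambda>z. f z - g z)" by (rule metric_F)

lemma limitin_F:
  assumes "\<And>n. \<sigma> n \<in> F"
  shows "limitin metric.mtopology \<sigma> g sequentially \<longleftrightarrow> g \<in> F \<and> (\<lambda>n. fs.nrm (\<sigma> n - g)) \<longlonglongrightarrow> 0"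
proof -
  have "limitin metric.mtopology \<sigma> g sequentially \<longleftrightarrow> g \<in> F \<and> (\<lambda>n. N (\<lambda>z. \<sigma> n z - g z)) \<longlonglongrightarrow> 0"
    unfolding metric.limitin_metric_dist_null using assms by simp
  then show ?thesis using N_diff[OF assms] by (cases "g \<in> F") simp_all
qed

lemma mcomplete_F: "metric.mcomplete"
  unfolding metric.mcomplete_def
proof (intro allI impI)
  fix \<sigma> assume C: "metric.MCauchy \<sigma>"
  then have \<sigma>: "\<sigma> n \<in> F" for n by (auto simp: metric.MCauchy_def)
  have "\<exists>g\<in>F. (\<lambda>n. fs.nrm (\<sigma> n - g)) \<longlonglongrightarrow> 0"
  proof (rule complete_F[OF \<sigma>])
    fix \<epsilon> :: real assume "0 < \<epsilon>"
    then obtain k where "\<And>m n. k \<le> m \<Longrightarrow> k \<le> n \<Longrightarrow> N (\<lambda>z. \<sigma> m z - \<sigma> n z) < \<epsilon>"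
      using C unfolding metric.MCauchy_def by blast
    then show "\<exists>k. \<forall>m\<ge>k. \<forall>n\<ge>k. fs.nrm (\<sigma> m - \<sigma> n) < \<epsilon>" unfolding N_diff[OF \<sigma> \<sigma>] by blast
  qed
  then show "\<exists>x. limitin metric.mtopology \<sigma> x sequentially" using limitin_F[of \<sigma>, OF \<sigma>] by blast
qed

lemma operator_on_W: "operator_on F W \<longleftrightarrow> (\<forall>f\<in>F. W f \<in> F)"
  unfolding operator_on_def by (auto simp: weighted_comp_def fun_eq_iff algebra_simps)

lemma bounded_operator_on_iff: "bounded_operator_on F N W \<longleftrightarrow> bounded_W"
proof -
  have "bounded_operator_on F N W \<longleftrightarrow> (\<forall>f\<in>F. W f \<in> F) \<and> (\<exists>C. \<forall>f\<in>F. N (W f) \<le> C * N f)"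
    by (simp only: bounded_operator_on_def operator_on_W)
  also have "\<dots> \<longleftrightarrow> (\<forall>f\<in>F. W f \<in> F) \<and> (\<exists>C. \<forall>f\<in>F. fs.nrm (W f) \<le> C * fs.nrm f)"
    by (rule conj_cong[OF refl]) (simp add: N)
  also have "\<dots> \<longleftrightarrow> bounded_W" unfolding bounded_W_def by blast
  finally show ?thesis .
qed

text \<open>In a complete space a set has compact closure exactly when it is totally bounded. Total
  boundedness says that every sequence in the set has a Cauchy subsequence, and completeness
  supplies its limit in \<open>F\<close>.\<close>

lemma compact_operator_on_iff: "compact_operator_on F N W \<longleftrightarrow> compact_W"
proof -
  let ?B = "{f \<in> F. N f \<le> 1}"
  have closure: "compactin metric.mtopology (metric.mtopology closure_of (W ` ?B)) \<longleftrightarrow> metric.mtotally_bounded (W ` ?B)"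
    if W: "\<forall>f\<in>F. W f \<in> F"
    using metric.mtotally_bounded_eq_compact_closure_of[OF mcomplete_F, of "W ` ?B"] W by auto
  have seq: "metric.mtotally_bounded (W ` ?B) \<longleftrightarrow> (\<forall>\<sigma>. (\<forall>n. \<sigma> n \<in> F \<and> fs.nrm (\<sigma> n) \<le> 1) \<longrightarrow>
    (\<exists>r g. strict_mono (r :: nat \<Rightarrow> nat) \<and> g \<in> F \<and> (\<lambda>n. fs.nrm (W (\<sigma> (r n)) - g)) \<longlonglongrightarrow> 0))" (is "_ \<longleftrightarrow> ?R")
    if W: "\<forall>f\<in>F. W f \<in> F"
  proof
    assume tb: "metric.mtotally_bounded (W ` ?B)"
    show ?R
    proof (intro allI impI)
      fix \<sigma> :: "nat \<Rightarrow> complex \<Rightarrow> complex" assume \<sigma>: "\<forall>n. \<sigma> n \<in> F \<and> fs.nrm (\<sigma> n) \<le> 1"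
      then have "range (\<lambda>n. W (\<sigma> n)) \<subseteq> W ` ?B" by (auto simp: N)
      then obtain r where r: "strict_mono r" "metric.MCauchy ((\<lambda>n. W (\<sigma> n)) \<circ> r)"
        using tb unfolding metric.mtotally_bounded_sequentially by blast
      then obtain g where "limitin metric.mtopology (\<lambda>n. W (\<sigma> (r n))) g sequentially"
        using mcomplete_F unfolding metric.mcomplete_def o_def by blast
      then have "g \<in> F \<and> (\<lambda>n. fs.nrm (W (\<sigma> (r n)) - g)) \<longlonglongrightarrow> 0"
        using limitin_F[of "\<lambda>n. W (\<sigma> (r n))" g] W \<sigma> by simp
      then show "\<exists>r g. strict_mono (r :: nat \<Rightarrow> nat) \<and> g \<in> F \<and> (\<lambda>n. fs.nrm (W (\<sigma> (r n)) - g)) \<longlonglongrightarrow> 0"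
        using r(1) by blast
    qed
  next
    assume R: ?R
    show "metric.mtotally_bounded (W ` ?B)"
      unfolding metric.mtotally_bounded_sequentially
    proof (intro conjI allI impI)
      show "W ` ?B \<subseteq> F" using W by auto
      fix \<tau> :: "nat \<Rightarrow> complex \<Rightarrow> complex" assume "range \<tau> \<subseteq> W ` ?B"
      then have "\<forall>n. \<exists>f. f \<in> F \<and> N f \<le> 1 \<and> \<tau> n = W f" by blast
      from choice[OF this] obtain \<sigma> where \<sigma>: "\<And>n. \<sigma> n \<in> F" "\<And>n. N (\<sigma> n) \<le> 1" "\<And>n. \<tau> n = W (\<sigma> n)" by blast
      have "\<forall>n. \<sigma> n \<in> F \<and> fs.nrm (\<sigma> n) \<le> 1" using \<sigma> N by simp
      with R obtain r g where r: "strict_mono (r :: nat \<Rightarrow> nat)" and g: "g \<in> F" "(\<lambda>n. fs.nrm (W (\<sigma> (r n)) - g)) \<longlonglongrightarrow> 0"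
        by blast
      have "limitin metric.mtopology (\<lambda>n. W (\<sigma> (r n))) g sequentially"
        using limitin_F[of "\<lambda>n. W (\<sigma> (r n))" g] W \<sigma>(1) g by simp
      then have "metric.MCauchy (\<lambda>n. W (\<sigma> (r n)))"
        using W \<sigma>(1) by (intro metric.convergent_imp_MCauchy) auto
      then show "\<exists>r. strict_mono r \<and> metric.MCauchy (\<tau> \<circ> r)"
        using r \<sigma>(3) by (intro exI[of _ r]) (simp add: o_def)
    qed
  qed
  show ?thesis
    unfolding compact_operator_on_def operator_on_W norm_topology_def compact_W_def
    using closure seq by blast
qed

lemma singular_values_on_iff:
  assumes "\<forall>f\<in>F. W f \<in> F"
  shows "singular_values_on F ip W s \<longleftrightarrow> singular_values_on F ipF W s"
proof -
  have "is_adjoint_on F ip W S \<longleftrightarrow> is_adjoint_on F ipF W S" for S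
    unfolding is_adjoint_on_def
  proof (rule conj_cong[OF refl])
    assume "operator_on F S"
    then have "\<forall>g\<in>F. S g \<in> F" by (auto simp: operator_on_def)
    then show "(\<forall>f\<in>F. \<forall>g\<in>F. ip (W f) g = ip f (S g)) \<longleftrightarrow> (\<forall>f\<in>F. \<forall>g\<in>F. ipF (W f) g = ipF f (S g))"
      using assms by (simp add: ip)
  qed
  then show ?thesis by (simp only: singular_values_on_def)
qed

lemma schatten_class_on_iff: "schatten_class_on F N ip p W \<longleftrightarrow> schatten_W p"
  unfolding schatten_class_on_def schatten_W_def compact_operator_on_iff
proof (rule conj_cong[OF refl])
  assume compact_W
  then have "\<forall>f\<in>F. W f \<in> F" by (simp add: compact_W_def)
  then show "(\<exists>s. singular_values_on F ip W s \<and> summable (\<lambda>n. s n powr p))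
    \<longleftrightarrow> (\<exists>s. singular_values_on F ipF W s \<and> summable (\<lambda>n. s n powr p))"
    by (simp only: singular_values_on_iff)
qed

end

end

section \<open>The characterisation for restricted Muckenhoupt weights\<close>

theorem corollary6p2:
  fixes \<alpha> :: real and w :: "complex \<Rightarrow> real" and \<phi> \<psi> :: "complex \<Rightarrow> complex"
  assumes "\<alpha> > 0"
    and "w \<in> A_infinity_restricted"
    and "\<phi> holomorphic_on UNIV"
    and "\<psi> holomorphic_on UNIV"
  defines "H \<equiv> fock_space \<alpha> w"
    and "N \<equiv> fock_norm \<alpha> w"
    and "ip \<equiv> fock_inner \<alpha> w"
    and "W \<equiv> weighted_comp \<phi> \<psi>"
    and "\<Phi> \<equiv> averaging_fun \<alpha> w \<phi> \<psi>"
  shows "\<exists>\<delta>. 0 < \<delta> \<and> \<delta> < 1 \<and>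
    (bounded_operator_on H N W \<longleftrightarrow> (\<exists>r\<in>{0<..<\<delta>}. (SUP z. \<Phi> r z) < \<infinity>)) \<and>
    (bounded_operator_on H N W \<longleftrightarrow> (\<forall>r\<in>{0<..<\<delta>}. (SUP z. \<Phi> r z) < \<infinity>)) \<and>
    (compact_operator_on H N W \<longleftrightarrow> (\<exists>r\<in>{0<..<\<delta>}. vanishes_at_infinity (\<Phi> r))) \<and>
    (compact_operator_on H N W \<longleftrightarrow> (\<forall>r\<in>{0<..<\<delta>}. vanishes_at_infinity (\<Phi> r))) \<and>
    (\<forall>p\<ge>2.
      (schatten_class_on H N ip p W \<longleftrightarrow> (\<exists>r\<in>{0<..<\<delta>}. in_Lp (p / 2) (\<Phi> r))) \<and>
      (schatten_class_on H N ip p W \<longleftrightarrow> (\<forall>r\<in>{0<..<\<delta>}. in_Lp (p / 2) (\<Phi> r))))"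
proof -
  have weight: "is_weight w" using assms(2) by (auto simp: A_infinity_restricted_def A_restricted_def)
  then have w_nonneg: "0 \<le> w z" for z by (simp add: is_weight_def)
  have w_meas [measurable]: "w \<in> borel_measurable lebesgue" by (rule weight_measurable[OF weight])
  obtain w' where w': "w' \<in> borel_measurable lborel" "AE z in lborel. w z = w' z"
    using completion_ex_borel_measurable_real[OF w_meas] by blast
  \<comment> \<open>\<open>w\<close> is only Lebesgue measurable, while the locales work with measures on Borel sets.\<close>
  define w\<^sub>0 where "w\<^sub>0 z = max 0 (w' z)" for z
  have w0 [measurable]: "w\<^sub>0 \<in> borel_measurable borel" using w'(1) unfolding w\<^sub>0_def by measurable
  have w0_nonneg: "0 \<le> w\<^sub>0 z" for z by (simp add: w\<^sub>0_def)
  have eq: "AE z in lborel. w z = w\<^sub>0 z" using w'(2) by eventually_elim (metis w\<^sub>0_def max_absorb2 w_nonneg)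
  define M where "M = density lborel (\<lambda>z. ennreal (w\<^sub>0 z))"
  obtain h q c where "doubling_measure M h q c"
    using A_infinity_doubling[OF assms(2) w0 eq] unfolding M_def by blast
  then interpret doubling_measure M h q c .
  interpret wc: weighted_composition M h q c \<alpha> \<phi> \<psi>
    by unfold_locales (use assms in auto)

  \<comment> \<open>Common translation of the nonnegative integrals in the definitions into
    integrals against \<open>M\<close>: those over the plane give the energy, those over disks and
    their preimages give \<Phi>.\<close>
  have nn: "(\<integral>\<^sup>+z. ennreal (g z * w z) * indicator E z \<partial>lebesgue) = (\<integral>\<^sup>+z. ennreal (g z) * indicator E z \<partial>M)"
    if [measurable]: "g \<in> borel_measurable borel" and "\<And>z. 0 \<le> g z" and [measurable]: "E \<in> sets borel" for g :: "complex \<Rightarrow> real" and E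
  proof -
    have "(\<integral>\<^sup>+z. ennreal (g z * w z) * indicator E z \<partial>lebesgue) = (\<integral>\<^sup>+z. ennreal (g z * w z) * indicator E z \<partial>lborel)"
      by (rule nn_integral_completion)
    also have "\<dots> = (\<integral>\<^sup>+z. ennreal (w\<^sub>0 z) * (ennreal (g z) * indicator E z) \<partial>lborel)"
      by (rule nn_integral_cong_AE) (use eq in eventually_elim, simp add: ennreal_mult that(2) w0_nonneg mult_ac)
    also have "\<dots> = (\<integral>\<^sup>+z. ennreal (g z) * indicator E z \<partial>M)"
      unfolding M_def by (rule nn_integral_density[symmetric]) measurable
    finally show ?thesis .
  qed
  have "(\<integral>\<^sup>+z. ennreal ((cmod (f z))\<^sup>2 * exp (- \<alpha> * (cmod z)\<^sup>2) * w z) \<partial>lebesgue) = wc.energy f"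
    if f: "f holomorphic_on UNIV" for f
  proof -
    have [measurable]: "f \<in> borel_measurable borel" using f by (rule wc.holomorphic_measurable)
    show ?thesis using nn[of "\<lambda>z. (cmod (f z))\<^sup>2 * wc.gs z" UNIV] by (simp add: wc.energy_def wc.gs_def)
  qed
  then have H: "H = wc.F" unfolding H_def fock_space_def wc.F_def by auto
  have ip: "ip f g = wc.ipF f g" if fg: "f \<in> wc.F" "g \<in> wc.F" for f g
  proof -
    have [measurable]: "f \<in> borel_measurable borel" "g \<in> borel_measurable borel" using fg by (auto dest: wc.F_measurable)
    have "(\<lambda>z. cnj (g z)) \<in> borel_measurable borel"
      by (rule measurable_compose[OF _ borel_measurable_continuous_onI[of cnj]]) (auto intro!: continuous_intros)
    moreover have "(\<lambda>z. complex_of_real (wc.gs z)) \<in> borel_measurable borel"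
      unfolding wc.gs_def by (intro borel_measurable_continuous_onI continuous_intros)
    ultimately have k [measurable]: "(\<lambda>z. f z * cnj (g z) * of_real (wc.gs z)) \<in> borel_measurable borel" by measurable
    have k' [measurable]: "(\<lambda>z. f z * cnj (g z) * of_real (wc.gs z)) \<in> borel_measurable lebesgue"
      using k by (auto intro: measurable_completion)
    have "ip f g = (LINT z|lebesgue. w z *\<^sub>R (f z * cnj (g z) * of_real (wc.gs z)))"
      unfolding ip_def fock_inner_def wc.gs_def by (intro Bochner_Integration.integral_cong refl) (simp add: scaleR_conv_of_real mult_ac)
    also have "\<dots> = (LINT z|lebesgue. w\<^sub>0 z *\<^sub>R (f z * cnj (g z) * of_real (wc.gs z)))"
    proof (rule integral_cong_AE)
      show "(\<lambda>z. w\<^sub>0 z *\<^sub>R (f z * cnj (g z) * of_real (wc.gs z))) \<in> borel_measurable lebesgue"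
        by (rule measurable_completion) measurable
      show "AE z in lebesgue. w z *\<^sub>R (f z * cnj (g z) * of_real (wc.gs z)) = w\<^sub>0 z *\<^sub>R (f z * cnj (g z) * of_real (wc.gs z))"
        using AE_completion[OF eq] by eventually_elim simp
    qed measurable
    also have "\<dots> = (LINT z|lborel. w\<^sub>0 z *\<^sub>R (f z * cnj (g z) * of_real (wc.gs z)))"
      by (rule integral_completion) measurable
    also have "\<dots> = (LINT z|M. f z * cnj (g z) * of_real (wc.gs z))"
      unfolding M_def by (rule integral_density[symmetric]) (use w0_nonneg k in auto)
    also have "\<dots> = wc.ipF f g" by (simp only: wc.ipF_def)
    finally show ?thesis .
  qed
  have N: "N f = wc.fs.nrm f" if f: "f \<in> wc.F" for f
  proof -
    have "complex_of_real ((N f)\<^sup>2) = of_real ((wc.fs.nrm f)\<^sup>2)"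
      using ip[OF f f] unfolding wc.fs.ip_self[OF f] ip_def fock_inner_self[OF weight] N_def .
    then have "(N f)\<^sup>2 = (wc.fs.nrm f)\<^sup>2" by (simp only: of_real_eq_iff)
    moreover have "0 \<le> N f"
      unfolding N_def fock_norm_def by (intro real_sqrt_ge_zero Bochner_Integration.integral_nonneg) (simp add: w_nonneg)
    ultimately show ?thesis using wc.fs.nrm_nonneg[OF f] by (simp add: power2_eq_iff_nonneg)
  qed
  have N_nonneg: "0 \<le> N f" for f
    unfolding N_def fock_norm_def by (intro real_sqrt_ge_zero Bochner_Integration.integral_nonneg) (simp add: w_nonneg)
  have N_commute: "N (\<lambda>z. f z - g z) = N (\<lambda>z. g z - f z)" for f g
    unfolding N_def fock_norm_def by (simp add: norm_minus_commute)
  have \<Phi>: "\<Phi> r z = wc.\<Phi> r z" for r z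
  proof -
    have [measurable]: "\<phi> -` ball z r \<in> sets borel"
      using measurable_sets[OF wc.\<phi>_meas, of "ball z r"] by simp
    have "weight_measure w (ball z r) = emeasure M (ball z r)"
      using nn[of "\<lambda>_. 1" "ball z r"] unfolding weight_measure_def by simp
    moreover have "(\<integral>\<^sup>+\<xi>\<in>\<phi> -` ball z r. ennreal ((cmod (\<psi> \<xi>))\<^sup>2 * exp (- \<alpha> * ((cmod \<xi>)\<^sup>2 - (cmod (\<phi> \<xi>))\<^sup>2)) * w \<xi>) \<partial>lebesgue)
      = wc.pull r z"
      unfolding wc.pull_def wc.u_def
      using nn[of "\<lambda>\<xi>. (cmod (\<psi> \<xi>))\<^sup>2 * exp (- \<alpha> * ((cmod \<xi>)\<^sup>2 - (cmod (\<phi> \<xi>))\<^sup>2))" "\<phi> -` ball z r"]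
      by (simp add: indicator_vimage)
    ultimately show ?thesis unfolding \<Phi>_def averaging_fun_def wc.\<Phi>_def by simp
  qed
  have \<Phi>_eq: "\<Phi> = wc.\<Phi>" by (intro ext) (rule \<Phi>)
  have Lp: "in_Lp s (wc.\<Phi> r) \<longleftrightarrow> (\<integral>\<^sup>+z. ennreal_rpow (wc.\<Phi> r z) s \<partial>lborel) < \<infinity>" for s r
    unfolding in_Lp_def nn_integral_completion using wc.\<Phi>_meas[of r] by (auto intro: measurable_completion)

  have iffs: "bounded_operator_on wc.F N wc.W \<longleftrightarrow> wc.bounded_W"
    "compact_operator_on wc.F N wc.W \<longleftrightarrow> wc.compact_W"
    "schatten_class_on wc.F N ip p wc.W \<longleftrightarrow> wc.schatten_W p" for p
    by (rule wc.bounded_operator_on_iff[of N ip] wc.compact_operator_on_iff[of N ip] wc.schatten_class_on_iff[of N ip];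
        rule N N_nonneg N_commute ip; assumption)+
  \<comment> \<open>Every radius below \<delta> is at most \<open>h\<close>, as all estimates
    require; 1/2 keeps \<delta> below 1.\<close>
  define \<delta> where "\<delta> = min (1 / 2) h"
  have \<delta>: "0 < \<delta>" "\<delta> < 1" using h_pos by (auto simp: \<delta>_def)
  have r: "0 < r" "r \<le> h" if "r \<in> {0<..<\<delta>}" for r using that by (auto simp: \<delta>_def)
  have ne: "\<delta> / 2 \<in> {0<..<\<delta>}" using \<delta> by simp
  \<comment> \<open>Both implications are available at every single radius, so the two quantifiers
    agree once the interval is known to be nonempty; \<open>ne\<close> provides the radius.\<close>
  have some_any: "(X \<longleftrightarrow> (\<exists>r\<in>{0<..<\<delta>}. Y r)) \<and> (X \<longleftrightarrow> (\<forall>r\<in>{0<..<\<delta>}. Y r))"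
    if "\<And>r. r \<in> {0<..<\<delta>} \<Longrightarrow> Y r \<Longrightarrow> X" "\<And>r. r \<in> {0<..<\<delta>} \<Longrightarrow> X \<Longrightarrow> Y r" for X :: bool and Y
    using that ne by blast
  have 1: "(wc.bounded_W \<longleftrightarrow> (\<exists>r\<in>{0<..<\<delta>}. (SUP z. wc.\<Phi> r z) < \<infinity>)) \<and>
    (wc.bounded_W \<longleftrightarrow> (\<forall>r\<in>{0<..<\<delta>}. (SUP z. wc.\<Phi> r z) < \<infinity>))"
    by (rule some_any) (rule wc.bounded_if_sup_finite wc.sup_finite_if_bounded; (rule r)?; assumption)+
  have 2: "(wc.compact_W \<longleftrightarrow> (\<exists>r\<in>{0<..<\<delta>}. vanishes_at_infinity (wc.\<Phi> r))) \<and>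
    (wc.compact_W \<longleftrightarrow> (\<forall>r\<in>{0<..<\<delta>}. vanishes_at_infinity (wc.\<Phi> r)))"
    by (rule some_any) (rule wc.compact_if_vanishes wc.vanishes_if_compact; (rule r)?; assumption)+
  have 3: "(wc.schatten_W p \<longleftrightarrow> (\<exists>r\<in>{0<..<\<delta>}. in_Lp (p / 2) (wc.\<Phi> r))) \<and>
    (wc.schatten_W p \<longleftrightarrow> (\<forall>r\<in>{0<..<\<delta>}. in_Lp (p / 2) (wc.\<Phi> r)))" if p: "2 \<le> p" for p
    unfolding Lp by (rule some_any) (rule wc.schatten_if_in_Lp wc.in_Lp_if_schatten; (rule r p)?; assumption?)+
  show ?thesis
    unfolding H \<Phi>_eq W_def iffs
    by (intro exI[of _ \<delta>] conjI allI impI)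
      (rule \<delta> 1[THEN conjunct1] 1[THEN conjunct2] 2[THEN conjunct1] 2[THEN conjunct2] 3[THEN conjunct1] 3[THEN conjunct2];
        assumption?)+
qed

end
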